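(* Let $\alpha\in(0,1)$, $\beta\in(0,2]$, $d\in\mathbb{Z}_+$ and $r>0$. Suppose $u$ is a mild solution in $[0,T]\times\mathbb{R}^d$ of the Cauchy problem $$\partial_t^\alpha(u-u_0)+(-\Delta)^{\beta/2}u=0,\qquad u(0,x)=u_0(x),$$ with nonnegative and sufficiently smooth initial data $u_0\not\equiv0$. Suppose further that $t_1$ and $t_2$ satisfy $$(2r)^{\beta/\alpha}\le t_1<t_2\le t_1+(2r)^{\beta/\alpha}\le T.$$ Then there exists a constant $C=C(d,\alpha,\beta,t_2/t_1)>0$ such that for all $x_1,x_2\in B_r(0)$ there holds $$u(t_1,x_1)\le C\left[1+\frac{[G\star(u_0\chi_{B_{r_1}(x_1)})](x_1)}{[G\star(u_0\chi_{B_{r_2}(x_2)})](x_2)}\right]u(t_2,x_2),\quad\text{if } d>\beta,$$ and, if $d=\beta$, $$u(t_1,x_1)\le C\left[1+\frac{\big[(c+\alpha\log t_1-\beta\,c(d,\beta)G)\star(\chi_{B_{r_1}(x_1)}u_0)\big](x_1)}{\big[(c+\alpha\log t_2-\beta\,c(d,\beta)G)\star(\chi_{B_{r_2}(x_2)}u_0)\big](x_2)}\right]u(t_2,x_2),$$ where $c=1+\beta\log2$ and $r_i=2t_i^{\alpha/\beta}$, $i=1,2$. Moreover, when $\beta=2$, the constant $C$ blows up as $t_2\to t_1$.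
   Context: For $0<\alpha<1$, $\partial_t^\alpha$ is the Riemann-Liouville fractional derivative in time, $\partial_t^\alpha f(t)=\frac{d}{dt}\frac{1}{\Gamma(1-\alpha)}\int_0^t(t-\tau)^{-\alpha}f(\tau)\,d\tau$, and $(-\Delta)^{\beta/2}$ acts in space as the Fourier multiplier with symbol $|\xi|^\beta$. The mild solution of the Cauchy problem is the function $u(t,x)=\int_{\mathbb{R}^d}Z(t,x-y)u_0(y)\,dy$, whenever this integral is well defined. Here $Z$ is the fundamental solution, i.e. for each $t>0$ the probability density $Z(t,\cdot)$ on $\mathbb{R}^d$ (continuous on $\mathbb{R}^d\setminus\{0\}$) with Fourier transform $\widehat Z(t,\xi)=(2\pi)^{-d/2}E_\alpha(-|\xi|^\beta t^\alpha)$, where $\widehat f(\xi)=(2\pi)^{-d/2}\int_{\mathbb{R}^d}e^{-ix\cdot\xi}f(x)\,dx$ and $E_\alpha(z)=\sum_{k=0}^\infty z^k/\Gamma(1+\alpha k)$ is the Mittag-Leffler function. The symbol $\star$ denotes convolution in the space variable, $\chi_A$ is the characteristic function of $A\subset\mathbb{R}^d$, and $B_\rho(x)$ is the ball of radius $\rho$ centered at $x$. The kernel $G$ is $$G(x)=\frac{1}{c(d,\beta)}\begin{cases}|x|^{\beta-d},& d>\beta,\\ \log|x|,& d=\beta,\end{cases}$$ where $c(d,\beta)$ is the (nonzero) normalization constant of the corresponding Riesz/Newtonian kernel, so that $v=G\star u_0$ satisfies $(-\Delta)^{\beta/2}v\ge0$ in $\mathbb{R}^d$ for nonnegative, sufficiently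 smooth $u_0$. In particular, for $d=\beta$ one has $c(d,\beta)G(x)=\log|x|$. A ratio with vanishing denominator is read as $+\infty$. *)

theory Defs
  imports "HOL-Analysis.Analysis"
begin

text \<open>The space $\mathbb{R}^d$ is an arbitrary Euclidean space \<open>'a\<close> with \<open>DIM('a) = d\<close>.\<close>

definition mittag_leffler :: "real \<Rightarrow> real \<Rightarrow> real" where
  "mittag_leffler \<alpha> z = (\<Sum>k. z ^ k / Gamma (1 + \<alpha> * real k))"

definition fourier_transform :: "('a::euclidean_space \<Rightarrow> real) \<Rightarrow> 'a \<Rightarrow> complex" where
  "fourier_transform f \<xi> =
     complex_of_real ((2 * pi) powr (- real DIM('a) / 2)) *
     (LINT x|lborel. exp (- \<i> * complex_of_real (x \<bullet> \<xi>)) * complex_of_real (f x))"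

text \<open>For \<open>d \<ge> \<beta>\<close> the density \<open>Z t\<close> is unbounded at the origin, so the real number \<open>Z t 0\<close>
  carries no meaning; off the origin, these conditions determine \<open>Z t\<close> for every \<open>t > 0\<close>.\<close>

definition fundamental_solution ::
    "real \<Rightarrow> real \<Rightarrow> (real \<Rightarrow> 'a::euclidean_space \<Rightarrow> real) \<Rightarrow> bool" where
  "fundamental_solution \<alpha> \<beta> Z \<longleftrightarrow>
     (\<forall>t>0. (\<forall>x. 0 \<le> Z t x) \<and>
            has_bochner_integral lborel (Z t) 1 \<and>
            continuous_on (- {0}) (Z t) \<and>
            (\<forall>\<xi>. fourier_transform (Z t) \<xi> =
              complex_of_real ((2 * pi) powr (- real DIM('a) / 2) *
                mittag_leffler \<alpha> (- (norm \<xi> powr \<beta>) * t powr \<alpha>))))"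

text \<open>Mild solutions on $[0,T] \times \mathbb{R}^d$ of
  $\partial_t^\alpha (u - u_0) + (-\Delta)^{\beta/2} u = 0$, $u(0,\cdot) = u_0$. They are given by
  the representation formula, which is required to be well defined at every point with
  \<open>0 < t \<le> T\<close>; at \<open>t = 0\<close>, where there is no kernel, the initial condition is used.\<close>

definition mild_solution ::
    "real \<Rightarrow> real \<Rightarrow> real \<Rightarrow> ('a::euclidean_space \<Rightarrow> real) \<Rightarrow> (real \<Rightarrow> 'a \<Rightarrow> real) \<Rightarrow> bool" where
  "mild_solution \<alpha> \<beta> T u0 u \<longleftrightarrow>
     (\<exists>Z. fundamental_solution \<alpha> \<beta> Z \<and>
          (\<forall>x. u 0 x = u0 x) \<and>
          (\<forall>t x. 0 < t \<and> t \<le> T \<longrightarrow>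
             integrable lborel (\<lambda>y. Z t (x - y) * u0 y) \<and>
             u t x = (LINT y|lborel. Z t (x - y) * u0 y)))"

primrec cont_differentiable :: "nat \<Rightarrow> ('a::euclidean_space \<Rightarrow> real) \<Rightarrow> bool" where
  "cont_differentiable 0 f \<longleftrightarrow> continuous_on UNIV f"
| "cont_differentiable (Suc n) f \<longleftrightarrow>
     f differentiable_on UNIV \<and>
     (\<forall>v. cont_differentiable n (\<lambda>x. frechet_derivative f (at x) v))"

text \<open>The class $C^k$, including $k = \infty$.\<close>

definition smooth_of_order :: "enat \<Rightarrow> ('a::euclidean_space \<Rightarrow> real) \<Rightarrow> bool" where
  "smooth_of_order k f \<longleftrightarrow> (\<forall>n. enat n \<le> k \<longrightarrow> cont_differentiable n f)"

definition space_conv ::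
    "('a::euclidean_space \<Rightarrow> real) \<Rightarrow> ('a \<Rightarrow> real) \<Rightarrow> 'a \<Rightarrow> real" (infixl "\<star>" 75) where
  "(f \<star> g) x = (LINT y|lborel. f (x - y) * g y)"

text \<open>The constant $c(d,\beta)$ for which $(-\Delta)^{\beta/2} G$ is the Dirac measure at the
  origin. For \<open>d = \<beta>\<close> it is negative. The case \<open>d < \<beta>\<close> is never used, neither here nor in
  \<open>riesz_kernel\<close>. The values \<open>0 powr _ = 0\<close> and \<open>ln 0 = 0\<close> affect the kernel only at the
  origin, a null set.\<close>

definition riesz_const :: "nat \<Rightarrow> real \<Rightarrow> real" where
  "riesz_const d \<beta> =
     (if real d > \<beta>
      then 2 powr \<beta> * pi powr (real d / 2) * Gamma (\<beta> / 2) / Gamma ((real d - \<beta>) / 2)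
      else - (2 powr (real d - 1) * pi powr (real d / 2) * Gamma (real d / 2)))"

definition riesz_kernel :: "real \<Rightarrow> 'a::euclidean_space \<Rightarrow> real" where
  "riesz_kernel \<beta> x =
     1 / riesz_const DIM('a) \<beta> *
     (if real DIM('a) > \<beta> then norm x powr (\<beta> - real DIM('a)) else ln (norm x))"

text \<open>Division in \<^typ>\<open>ereal\<close> gives \<open>0 / 0 = 0\<close>; here every ratio with vanishing denominator,
  including this one, is infinite.\<close>

definition ext_ratio :: "real \<Rightarrow> real \<Rightarrow> ereal" where
  "ext_ratio a b = (if b = 0 then \<infinity> else ereal (a / b))"

text \<open>The two ratios, for \<open>d > \<beta>\<close> and for \<open>d = \<beta>\<close>.\<close>

definition riesz_ratio ::
    "real \<Rightarrow> real \<Rightarrow> ('a::euclidean_space \<Rightarrow> real) \<Rightarrow> real \<Rightarrow> real \<Rightarrow> 'a \<Rightarrow> 'a \<Rightarrow> ereal" where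
  "riesz_ratio \<alpha> \<beta> u0 t1 t2 x1 x2 =
     (let part = (\<lambda>t x. (riesz_kernel \<beta> \<star>
                   (\<lambda>y. u0 y * indicat_real (ball x (2 * t powr (\<alpha> / \<beta>))) y)) x)
      in ext_ratio (part t1 x1) (part t2 x2))"

definition log_ratio ::
    "real \<Rightarrow> real \<Rightarrow> ('a::euclidean_space \<Rightarrow> real) \<Rightarrow> real \<Rightarrow> real \<Rightarrow> 'a \<Rightarrow> 'a \<Rightarrow> ereal" where
  "log_ratio \<alpha> \<beta> u0 t1 t2 x1 x2 =
     (let c = 1 + \<beta> * ln 2;
          part = (\<lambda>t x. ((\<lambda>z. c + \<alpha> * ln t - \<beta> * riesz_const DIM('a) \<beta> * riesz_kernel \<beta> z) \<star>
                   (\<lambda>y. indicat_real (ball x (2 * t powr (\<alpha> / \<beta>))) y * u0 y)) x)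
      in ext_ratio (part t1 x1) (part t2 x2))"

text \<open>\<open>harnack_constant TYPE('a) k \<alpha> \<beta> C\<close>: the function \<open>C\<close> of \<open>t2 / t1\<close> is a constant for which
  the Harnack inequality holds in $\mathbb{R}^d$ for all nonnegative nonzero initial data of class
  $C^k$. It may depend on \<open>d\<close>, \<open>\<alpha>\<close>, \<open>\<beta>\<close> and \<open>k\<close>, but not on \<open>r\<close>, \<open>T\<close> or the solution.\<close>

definition harnack_constant ::
    "'a::euclidean_space itself \<Rightarrow> enat \<Rightarrow> real \<Rightarrow> real \<Rightarrow> (real \<Rightarrow> real) \<Rightarrow> bool" where
  "harnack_constant _ k \<alpha> \<beta> C \<longleftrightarrow>
     (\<forall>s>1. C s > 0) \<and>
     (\<forall>r T (u0 :: 'a \<Rightarrow> real) u t1 t2.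
        0 < r \<and>
        smooth_of_order k u0 \<and> (\<forall>x. 0 \<le> u0 x) \<and> (\<exists>x. u0 x \<noteq> 0) \<and>
        mild_solution \<alpha> \<beta> T u0 u \<and>
        (2 * r) powr (\<beta> / \<alpha>) \<le> t1 \<and> t1 < t2 \<and>
        t2 \<le> t1 + (2 * r) powr (\<beta> / \<alpha>) \<and> t1 + (2 * r) powr (\<beta> / \<alpha>) \<le> T \<longrightarrow>
        (\<forall>x1 \<in> ball 0 r. \<forall>x2 \<in> ball 0 r.
           (real DIM('a) > \<beta> \<longrightarrow>
              ereal (u t1 x1) \<le>
                ereal (C (t2 / t1)) * (1 + riesz_ratio \<alpha> \<beta> u0 t1 t2 x1 x2) * ereal (u t2 x2)) \<and>
           (real DIM('a) = \<beta> \<longrightarrow>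
              ereal (u t1 x1) \<le>
                ereal (C (t2 / t1)) * (1 + log_ratio \<alpha> \<beta> u0 t1 t2 x1 x2) * ereal (u t2 x2))))"

end

theory Submission
  imports Defs "HOL-Probability.Probability" "HOL-Real_Asymp.Real_Asymp"
begin

text \<open>The Harnack inequality comes from one structural fact: the fundamental solution is a
mixture of Gaussians. With $\tau = t^{2\alpha/\beta}$ and the heat kernel
$h_s(x) = (4\pi s)^{-d/2} e^{-|x|^2/4s}$ there is a probability measure $N$ on $(0,\infty)$, the same
for all $t$, with $Z(t,x) = \int h_{\tau s}(x)\, dN(s)$ for $x \neq 0$. Since the Gaussian of variance
parameter $s$ has Fourier transform $e^{-s|\xi|^2}$, this says that $N$ has the Laplace transform
$E_\alpha(-\lambda^{\beta/2})$. Three properties of $Z$ can be read off: it scales, $Z(t,x) =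
\tau^{-d/2} Z(1, x/\sqrt\tau)$; it is radially decreasing and strictly positive; and its singularity at
the origin is governed by the mass of $N$ near $0$, that is, by the decay of
its Laplace transform: $E_\alpha(-z)$ is comparable to $1/(1+z)$.

The class \<open>comp_mono\<close> consists of the pointwise
limits of positive combinations of decaying exponentials. It is closed under sums, products
and the substitution $\lambda \mapsto \lambda^\gamma$ with $0 < \gamma \le 1$, and by Helly selection its members are
Laplace transforms (\<open>comp_mono_rep\<close>, \<open>comp_mono_laplace\<close>). That $E_\alpha(-\lambda)$ is a member is proved by
discretising $v + c\, I^\alpha v = 1$, the equation solved by $v(t) = E_\alpha(-c t^\alpha)$, with $I^\alpha$
replaced by the sequence operator of generating function $(1-X)^{-\alpha}$. The discrete solution is a
polynomial with nonnegative coefficients in $1/(1+c)$ (\<open>discrete_ml_rec\<close>), it converges to the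
Mittag-Leffler function (\<open>discrete_ml_limit\<close>), and its monotonicity in time yields the two-sided bounds
\<open>mittag_leffler_upper\<close> and \<open>mittag_leffler_lower\<close>.

Uniqueness of Fourier transforms (\<open>fourier_inj\<close>) identifies every fundamental
solution with the mixture off the origin. For $|z| < 2t^{\alpha/\beta}$ the kernel $Z(t,z)$ is comparable to
$t^{-\alpha}$ times the Riesz or logarithmic kernel (\<open>mixture_near_origin\<close>); this handles the data in the
two balls and produces the ratio. For $|x_1 - y| \ge 2t_1^{\alpha/\beta}$ the inequality
$Z(t_1,x_1-y) \le D\, Z(t_2,x_2-y)$ follows from monotonicity (\<open>mixture_outside\<close>): in
self-similar variables the later time contracts distances by the factor $q = (t_1/t_2)^{\alpha/\beta} < 1$,
which for large $|x_1-y|$ outweighs the shift from $x_1$ to $x_2$, so that the decreasing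
profile gives the bound in self-similar variables with $D = 1$, and the remaining range of distances
is compact. Both facts are put together in \<open>harnack_from_kernel_bounds\<close>.

For $\beta = 2$ the profile decays faster than every exponential, because
$E_\alpha$ is entire. Hence $u_0(y) = e^{A e\cdot y} + B$ is admissible, and it has the explicit solution
$u(t,x) = e^{A e \cdot x} E_\alpha(A^2 t^\alpha) + B$. The constant $B = e^{9A/4}$ keeps the ratio of the local
potentials at most $2$, and it is negligible against $E_\alpha(A^2)$, which grows like $e^{cA^{2/\alpha}}$. At
$x_1 = e/4$, $x_2 = -e/4$ the quotient $u(1,x_1)/u(s,x_2)$ therefore tends, as $s \to 1$, to
roughly $e^{A/2}$, and $A$ is arbitrary (\<open>harnack_constant_lower_bound\<close>).\<close>

unbundle no vec_syntax
unbundle fps_syntax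

section \<open>Fractional powers of $1 - X$\<close>

text \<open>The binomial series of $(1-X)^a$. Convolution with its coefficients for $a = -\alpha$ is the
discrete fractional integral of order $\alpha$, for $a = \alpha$ the discrete fractional derivative.\<close>

definition binser :: "real \<Rightarrow> real fps" where
  "binser a = Abs_fps (\<lambda>n. pochhammer (- a) n / fact n)"

lemma binser_nth: "binser a $ n = pochhammer (- a) n / fact n"
  by (simp add: binser_def)

lemma binser_nth_0 [simp]: "binser a $ 0 = 1"
  by (simp add: binser_nth)

lemma binser_nth_Suc: "binser a $ Suc n = binser a $ n * ((real n - a) / real (Suc n))"
  by (simp add: binser_nth pochhammer_Suc field_simps)

text \<open>The Chu--Vandermonde identity.\<close>

lemma binser_add: "binser (a + b) = binser a * binser b"
proof (rule fps_ext)
  fix n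
  have "binser (a + b) $ n = pochhammer (- a + - b) n / fact n" by (simp add: binser_nth)
  also have "\<dots> = (\<Sum>k\<le>n. of_nat (n choose k) * pochhammer (- a) k * pochhammer (- b) (n - k) / fact n)"
    by (subst pochhammer_binomial_sum) (simp add: sum_divide_distrib)
  also have "\<dots> = (\<Sum>k\<le>n. binser a $ k * binser b $ (n - k))"
    by (intro sum.cong refl) (auto simp: binser_nth binomial_fact field_simps)
  finally show "binser (a + b) $ n = (binser a * binser b) $ n"
    by (simp add: fps_mult_nth atMost_atLeast0)
qed

lemma binser_0 [simp]: "binser 0 = 1"
  by (rule fps_ext) (simp add: binser_nth pochhammer_0_left)

lemma binser_minus_one_nth [simp]: "binser (-1) $ n = 1"
  by (simp add: binser_nth pochhammer_fact[symmetric])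

lemma binser_nth_nonneg: "a \<le> 0 \<Longrightarrow> 0 \<le> binser a $ n"
  using pochhammer_nonneg[of "- a" n] by (cases "a = 0") (simp_all add: binser_nth)

lemma binser_nth_nonneg': "0 \<le> a \<Longrightarrow> 0 \<le> binser (- 1 - a * real k) $ n"
  using mult_nonneg_nonneg[of a "real k"] by (intro binser_nth_nonneg) linarith

lemma binser_nth_nonpos: "0 \<le> a \<Longrightarrow> a \<le> 1 \<Longrightarrow> 0 < n \<Longrightarrow> binser a $ n \<le> 0"
proof (induction n)
  case (Suc n)
  show ?case
  proof (cases "n = 0")
    case True with Suc.prems show ?thesis by (simp add: binser_nth)
  next
    case False
    with Suc show ?thesis unfolding binser_nth_Suc
      by (intro mult_nonpos_nonneg divide_nonneg_nonneg) auto
  qed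
qed simp

lemma binser_nth_antimono:
  assumes "-1 \<le> a" "a \<le> 0" shows "m \<le> n \<Longrightarrow> binser a $ n \<le> binser a $ m"
proof (induction n rule: dec_induct)
  case (step n)
  have "binser a $ Suc n \<le> binser a $ n * 1"
    unfolding binser_nth_Suc using assms by (intro mult_left_mono binser_nth_nonneg) auto
  with step show ?case by simp
qed simp

text \<open>Gauss' product formula for the Gamma function: the coefficients of $(1-X)^{-1-x}$ grow like
$n^x / \Gamma(1+x)$.\<close>

lemma binser_asymp:
  assumes "x \<ge> - 1"
  shows "(\<lambda>n. binser (- 1 - x) $ n / real n powr x) \<longlonglongrightarrow> 1 / Gamma (1 + x)"
proof (cases "x = -1")
  case True
  have "eventually (\<lambda>n. binser (-1-x) $ n / real n powr x = 0) sequentially"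
    using eventually_gt_at_top[of 0]
    by eventually_elim (use True in \<open>auto simp: binser_0\<close>)
  then show ?thesis using True by (simp add: tendsto_eventually Gamma_nonpos_Int)
next
  case False
  with assms have x: "x > -1" by simp
  have "(\<lambda>n. inverse (Gamma_series' (1 + x) n)) \<longlonglongrightarrow> inverse (Gamma (1 + x))"
    using x by (intro tendsto_inverse Gamma_series'_LIMSEQ) (auto simp: Gamma_eq_zero_iff nonpos_Ints_def)
  moreover have "eventually (\<lambda>n. inverse (Gamma_series' (1 + x) n) = binser (- 1 - x) $ n / real n powr x) sequentially"
    using eventually_gt_at_top[of 0]
  proof eventually_elim
    case (elim n)
    then obtain m where n: "n = Suc m" by (cases n) auto
    have "exp ((1 + x) * ln (real n)) = real n * real n powr x"
      using elim by (simp add: powr_def exp_add ring_distribs)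
    then show ?case using elim
      by (simp add: Gamma_series'_def binser_nth n field_simps)
  qed
  ultimately show ?thesis by (simp add: inverse_eq_divide tendsto_cong)
qed

text \<open>The quotients in \<open>binser_asymp\<close> approach their limit from above, because
$1 + x/(n+1) \le (1 + 1/n)^x$. A single early quotient thus dominates all later ones, which provides
the majorant for the limit in \<open>discrete_ml_limit\<close>.\<close>

lemma binser_ratio_antimono:
  assumes "x \<ge> 0" "0 < m" "m \<le> n"
  shows "binser (- 1 - x) $ n / real n powr x \<le> binser (- 1 - x) $ m / real m powr x"
  using \<open>m \<le> n\<close>
proof (induction n rule: dec_induct)
  case (step n)
  then have n: "n > 0" using \<open>0 < m\<close> by simp
  have "1 + x / (real n + 1) \<le> (1 + 1 / real n) powr x"
  proof -
    have "ln (real n / (real n + 1)) \<le> real n / (real n + 1) - 1"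
      by (intro ln_le_minus_one) (use n in auto)
    also have "\<dots> = - (1 / (real n + 1))" by (simp add: field_simps)
    finally have l: "1 / (real n + 1) \<le> ln (1 + 1 / real n)"
      using n by (simp add: ln_div field_simps)
    have "1 + x / (real n + 1) \<le> exp (x / (real n + 1))" by (rule exp_ge_add_one_self)
    also have "\<dots> \<le> exp (x * ln (1 + 1 / real n))"
      using mult_left_mono[OF l \<open>x \<ge> 0\<close>] by simp
    also have "\<dots> = (1 + 1 / real n) powr x" by (subst powr_def) (use n in \<open>auto simp: add_pos_pos add_nonneg_eq_0_iff\<close>)
    finally show ?thesis .
  qed
  also have "(1 + 1 / real n) powr x = real (Suc n) powr x / real n powr x"
    using n by (subst powr_divide[symmetric]) (auto simp: field_simps)
  finally have *: "1 + x / (real n + 1) \<le> real (Suc n) powr x / real n powr x" .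
  have "binser (-1-x) $ Suc n / real (Suc n) powr x
      = binser (-1-x) $ n * (1 + x / (real n + 1)) / real (Suc n) powr x"
    by (simp add: binser_nth_Suc field_simps)
  also have "\<dots> \<le> binser (-1-x) $ n * (real (Suc n) powr x / real n powr x) / real (Suc n) powr x"
    using assms by (intro divide_right_mono mult_left_mono * binser_nth_nonneg) auto
  also have "\<dots> = binser (-1-x) $ n / real n powr x" using n by simp
  finally show ?case using step by simp
qed simp

text \<open>For an integer $x$ the coefficient is a binomial coefficient, hence at most $2^{n+x}$.\<close>

lemma binser_exp_bound:
  assumes "x \<ge> 0"
  shows "binser (- 1 - x) $ n \<le> 2 ^ (n + 1) * 2 powr x"
proof -
  define m where "m = nat \<lceil>x\<rceil>"
  have m: "x \<le> real m" "real m \<le> x + 1" using assms unfolding m_def by linarith+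
  have "pochhammer (1 + x) n \<le> pochhammer (1 + real m) n"
    unfolding pochhammer_prod using assms m by (intro prod_mono) auto
  then have "binser (- 1 - x) $ n \<le> pochhammer (1 + real m) n / fact n"
    by (simp add: binser_nth divide_right_mono add.commute)
  also have "pochhammer (1 + real m) n = fact (m + n) / fact m"
    using pochhammer_product'[of "1::real" m n] by (simp add: pochhammer_fact[symmetric] field_simps)
  also have "fact (m + n) / fact m / fact n = real ((m + n) choose n)"
    by (simp add: binomial_fact field_simps)
  also have "\<dots> \<le> 2 ^ (m + n)" 
    using binomial_le_pow2[of "m + n" n] by (metis of_nat_le_iff of_nat_numeral of_nat_power)
  also have "\<dots> = 2 ^ n * 2 powr real m" by (simp add: power_add powr_realpow)
  also have "\<dots> \<le> 2 ^ n * 2 powr (x + 1)" using m by (intro mult_left_mono powr_mono) auto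
  also have "\<dots> = 2 ^ (n + 1) * 2 powr x" by (simp add: powr_add)
  finally show ?thesis .
qed


section \<open>A discrete Mittag-Leffler function\<close>

text \<open>The generating function of the solution of $v + c\, I^\alpha v = 1$, where $I^\alpha$ is convolution
with the coefficients of $(1-X)^{-\alpha}$. For a step width $h$ and $c = \lambda h^\alpha$ the $n$-th
coefficient approximates $E_\alpha(-\lambda (nh)^\alpha)$.\<close>

definition discrete_ml :: "real \<Rightarrow> real \<Rightarrow> real fps" where
  "discrete_ml \<alpha> c = binser (\<alpha> - 1) * inverse (binser \<alpha> + fps_const c)"

lemma discrete_ml_eq:
  assumes "c > -1"
  shows "(binser \<alpha> + fps_const c) * discrete_ml \<alpha> c = binser (\<alpha> - 1)"
proof -
  have "(binser \<alpha> + fps_const c) $ 0 \<noteq> 0" using assms by simp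
  then have "inverse (binser \<alpha> + fps_const c) * (binser \<alpha> + fps_const c) = 1"
    by (rule inverse_mult_eq_1)
  then show ?thesis unfolding discrete_ml_def by (metis mult.commute mult.left_commute mult.right_neutral)
qed

lemma binser_plus_const_inj:
  assumes "c > -1" "(binser \<alpha> + fps_const c) * F = (binser \<alpha> + fps_const c) * G"
  shows "F = G"
proof -
  have "(binser \<alpha> + fps_const c) $ 0 \<noteq> 0" using assms by simp
  then have "binser \<alpha> + fps_const c \<noteq> 0" by force
  with assms(2) show ?thesis by simp
qed

lemma binser_plus_const_mult_nth:
  "((binser \<alpha> + fps_const c) * F) $ n
     = (1 + c) * F $ n - (\<Sum>m<n. - binser \<alpha> $ (n - m) * F $ m)"
proof -
  have "((binser \<alpha> + fps_const c) * F) $ n = (F * binser \<alpha>) $ n + c * F $ n"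
    by (simp add: ring_distribs mult.commute)
  also have "(F * binser \<alpha>) $ n = (\<Sum>m\<le>n. F $ m * binser \<alpha> $ (n - m))"
    by (simp add: fps_mult_nth atMost_atLeast0)
  also have "{..n} = insert n {..<n}" by auto
  finally show ?thesis by (simp add: ring_distribs sum_negf mult.commute)
qed

text \<open>The coefficients of $(1-X)^\alpha$ are nonpositive after the first, so each value of the solution is
$1/(1+c)$ times a nonnegative combination of earlier values.\<close>

lemma discrete_ml_rec:
  assumes "c > -1"
  shows "(1 + c) * discrete_ml \<alpha> c $ n = binser (\<alpha> - 1) $ n + (\<Sum>m<n. - binser \<alpha> $ (n - m) * discrete_ml \<alpha> c $ m)"
  using binser_plus_const_mult_nth[of \<alpha> c "discrete_ml \<alpha> c" n] discrete_ml_eq[OF assms, of \<alpha>] by simp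

text \<open>By \<open>binser_exp_bound\<close> the Neumann series converges for $|c| < 1/2$. The limit is taken along
$c \to 0$, which eventually enters this range.\<close>

lemma summable_discrete_ml_series:
  assumes "\<bar>c\<bar> < 1/2" "0 \<le> \<alpha>" "\<alpha> \<le> 1"
  shows "summable (\<lambda>k. \<bar>c\<bar> ^ k * binser (- 1 - \<alpha> * real k) $ n)"
proof (rule summable_comparison_test')
  show "summable (\<lambda>k. 2 ^ (n + 1) * (2 * \<bar>c\<bar>) ^ k)"
    using assms by (intro summable_mult summable_geometric) auto
  fix k :: nat assume "k \<ge> 0"
  have "binser (- 1 - \<alpha> * real k) $ n \<le> 2 ^ (n + 1) * 2 powr (\<alpha> * real k)"
    using assms by (intro binser_exp_bound) auto
  also have "\<dots> \<le> 2 ^ (n + 1) * 2 powr (1 * real k)"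
    using assms by (intro mult_left_mono powr_mono mult_right_mono) auto
  finally have "binser (- 1 - \<alpha> * real k) $ n \<le> 2 ^ (n + 1) * 2 ^ k" by (simp add: powr_realpow)
  then have "\<bar>c\<bar> ^ k * binser (- 1 - \<alpha> * real k) $ n \<le> \<bar>c\<bar> ^ k * (2 ^ (n + 1) * 2 ^ k)"
    by (intro mult_left_mono) auto
  moreover have "0 \<le> binser (- 1 - \<alpha> * real k) $ n" using assms by (intro binser_nth_nonneg') auto
  ultimately show "norm (\<bar>c\<bar> ^ k * binser (- 1 - \<alpha> * real k) $ n) \<le> 2 ^ (n + 1) * (2 * \<bar>c\<bar>) ^ k"
    by (simp add: power_mult_distrib mult_ac abs_mult)
qed

text \<open>The Neumann series of the Volterra equation: $I^\alpha$ applied $k$ times to the constant $1$ has the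
generating function $(1-X)^{-1-\alpha k}$.\<close>

lemma discrete_ml_series:
  assumes "\<bar>c\<bar> < 1/2" "0 \<le> \<alpha>" "\<alpha> \<le> 1"
  shows "(\<lambda>k. (- c) ^ k * binser (- 1 - \<alpha> * real k) $ n) sums (discrete_ml \<alpha> c $ n)"
proof -
  define S where "S = Abs_fps (\<lambda>n. \<Sum>k. (- c) ^ k * binser (- 1 - \<alpha> * real k) $ n)"
  have sums: "(\<lambda>k. (- c) ^ k * binser (- 1 - \<alpha> * real k) $ n) sums (S $ n)" for n
  proof -
    have "summable (\<lambda>k. norm ((- c) ^ k * binser (- 1 - \<alpha> * real k) $ n))"
      using summable_discrete_ml_series[OF assms, of n] assms
      by (simp add: abs_mult power_abs binser_nth_nonneg')
    then show ?thesis unfolding S_def by (simp add: summable_norm_cancel summable_sums)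
  qed
  have "(binser \<alpha> + fps_const c) * S = binser (\<alpha> - 1)"
  proof (rule fps_ext)
    fix n
    have "(\<lambda>k. \<Sum>m\<le>n. (- c) ^ k * binser (- 1 - \<alpha> * real k) $ m * binser \<alpha> $ (n - m)) sums
            (\<Sum>m\<le>n. S $ m * binser \<alpha> $ (n - m))"
      by (intro sums_sum sums_mult2 sums)
    also have "(\<Sum>m\<le>n. S $ m * binser \<alpha> $ (n - m)) = (binser \<alpha> * S) $ n"
      by (subst mult.commute) (simp add: fps_mult_nth atMost_atLeast0)
    also have "(\<lambda>k. \<Sum>m\<le>n. (- c) ^ k * binser (- 1 - \<alpha> * real k) $ m * binser \<alpha> $ (n - m))
             = (\<lambda>k. (- c) ^ k * binser (\<alpha> - 1 - \<alpha> * real k) $ n)"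
    proof
      fix k
      have eq: "binser (\<alpha> - 1 - \<alpha> * real k) = binser (- 1 - \<alpha> * real k) * binser \<alpha>"
        by (subst binser_add[symmetric]) (simp add: algebra_simps)
      show "(\<Sum>m\<le>n. (- c) ^ k * binser (- 1 - \<alpha> * real k) $ m * binser \<alpha> $ (n - m))
             = (- c) ^ k * binser (\<alpha> - 1 - \<alpha> * real k) $ n"
        unfolding eq fps_mult_nth atMost_atLeast0 sum_distrib_left
        by (intro sum.cong refl) (simp only: mult.assoc)
    qed
    finally have 1: "(\<lambda>k. (- c) ^ k * binser (\<alpha> - 1 - \<alpha> * real k) $ n) sums ((binser \<alpha> * S) $ n)" .
    have shift: "(- c) ^ Suc k * binser (\<alpha> - 1 - \<alpha> * real (Suc k)) $ n
                = (- c) * ((- c) ^ k * binser (- 1 - \<alpha> * real k) $ n)" for k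
    proof -
      have eq: "\<alpha> - 1 - \<alpha> * real (Suc k) = - 1 - \<alpha> * real k" by (simp add: algebra_simps)
      show ?thesis unfolding eq power_Suc by (rule mult.assoc)
    qed
    have "(\<lambda>k. (- c) ^ Suc k * binser (\<alpha> - 1 - \<alpha> * real (Suc k)) $ n) sums (- c * S $ n)"
      unfolding shift by (intro sums_mult sums)
    from sums_Suc[where f = "\<lambda>k. (- c) ^ k * binser (\<alpha> - 1 - \<alpha> * real k) $ n", OF this]
    have "(\<lambda>k. (- c) ^ k * binser (\<alpha> - 1 - \<alpha> * real k) $ n) sums (- c * S $ n + binser (\<alpha> - 1) $ n)"
      by simp
    then have "(binser \<alpha> * S) $ n = - c * S $ n + binser (\<alpha> - 1) $ n"
      using 1 sums_unique2 by blast
    moreover have "((binser \<alpha> + fps_const c) * S) $ n = (binser \<alpha> * S) $ n + c * S $ n"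
      by (simp only: distrib_right fps_add_nth fps_mult_left_const_nth)
    ultimately show "((binser \<alpha> + fps_const c) * S) $ n = binser (\<alpha> - 1) $ n"
      by simp
  qed
  then have "S = discrete_ml \<alpha> c"
    using assms binser_plus_const_inj[of c \<alpha> S "discrete_ml \<alpha> c"] by (simp add: discrete_ml_eq)
  with sums show ?thesis by simp
qed

lemma powr_mult_of_nat: "0 < (x::real) \<Longrightarrow> x powr (a * real k) = (x powr a) ^ k"
  using powr_power[of x a k] by (simp add: mult.commute)

text \<open>With $n$ steps of width $1/n$ the Neumann series turns into the Mittag-Leffler series term by term,
by \<open>binser_asymp\<close>; the exchange of limit and sum is Tannery's theorem.\<close>

lemma discrete_ml_limit:
  assumes "0 < \<alpha>" "\<alpha> \<le> 1"
  shows summable_mittag_leffler: "summable (\<lambda>k. z ^ k / Gamma (1 + \<alpha> * real k))"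
    and discrete_ml_tendsto: "(\<lambda>n. discrete_ml \<alpha> (- z / real n powr \<alpha>) $ n) \<longlonglongrightarrow> mittag_leffler \<alpha> z"
proof -
  define a where "a = (\<lambda>k n. z ^ k * (binser (- 1 - \<alpha> * real k) $ n / real n powr (\<alpha> * real k)))"
  have a_eq: "a k n = (z / real n powr \<alpha>) ^ k * binser (- 1 - \<alpha> * real k) $ n" if "n > 0" for k n
    using that by (simp add: a_def power_divide powr_mult_of_nat)
  have lim0: "(\<lambda>n. z / real n powr \<alpha>) \<longlonglongrightarrow> 0" using assms by real_asymp
  have ev: "eventually (\<lambda>n. \<bar>z / real n powr \<alpha>\<bar> < 1/2 \<and> n > 0) sequentially"
    using eventually_conj[OF tendstoD[OF lim0, of "1/2"] eventually_gt_at_top[of 0]] by simp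
  then obtain J where J: "\<bar>z / real J powr \<alpha>\<bar> < 1/2" "J > 0"
    using eventually_happens'[OF sequentially_bot ev] by blast
  define M where "M = (\<lambda>k. \<bar>z / real J powr \<alpha>\<bar> ^ k * binser (- 1 - \<alpha> * real k) $ J)"
  have "eventually (\<lambda>n. summable (\<lambda>k. norm (a k n))) sequentially \<and>
           summable (\<lambda>k. norm (z ^ k * (1 / Gamma (1 + \<alpha> * real k)))) \<and>
           ((\<lambda>n. suminf (\<lambda>k. a k n)) \<longlonglongrightarrow> suminf (\<lambda>k. z ^ k * (1 / Gamma (1 + \<alpha> * real k))))"
  proof (rule tannerys_theorem[where a = a and M = M and F = sequentially])
    show "(\<lambda>n. a k n) \<longlonglongrightarrow> z ^ k * (1 / Gamma (1 + \<alpha> * real k))" for k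
      unfolding a_def using mult_nonneg_nonneg[of \<alpha> "real k"] assms
      by (intro tendsto_mult tendsto_const binser_asymp) linarith
    show "summable M" unfolding M_def using assms J by (intro summable_discrete_ml_series) auto
    have "norm (a k n) \<le> M k" if "n \<ge> J" for k n
    proof -
      have "norm (a k n) = \<bar>z\<bar> ^ k * (binser (- 1 - \<alpha> * real k) $ n / real n powr (\<alpha> * real k))"
        using assms by (simp add: a_def abs_mult power_abs binser_nth_nonneg')
      also have "\<dots> \<le> \<bar>z\<bar> ^ k * (binser (- 1 - \<alpha> * real k) $ J / real J powr (\<alpha> * real k))"
        using assms J that by (intro mult_left_mono binser_ratio_antimono) auto
      also have "\<dots> = M k"
        using J by (simp add: M_def power_divide powr_mult_of_nat)
      finally show ?thesis .
    qed
    then show "eventually (\<lambda>(k,n). norm (a k n) \<le> M k) (at_top \<times>\<^sub>F sequentially)"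
      unfolding eventually_prod_filter
      by (intro exI[of _ "\<lambda>_. True"] exI[of _ "\<lambda>n. n \<ge> J"]) auto
  qed auto
  then have 1: "summable (\<lambda>k. norm (z ^ k * (1 / Gamma (1 + \<alpha> * real k))))"
    and 2: "(\<lambda>n. suminf (\<lambda>k. a k n)) \<longlonglongrightarrow> suminf (\<lambda>k. z ^ k * (1 / Gamma (1 + \<alpha> * real k)))"
    by auto
  show "summable (\<lambda>k. z ^ k / Gamma (1 + \<alpha> * real k))"
    using summable_norm_cancel[OF 1] by simp
  have "eventually (\<lambda>n. suminf (\<lambda>k. a k n) = discrete_ml \<alpha> (- z / real n powr \<alpha>) $ n) sequentially"
    using ev
  proof eventually_elim
    case (elim n)
    then have "(\<lambda>k. (- (- z / real n powr \<alpha>)) ^ k * binser (- 1 - \<alpha> * real k) $ n) sums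
        (discrete_ml \<alpha> (- z / real n powr \<alpha>) $ n)"
      using assms by (intro discrete_ml_series) auto
    then show ?case using elim by (simp add: a_eq sums_iff)
  qed
  from Lim_transform_eventually[OF 2 this]
  show "(\<lambda>n. discrete_ml \<alpha> (- z / real n powr \<alpha>) $ n) \<longlonglongrightarrow> mittag_leffler \<alpha> z"
    by (simp add: mittag_leffler_def)
qed

text \<open>The generating function of the decrements $v_{n-1} - v_n$, with $v_{-1} = 1$.\<close>

definition discrete_ml_drop :: "real \<Rightarrow> real \<Rightarrow> real fps" where
  "discrete_ml_drop \<alpha> c = fps_const c * inverse (binser \<alpha> + fps_const c)"

lemma discrete_ml_drop_eq: 
  assumes "c > -1"
  shows "(binser \<alpha> + fps_const c) * discrete_ml_drop \<alpha> c = fps_const c"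
proof -
  have "(binser \<alpha> + fps_const c) $ 0 \<noteq> 0" using assms by simp
  then have "inverse (binser \<alpha> + fps_const c) * (binser \<alpha> + fps_const c) = 1"
    by (rule inverse_mult_eq_1)
  then show ?thesis unfolding discrete_ml_drop_def by (metis mult.commute mult.left_commute mult.right_neutral)
qed

lemma discrete_ml_drop_nonneg:
  assumes "c \<ge> 0" "0 \<le> \<alpha>" "\<alpha> \<le> 1"
  shows "0 \<le> discrete_ml_drop \<alpha> c $ n"
proof (induction n rule: less_induct)
  case (less n)
  have "0 \<le> fps_const c $ n + (\<Sum>m<n. - binser \<alpha> $ (n - m) * discrete_ml_drop \<alpha> c $ m)"
    using assms less
    by (intro add_nonneg_nonneg sum_nonneg mult_nonneg_nonneg)
       (auto intro!: binser_nth_nonpos)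
  then have "0 \<le> (1 + c) * discrete_ml_drop \<alpha> c $ n"
    using binser_plus_const_mult_nth[of \<alpha> c "discrete_ml_drop \<alpha> c" n] discrete_ml_drop_eq[of c \<alpha>] assms by simp
  then show ?case using assms by (simp add: zero_le_mult_iff)
qed

lemma discrete_ml_partial_sums:
  assumes "c > -1"
  shows "discrete_ml \<alpha> c $ n = 1 - (\<Sum>m\<le>n. discrete_ml_drop \<alpha> c $ m)"
proof -
  have "binser 1 * discrete_ml \<alpha> c = 1 - discrete_ml_drop \<alpha> c"
  proof (rule binser_plus_const_inj[OF assms])
    have "binser \<alpha> = binser 1 * binser (\<alpha> - 1)" by (subst binser_add[symmetric]) simp
    then have "(binser \<alpha> + fps_const c) * (binser 1 * discrete_ml \<alpha> c) = binser \<alpha>"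
      using discrete_ml_eq[OF assms, of \<alpha>] by (metis mult.left_commute)
    also have "\<dots> = (binser \<alpha> + fps_const c) * (1 - discrete_ml_drop \<alpha> c)"
      using discrete_ml_drop_eq[OF assms, of \<alpha>] by (simp add: right_diff_distrib)
    finally show "(binser \<alpha> + fps_const c) * (binser 1 * discrete_ml \<alpha> c) = (binser \<alpha> + fps_const c) * (1 - discrete_ml_drop \<alpha> c)" .
  qed
  then have "binser (-1) * (binser 1 * discrete_ml \<alpha> c) = binser (-1) * (1 - discrete_ml_drop \<alpha> c)" by simp
  also have "binser (-1) * (binser 1 * discrete_ml \<alpha> c) = discrete_ml \<alpha> c"
    by (simp flip: binser_add mult.assoc)
  finally have "discrete_ml \<alpha> c = (1 - discrete_ml_drop \<alpha> c) * binser (-1)" by (simp add: mult.commute)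
  then have "discrete_ml \<alpha> c $ n = (\<Sum>m\<le>n. (1 - discrete_ml_drop \<alpha> c) $ m)"
    by (simp add: fps_mult_nth atMost_atLeast0)
  also have "\<dots> = 1 - (\<Sum>m\<le>n. discrete_ml_drop \<alpha> c $ m)" 
    by (simp add: sum_subtractf fps_one_def)
  finally show ?thesis .
qed

lemma discrete_ml_antimono:
  assumes "c \<ge> 0" "0 \<le> \<alpha>" "\<alpha> \<le> 1" "m \<le> n"
  shows "discrete_ml \<alpha> c $ n \<le> discrete_ml \<alpha> c $ m"
proof -
  have "(\<Sum>i\<le>m. discrete_ml_drop \<alpha> c $ i) \<le> (\<Sum>i\<le>n. discrete_ml_drop \<alpha> c $ i)"
    using assms by (intro sum_mono2 discrete_ml_drop_nonneg) auto
  then show ?thesis using assms by (simp add: discrete_ml_partial_sums)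
qed

text \<open>Since $v$ decreases in time, $1 = v_n + c\,(I^\alpha v)_n \ge v_n\,(1 + c\,(I^\alpha 1)_n)$.\<close>

lemma discrete_ml_upper:
  assumes "c \<ge> 0" "0 \<le> \<alpha>" "\<alpha> \<le> 1"
  shows "discrete_ml \<alpha> c $ n * (1 + c * binser (- 1 - \<alpha>) $ n) \<le> 1"
proof -
  have "binser (-1) = binser (- \<alpha>) * binser (\<alpha> - 1)" by (subst binser_add[symmetric]) simp
  also have "\<dots> = binser (- \<alpha>) * ((binser \<alpha> + fps_const c) * discrete_ml \<alpha> c)" using assms by (simp add: discrete_ml_eq)
  also have "\<dots> = (binser (- \<alpha>) * binser \<alpha>) * discrete_ml \<alpha> c + fps_const c * (discrete_ml \<alpha> c * binser (- \<alpha>))"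
    by (simp add: algebra_simps)
  also have "binser (- \<alpha>) * binser \<alpha> = 1" by (subst binser_add[symmetric]) simp
  finally have "binser (-1) $ n = (1 * discrete_ml \<alpha> c + fps_const c * (discrete_ml \<alpha> c * binser (- \<alpha>))) $ n" by simp
  then have "1 = discrete_ml \<alpha> c $ n + c * (discrete_ml \<alpha> c * binser (- \<alpha>)) $ n" by simp
  also have "(discrete_ml \<alpha> c * binser (- \<alpha>)) $ n = (\<Sum>m\<le>n. discrete_ml \<alpha> c $ m * binser (- \<alpha>) $ (n - m))"
    by (simp only: fps_mult_nth atMost_atLeast0)
  also have "discrete_ml \<alpha> c $ n + c * (\<Sum>m\<le>n. discrete_ml \<alpha> c $ m * binser (- \<alpha>) $ (n - m)) \<ge> discrete_ml \<alpha> c $ n + c * (\<Sum>m\<le>n. discrete_ml \<alpha> c $ n * binser (- \<alpha>) $ (n - m))"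
    using assms by (intro add_mono mult_left_mono sum_mono mult_right_mono discrete_ml_antimono binser_nth_nonneg) auto
  also have "(\<Sum>m\<le>n. discrete_ml \<alpha> c $ n * binser (- \<alpha>) $ (n - m)) = discrete_ml \<alpha> c $ n * (binser (-1) * binser (- \<alpha>)) $ n"
    by (simp add: fps_mult_nth atMost_atLeast0 sum_distrib_left)
  also have "binser (-1) * binser (- \<alpha>) = binser (- 1 - \<alpha>)" by (subst binser_add[symmetric]) simp
  finally show ?thesis by (simp add: algebra_simps)
qed

text \<open>The equation in Caputo form reads $(1-X)^{\alpha-1} \cdot (\textrm{decrements}) = c\, v$. The
coefficients of $(1-X)^{\alpha-1}$ decrease, so the $n$-th one can be pulled out, and the decrements add
up to $1 - v_n$.\<close>

lemma discrete_ml_lower: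
  assumes "c \<ge> 0" "0 \<le> \<alpha>" "\<alpha> \<le> 1"
  shows "binser (\<alpha> - 1) $ n \<le> discrete_ml \<alpha> c $ n * (binser (\<alpha> - 1) $ n + c)"
proof -
  have "discrete_ml_drop \<alpha> c * binser (\<alpha> - 1) = fps_const c * discrete_ml \<alpha> c"
    by (simp add: discrete_ml_def discrete_ml_drop_def mult_ac)
  then have "(discrete_ml_drop \<alpha> c * binser (\<alpha> - 1)) $ n = c * discrete_ml \<alpha> c $ n" by simp
  then have "c * discrete_ml \<alpha> c $ n = (\<Sum>m\<le>n. discrete_ml_drop \<alpha> c $ m * binser (\<alpha> - 1) $ (n - m))"
    by (simp add: fps_mult_nth atMost_atLeast0)
  also have "\<dots> \<ge> (\<Sum>m\<le>n. discrete_ml_drop \<alpha> c $ m * binser (\<alpha> - 1) $ n)"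
    using assms by (intro sum_mono mult_left_mono binser_nth_antimono discrete_ml_drop_nonneg) auto
  also have "(\<Sum>m\<le>n. discrete_ml_drop \<alpha> c $ m * binser (\<alpha> - 1) $ n) = (1 - discrete_ml \<alpha> c $ n) * binser (\<alpha> - 1) $ n"
    using assms by (simp add: discrete_ml_partial_sums sum_distrib_right)
  finally show ?thesis by (simp add: algebra_simps)
qed

section \<open>Two-sided bounds for the Mittag-Leffler function\<close>

lemma mittag_leffler_upper:
  assumes "0 < \<alpha>" "\<alpha> < 1" "0 \<le> z"
  shows "mittag_leffler \<alpha> (- z) \<le> 1 / (1 + z / Gamma (1 + \<alpha>))"
proof -
  have G: "Gamma (1 + \<alpha>) > 0" using assms by simp
  have lim: "(\<lambda>n. discrete_ml \<alpha> (z / real n powr \<alpha>) $ n * (1 + z * (binser (- 1 - \<alpha>) $ n / real n powr \<alpha>)))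
     \<longlonglongrightarrow> mittag_leffler \<alpha> (- z) * (1 + z * (1 / Gamma (1 + \<alpha>)))"
    using discrete_ml_tendsto[of \<alpha> "- z"] binser_asymp[of \<alpha>] assms
    by (intro tendsto_mult tendsto_add tendsto_const) auto
  have "mittag_leffler \<alpha> (- z) * (1 + z * (1 / Gamma (1 + \<alpha>))) \<le> 1"
    using discrete_ml_upper[of "z / real n powr \<alpha>" \<alpha> n for n] assms
    by (intro LIMSEQ_le_const2[OF lim]) auto
  moreover have "1 + z / Gamma (1 + \<alpha>) > 0" using assms G by (intro add_pos_nonneg) auto
  ultimately show ?thesis by (simp add: pos_le_divide_eq)
qed

lemma mittag_leffler_lower:
  assumes "0 < \<alpha>" "\<alpha> < 1" "0 \<le> z"
  shows "1 / (1 + Gamma (1 - \<alpha>) * z) \<le> mittag_leffler \<alpha> (- z)"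
proof -
  have G: "Gamma (1 - \<alpha>) > 0" using assms by simp
  have asymp: "(\<lambda>n. binser (\<alpha> - 1) $ n * real n powr \<alpha>) \<longlonglongrightarrow> 1 / Gamma (1 - \<alpha>)"
    using binser_asymp[of "-\<alpha>"] assms by (simp add: powr_minus divide_inverse)
  have lim: "(\<lambda>n. discrete_ml \<alpha> (z / real n powr \<alpha>) $ n * (binser (\<alpha> - 1) $ n * real n powr \<alpha> + z))
     \<longlonglongrightarrow> mittag_leffler \<alpha> (- z) * (1 / Gamma (1 - \<alpha>) + z)"
    using discrete_ml_tendsto[of \<alpha> "- z"] asymp assms
    by (intro tendsto_mult[of "\<lambda>n. discrete_ml \<alpha> (z / real n powr \<alpha>) $ n"] tendsto_add tendsto_const) auto
  have "1 / Gamma (1 - \<alpha>) \<le> mittag_leffler \<alpha> (- z) * (1 / Gamma (1 - \<alpha>) + z)"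
  proof (rule LIMSEQ_le[OF asymp lim], intro exI allI impI)
    fix n :: nat assume n: "n \<ge> 1"
    have "binser (\<alpha> - 1) $ n \<le> discrete_ml \<alpha> (z / real n powr \<alpha>) $ n * (binser (\<alpha> - 1) $ n + z / real n powr \<alpha>)"
      using assms by (intro discrete_ml_lower) auto
    then have "binser (\<alpha> - 1) $ n * real n powr \<alpha> \<le> discrete_ml \<alpha> (z / real n powr \<alpha>) $ n * (binser (\<alpha> - 1) $ n + z / real n powr \<alpha>) * real n powr \<alpha>"
      by (intro mult_right_mono) auto
    also have "\<dots> = discrete_ml \<alpha> (z / real n powr \<alpha>) $ n * (binser (\<alpha> - 1) $ n * real n powr \<alpha> + z)"
      using n by (simp add: field_simps)
    finally show "binser (\<alpha> - 1) $ n * real n powr \<alpha> \<le> discrete_ml \<alpha> (z / real n powr \<alpha>) $ n * (binser (\<alpha> - 1) $ n * real n powr \<alpha> + z)" .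
  qed
  then have "Gamma (1 - \<alpha>) * (1 / Gamma (1 - \<alpha>)) \<le> Gamma (1 - \<alpha>) * (mittag_leffler \<alpha> (- z) * (1 / Gamma (1 - \<alpha>) + z))"
    using G by (intro mult_left_mono) auto
  also have "\<dots> = mittag_leffler \<alpha> (- z) * (1 + Gamma (1 - \<alpha>) * z)" using G by (simp add: field_simps)
  finally have "1 \<le> mittag_leffler \<alpha> (- z) * (1 + Gamma (1 - \<alpha>) * z)" using G by simp
  moreover have "1 + Gamma (1 - \<alpha>) * z > 0" using assms G by (intro add_pos_nonneg) auto
  ultimately show ?thesis by (simp add: pos_divide_le_eq)
qed

lemma continuous_mittag_leffler:
  assumes "0 < \<alpha>" "\<alpha> \<le> 1"
  shows "isCont (mittag_leffler \<alpha>) z"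
proof -
  have "isCont (\<lambda>z. \<Sum>k. (1 / Gamma (1 + \<alpha> * real k)) * z ^ k) z"
    using summable_mittag_leffler[OF assms] by (intro isCont_powser_converges_everywhere) simp
  then show ?thesis by (simp add: mittag_leffler_def[abs_def])
qed

section \<open>Limits of positive combinations of decaying exponentials\<close>

definition exp_comb :: "(real \<times> real) list \<Rightarrow> real \<Rightarrow> real" where
  "exp_comb xs x = (\<Sum>(a, s)\<leftarrow>xs. a * exp (- (s * x)))"

lemma exp_comb_simps [simp]:
  "exp_comb [] x = 0" "exp_comb ((a, s) # xs) x = a * exp (- (s * x)) + exp_comb xs x"
  by (simp_all add: exp_comb_def)

text \<open>The completely monotone functions on $[0,\infty)$, generated from below. Continuity at $0$ is not part
of the definition: mass may escape to infinite rates, in which case the value at $0$ is larger than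
the limit from the right. Values at negative arguments are unconstrained.\<close>

inductive comp_mono :: "(real \<Rightarrow> real) \<Rightarrow> bool" where
  base: "\<forall>(a, s)\<in>set xs. 0 \<le> a \<and> 0 \<le> s \<Longrightarrow> comp_mono (exp_comb xs)"
| lim: "(\<And>n. comp_mono (f n)) \<Longrightarrow> (\<And>x. 0 \<le> x \<Longrightarrow> (\<lambda>n. f n x) \<longlonglongrightarrow> g x) \<Longrightarrow> comp_mono g"

lemma comp_mono_cong: 
  assumes "comp_mono f" "\<And>x. 0 \<le> x \<Longrightarrow> f x = g x" shows "comp_mono g"
  using assms(1) by (rule comp_mono.lim[where f = "\<lambda>_. f"]) (simp add: assms(2))

lemma comp_mono_exp:
  assumes "0 \<le> a" "0 \<le> s" shows "comp_mono (\<lambda>x. a * exp (- (s * x)))"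
  using comp_mono_cong[OF comp_mono.base[of "[(a, s)]"]] assms by simp

lemma comp_mono_const: "0 \<le> a \<Longrightarrow> comp_mono (\<lambda>_. a)"
  using comp_mono_exp[of a 0] by simp

lemma exp_comb_append: "exp_comb (xs @ ys) x = exp_comb xs x + exp_comb ys x"
  by (simp add: exp_comb_def)

lemma comp_mono_add:
  assumes "comp_mono f" "comp_mono g" shows "comp_mono (\<lambda>x. f x + g x)"
proof -
  have 1: "comp_mono (\<lambda>x. exp_comb xs x + g x)" if "\<forall>(a, s)\<in>set xs. 0 \<le> a \<and> 0 \<le> s" for xs
    using \<open>comp_mono g\<close>
  proof (induction g rule: comp_mono.induct)
    case (base ys)
    have "comp_mono (exp_comb (xs @ ys))" using base that by (intro comp_mono.base) auto
    then show ?case by (elim comp_mono_cong) (simp add: exp_comb_append)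
  next
    case (lim f g)
    show ?case 
      by (rule comp_mono.lim[where f = "\<lambda>n x. exp_comb xs x + f n x"], rule lim.IH) (intro tendsto_intros lim(2))
  qed
  show ?thesis using \<open>comp_mono f\<close>
  proof (induction f rule: comp_mono.induct)
    case (lim f' f)
    show ?case 
      by (rule comp_mono.lim[where f = "\<lambda>n x. f' n x + g x"], rule lim.IH) (intro tendsto_intros lim(2))
  qed (use 1 in auto)
qed

lemma comp_mono_mult_exp:
  assumes "comp_mono f" "0 \<le> a" "0 \<le> s" shows "comp_mono (\<lambda>x. a * exp (- (s * x)) * f x)"
  using \<open>comp_mono f\<close>
proof (induction f rule: comp_mono.induct)
  case (base ys)
  have *: "a * exp (- (s * x)) * exp_comb ys x = exp_comb (map (\<lambda>(b, t). (a * b, s + t)) ys) x" for x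
  proof (induction ys)
    case (Cons p ys)
    have "exp (- ((s + snd p) * x)) = exp (- (s * x)) * exp (- (snd p * x))"
      by (simp add: algebra_simps flip: exp_add)
    with Cons show ?case by (cases p) (simp add: algebra_simps)
  qed simp
  show ?case unfolding * using base assms by (intro comp_mono.base) auto
next
  case (lim f g)
  show ?case 
      by (rule comp_mono.lim[where f = "\<lambda>n x. a * exp (- (s * x)) * f n x"], rule lim.IH) (intro tendsto_intros lim(2))
qed

lemma comp_mono_mult:
  assumes "comp_mono f" "comp_mono g" shows "comp_mono (\<lambda>x. f x * g x)"
  using \<open>comp_mono f\<close>
proof (induction f rule: comp_mono.induct)
  case (base xs)
  then show ?case
  proof (induction xs)
    case Nil
    show ?case using comp_mono_const[of 0] by simp
  next
    case (Cons p xs)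
    obtain a s where p: "p = (a, s)" by force
    have "comp_mono (\<lambda>x. a * exp (- (s * x)) * g x + exp_comb xs x * g x)"
      using Cons \<open>comp_mono g\<close> by (intro comp_mono_add comp_mono_mult_exp) (auto simp: p)
    then show ?case by (simp add: p ring_distribs)
  qed
next
  case (lim f' f)
  show ?case 
      by (rule comp_mono.lim[where f = "\<lambda>n x. f' n x * g x"], rule lim.IH) (intro tendsto_intros lim(2))
qed

lemma comp_mono_cmult: "0 \<le> a \<Longrightarrow> comp_mono f \<Longrightarrow> comp_mono (\<lambda>x. a * f x)"
  by (intro comp_mono_mult comp_mono_const)

lemma comp_mono_power: "comp_mono f \<Longrightarrow> comp_mono (\<lambda>x. f x ^ n)"
  by (induction n) (auto intro: comp_mono_mult comp_mono_const)

lemma comp_mono_sum: "(\<And>i. i \<in> I \<Longrightarrow> comp_mono (f i)) \<Longrightarrow> comp_mono (\<lambda>x. \<Sum>i\<in>I. f i x)"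
  by (induction I rule: infinite_finite_induct) (auto intro: comp_mono_add comp_mono_const)

lemma comp_mono_sums:
  assumes "\<And>n. comp_mono (f n)" "\<And>x. 0 \<le> x \<Longrightarrow> (\<lambda>n. f n x) sums g x"
  shows "comp_mono g"
  by (rule comp_mono.lim[where f = "\<lambda>n x. \<Sum>i<n. f i x"]) (use assms in \<open>auto simp: sums_def intro: comp_mono_sum\<close>)

lemma comp_mono_exp_comp: 
  assumes "comp_mono f" shows "comp_mono (\<lambda>x. exp (f x))"
proof (rule comp_mono_sums)
  show "comp_mono (\<lambda>x. f x ^ n / fact n)" for n
    using comp_mono_cmult[OF _ comp_mono_power[OF assms], of "1 / fact n" n] by simp
  show "(\<lambda>n. f x ^ n / fact n) sums exp (f x)" for x
    using exp_converges[of "f x"] by (simp add: scaleR_conv_of_real field_simps)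
qed

text \<open>A Riemann sum of $\int_0^\infty e^{-t(a+bx)}\,dt$, summed as a geometric series.\<close>

lemma comp_mono_inverse_affine:
  assumes "0 < a" "0 \<le> b" shows "comp_mono (\<lambda>x. 1 / (a + b * x))"
proof (rule comp_mono.lim)
  fix n :: nat
  define h where "h = 1 / (real n + 1)"
  have h: "h > 0" by (simp add: h_def)
  show "comp_mono (\<lambda>x. h / (1 - exp (- h * (a + b * x))))"
  proof (rule comp_mono_sums)
    fix j :: nat
    have "comp_mono (\<lambda>x. (h * exp (- (real j * h * a))) * exp (- ((real j * h * b) * x)))"
      using assms h by (intro comp_mono_exp) auto
    then show "comp_mono (\<lambda>x. h * exp (- h * (a + b * x)) ^ j)"
      by (rule comp_mono_cong) (simp add: exp_of_nat_mult[symmetric] exp_add[symmetric] algebra_simps mult.assoc)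
  next
    fix x :: real assume "0 \<le> x"
    with assms have "0 < a + b * x" by (intro add_pos_nonneg) auto
    then have "exp (- h * (a + b * x)) < 1" using h by simp
    then have "(\<lambda>j. h * exp (- h * (a + b * x)) ^ j) sums (h * (1 / (1 - exp (- h * (a + b * x)))))"
      by (intro sums_mult geometric_sums) simp
    then show "(\<lambda>j. h * exp (- h * (a + b * x)) ^ j) sums (h / (1 - exp (- h * (a + b * x))))"
      by simp
  qed
next
  fix x :: real assume "0 \<le> x"
  with assms have "0 < a + b * x" by (intro add_pos_nonneg) auto
  then show "(\<lambda>n. 1 / (real n + 1) / (1 - exp (- (1 / (real n + 1)) * (a + b * x)))) \<longlonglongrightarrow> 1 / (a + b * x)"
    unfolding inverse_eq_divide[symmetric] by real_asymp
qed

lemma binser_sums: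
  assumes "\<bar>u\<bar> < 1" shows "(\<lambda>n. binser g $ n * u ^ n) sums (1 - u) powr g"
proof -
  have "(\<lambda>n. (g gchoose n) * (- u) ^ n) sums (1 + - u) powr g"
    using assms by (intro gen_binomial_real) simp
  moreover have "(g gchoose n) * (- u) ^ n = binser g $ n * u ^ n" for n
  proof -
    have "(g gchoose n) * (- u) ^ n = (- 1) ^ n * (- u) ^ n * binser g $ n"
      by (simp add: gbinomial_pochhammer binser_nth)
    also have "(- 1) ^ n * (- u) ^ n = u ^ n" by (simp flip: power_mult_distrib)
    finally show ?thesis by simp
  qed
  ultimately show ?thesis by simp
qed

text \<open>The stable subordinator is approximated by compound Poisson processes with Sibuya jumps: with $u = e^{-h(x+h)}$
one has $1 - (1-u)^g = \sum_{j \ge 1} p_j u^j$ with $p_j \ge 0$, and $((1-u)/h)^g \to x^g$ as $h \to 0$. The shift by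
$h$ keeps $u < 1$ also at $x = 0$, inside the disc of convergence.\<close>

lemma comp_mono_exp_powr:
  assumes "0 < g" "g \<le> 1" "0 \<le> s" shows "comp_mono (\<lambda>x. exp (- (s * x powr g)))"
proof (rule comp_mono.lim)
  fix n :: nat
  define h where "h = 1 / (real n + 1)"
  have h: "h > 0" by (simp add: h_def)
  define u where "u = (\<lambda>x. exp (- (h * (x + h))))"
  define C where "C = s * (real n + 1) powr g"
  have C: "C \<ge> 0" using assms by (simp add: C_def)
  have "comp_mono (\<lambda>x. exp (- (h * h)) * exp (- (h * x)))" using h by (intro comp_mono_exp) auto
  then have cmu: "comp_mono u" by (rule comp_mono_cong) (simp add: u_def exp_add[symmetric] algebra_simps)
  have "comp_mono (\<lambda>x. 1 - (1 - u x) powr g)"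
  proof (rule comp_mono_sums)
    show "comp_mono (\<lambda>x. (if j = 0 then 0 else - binser g $ j) * u x ^ j)" for j
      using assms binser_nth_nonpos[of g j] by (intro comp_mono_mult comp_mono_const comp_mono_power cmu) auto
    fix x :: real assume "0 \<le> x"
    then have "\<bar>u x\<bar> < 1" using h by (simp add: u_def)
    then have "(\<lambda>n. binser g $ n * u x ^ n) sums (1 - u x) powr g" by (rule binser_sums)
    moreover have "(\<lambda>n. if n = 0 then 1 else 0) sums (1::real)" by (rule sums_single)
    ultimately have "(\<lambda>n. (if n = 0 then 1 else 0) - binser g $ n * u x ^ n) sums (1 - (1 - u x) powr g)"
      by (intro sums_diff)
    then show "(\<lambda>j. (if j = 0 then 0 else - binser g $ j) * u x ^ j) sums (1 - (1 - u x) powr g)"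
      by (rule sums_cong[THEN iffD1, rotated]) auto
  qed
  then have "comp_mono (\<lambda>x. exp (- C) * exp (C * (1 - (1 - u x) powr g)))"
    using C by (intro comp_mono_cmult comp_mono_exp_comp) auto
  then show "comp_mono (\<lambda>x. exp (- (s * (((1 - exp (- (1 / (real n + 1) * (x + 1 / (real n + 1))))) * (real n + 1)) powr g))))"
  proof (rule comp_mono_cong)
    fix x :: real assume "0 \<le> x"
    then have "u x \<le> 1" using h by (simp add: u_def)
    then have "((1 - u x) * (real n + 1)) powr g = (1 - u x) powr g * (real n + 1) powr g"
      by (intro powr_mult)
    then have "exp (- (s * ((1 - u x) * (real n + 1)) powr g)) = exp (- C + C * (1 - (1 - u x) powr g))"
      by (simp add: C_def algebra_simps)
    then show "exp (- C) * exp (C * (1 - (1 - u x) powr g))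
       = exp (- (s * (((1 - exp (- (1 / (real n + 1) * (x + 1 / (real n + 1))))) * (real n + 1)) powr g)))"
      by (simp add: exp_add[symmetric] u_def h_def)
  qed
next
  fix x :: real assume x: "0 \<le> x"
  have "(\<lambda>n. (1 - exp (- (1 / (real n + 1) * (x + 1 / (real n + 1))))) * (real n + 1)) \<longlonglongrightarrow> x"
    by real_asymp
  then show "(\<lambda>n. exp (- (s * (((1 - exp (- (1 / (real n + 1) * (x + 1 / (real n + 1))))) * (real n + 1)) powr g))))
    \<longlonglongrightarrow> exp (- (s * x powr g))"
    using assms x by (intro tendsto_intros tendsto_powr') auto
qed

text \<open>Bochner's subordination: it suffices to know it for the exponentials.\<close>

lemma comp_mono_comp_powr:
  assumes "comp_mono f" "0 < g" "g \<le> 1" shows "comp_mono (\<lambda>x. f (x powr g))"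
  using \<open>comp_mono f\<close>
proof (induction f rule: comp_mono.induct)
  case (base xs)
  then show ?case
  proof (induction xs)
    case Nil
    show ?case using comp_mono_const[of 0] by simp
  next
    case (Cons p xs)
    obtain a s where p: "p = (a, s)" by force
    have "comp_mono (\<lambda>x. a * exp (- (s * x powr g)) + exp_comb xs (x powr g))"
      using Cons assms by (intro comp_mono_add comp_mono_cmult comp_mono_exp_powr) (auto simp: p)
    then show ?case by (simp add: p)
  qed
next
  case (lim f' f)
  show ?case by (rule comp_mono.lim, rule lim.IH, rule lim(2)) simp
qed

lemma comp_mono_discrete_ml:
  assumes "0 \<le> \<alpha>" "\<alpha> \<le> 1" "0 \<le> \<kappa>" "0 \<le> l" "l < 1"
  shows "comp_mono (\<lambda>x. discrete_ml \<alpha> (\<kappa> * x - l) $ n)"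
proof (induction n rule: less_induct)
  case (less n)
  have "comp_mono (\<lambda>x. 1 / (1 - l + \<kappa> * x) * (binser (\<alpha> - 1) $ n + (\<Sum>m<n. - binser \<alpha> $ (n - m) * discrete_ml \<alpha> (\<kappa> * x - l) $ m)))"
    using assms less binser_nth_nonpos[of \<alpha>]
    by (intro comp_mono_mult comp_mono_inverse_affine comp_mono_add comp_mono_const comp_mono_sum binser_nth_nonneg comp_mono_cmult) auto
  then show ?case
  proof (rule comp_mono_cong)
    fix x :: real assume x: "0 \<le> x"
    then have "0 \<le> \<kappa> * x" using assms by simp
    then have c: "\<kappa> * x - l > -1" using assms by simp
    show "1 / (1 - l + \<kappa> * x) * (binser (\<alpha> - 1) $ n + (\<Sum>m<n. - binser \<alpha> $ (n - m) * discrete_ml \<alpha> (\<kappa> * x - l) $ m))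
        = discrete_ml \<alpha> (\<kappa> * x - l) $ n"
      unfolding discrete_ml_rec[OF c, symmetric] using c by (simp add: field_simps)
  qed
qed

text \<open>The shift $L$ to the left of the origin records that $E_\alpha$ is entire; through it the representing
measure acquires exponential moments.\<close>

lemma comp_mono_mittag_leffler:
  assumes "0 < \<alpha>" "\<alpha> \<le> 1" "0 \<le> L"
  shows "comp_mono (\<lambda>x. mittag_leffler \<alpha> (L - x))"
proof -
  have "(\<lambda>n. L / real n powr \<alpha>) \<longlonglongrightarrow> 0" using assms by real_asymp
  then have "eventually (\<lambda>n. L / real n powr \<alpha> < 1) sequentially"
    by (rule order_tendstoD) simp
  then obtain N where N: "\<And>n. n \<ge> N \<Longrightarrow> L / real n powr \<alpha> < 1"
    by (auto simp: eventually_sequentially)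
  show ?thesis
  proof (rule comp_mono.lim)
    show "comp_mono (\<lambda>x. discrete_ml \<alpha> (1 / real (n + N) powr \<alpha> * x - L / real (n + N) powr \<alpha>) $ (n + N))" for n
      using assms N[of "n + N"] by (intro comp_mono_discrete_ml) auto
    fix x :: real assume "0 \<le> x"
    have "(\<lambda>n. discrete_ml \<alpha> (- (L - x) / real n powr \<alpha>) $ n) \<longlonglongrightarrow> mittag_leffler \<alpha> (L - x)"
      by (rule discrete_ml_tendsto[OF assms(1,2)])
    then have "(\<lambda>n. discrete_ml \<alpha> (- (L - x) / real (n + N) powr \<alpha>) $ (n + N)) \<longlonglongrightarrow> mittag_leffler \<alpha> (L - x)"
      by (rule LIMSEQ_ignore_initial_segment)
    then show "(\<lambda>n. discrete_ml \<alpha> (1 / real (n + N) powr \<alpha> * x - L / real (n + N) powr \<alpha>) $ (n + N))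
        \<longlonglongrightarrow> mittag_leffler \<alpha> (L - x)"
      by (simp add: diff_divide_distrib)
  qed
qed

section \<open>Representation by probability measures\<close>

lemma exp_comb_bounds:
  assumes "\<forall>(a, s)\<in>set xs. 0 \<le> a \<and> 0 \<le> s" "0 \<le> x"
  shows "0 \<le> exp_comb xs x" "exp_comb xs x \<le> exp_comb xs 0"
proof -
  have "0 \<le> exp_comb xs x \<and> exp_comb xs x \<le> exp_comb xs 0"
    using assms(1)
  proof (induction xs)
    case (Cons p xs)
    then show ?case using assms(2)
      by (cases p) (auto intro!: add_mono mult_right_le_one_le)
  qed simp
  then show "0 \<le> exp_comb xs x" "exp_comb xs x \<le> exp_comb xs 0" by auto
qed

text \<open>In the variable $u = e^{-s}$ the rates live in the compact interval $[0,1]$, so that no mass can be lost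
in limits.\<close>

lemma exp_comb_rep:
  assumes xs: "\<forall>(a, s)\<in>set xs. 0 \<le> a \<and> 0 \<le> s"
  shows "\<exists>M. real_distribution M \<and> (AE u in M. 0 \<le> u \<and> u \<le> 1) \<and>
             (\<forall>x>0. exp_comb xs x = exp_comb xs 0 * (\<integral>u. u powr x \<partial>M))"
proof (cases "exp_comb xs 0 = 0")
  case True
  then have "exp_comb xs x = 0" if "x > 0" for x
    using exp_comb_bounds[OF xs, of x] that by simp
  moreover have "real_distribution (return borel (1::real))"
    by (intro real_distribution.intro prob_space_return real_distribution_axioms.intro) auto
  moreover have "AE u in return borel (1::real). 0 \<le> u \<and> u \<le> 1"
    by (subst AE_return) auto
  ultimately show ?thesis using True by (intro exI[of _ "return borel 1"]) auto
next
  case False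
  define A where "A = exp_comb xs 0"
  have A: "A > 0" using False exp_comb_bounds(1)[OF xs, of 0] by (simp add: A_def)
  define I where "I = {..<length xs}"
  define p where "p = (\<lambda>i. fst (xs ! i) / A)"
  define X where "X = (\<lambda>i. exp (- snd (xs ! i)))"
  have nth: "0 \<le> fst (xs ! i)" "0 \<le> snd (xs ! i)" if "i \<in> I" for i
    using xs nth_mem[of i xs] that by (auto simp: I_def case_prod_beta)
  have p: "0 \<le> p i" if "i \<in> I" for i using nth[OF that] A by (simp add: p_def)
  have es: "exp_comb xs x = (\<Sum>i\<in>I. fst (xs ! i) * exp (- (snd (xs ! i) * x)))" for x
    unfolding exp_comb_def I_def by (simp add: sum_list_sum_nth atLeast0LessThan case_prod_beta)
  define P where "P = point_measure I (\<lambda>i. ennreal (p i))"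
  have [simp]: "finite I" by (simp add: I_def)
  have sp: "space P = I" by (simp add: P_def space_point_measure)
  have "(\<Sum>i\<in>I. p i) = 1"
    using A es[of 0] by (simp add: p_def A_def sum_divide_distrib[symmetric])
  moreover have "emeasure P (space P) = (\<Sum>i\<in>I. ennreal (p i))"
    unfolding sp unfolding P_def by (subst emeasure_point_measure_finite) auto
  ultimately have "emeasure P (space P) = 1" using p by (simp add: sum_ennreal)
  then interpret P: prob_space P by (rule prob_spaceI)
  have [measurable]: "X \<in> P \<rightarrow>\<^sub>M borel" by (simp add: P_def measurable_point_measure_eq1)
  define M where "M = distr P borel X"
  have "real_distribution M" unfolding M_def by (rule P.real_distribution_distr) simp
  moreover have "AE u in M. 0 \<le> u \<and> u \<le> 1"
  proof -
    have "AE i in P. 0 \<le> X i \<and> X i \<le> 1" by (auto simp: X_def nth sp intro!: AE_I2)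
    then show ?thesis unfolding M_def by (subst AE_distr_iff) auto
  qed
  moreover have "exp_comb xs x = exp_comb xs 0 * (\<integral>u. u powr x \<partial>M)" for x
  proof -
    have "(\<integral>u. u powr x \<partial>M) = (\<integral>i. X i powr x \<partial>P)" unfolding M_def by (subst integral_distr) auto
    also have "\<dots> = (\<Sum>i\<in>I. X i powr x * p i)"
      unfolding P_def using p by (subst lebesgue_integral_point_measure_finite) (auto simp: mult.commute)
    also have "\<dots> = (\<Sum>i\<in>I. fst (xs ! i) * exp (- (snd (xs ! i) * x)) / A)"
      by (intro sum.cong refl) (simp add: X_def p_def powr_def mult_ac)
    also have "\<dots> = exp_comb xs x / A" by (simp add: es sum_divide_distrib)
    finally show ?thesis using A by (simp add: A_def)
  qed
  ultimately show ?thesis by blast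
qed

text \<open>Hausdorff's form of Bernstein's theorem. Measures on $[0,1]$ are tight, so Helly's theorem
provides a limit measure. The case $x = 0$ is excluded because $u^x$ is then discontinuous at $u = 0$,
the place of infinite rates.\<close>

lemma comp_mono_rep:
  assumes "comp_mono f"
  shows "\<exists>M. real_distribution M \<and> (AE u in M. 0 \<le> u \<and> u \<le> 1) \<and>
             (\<forall>x>0. f x = f 0 * (\<integral>u. u powr x \<partial>M))"
  using assms
proof (induction f rule: comp_mono.induct)
  case (base xs)
  then show ?case by (rule exp_comb_rep)
next
  case (lim f g)
  from lim.IH have "\<exists>M. \<forall>n. real_distribution (M n) \<and> (AE u in M n. 0 \<le> u \<and> u \<le> 1) \<and>
             (\<forall>x>0. f n x = f n 0 * (\<integral>u. u powr x \<partial>M n))"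
    by (intro choice) auto
  then obtain M where M: "\<And>n. real_distribution (M n)" "\<And>n. AE u in M n. 0 \<le> u \<and> u \<le> 1"
    and fM: "\<And>n x. 0 < x \<Longrightarrow> f n x = f n 0 * (\<integral>u. u powr x \<partial>M n)" by blast
  \<comment> \<open>Clamping to $[0,1]$ turns $u^x$ into a bounded continuous function on the whole line.\<close>
  define k where "k = (\<lambda>u::real. max 0 (min 1 u))"
  have kb: "0 \<le> k u" "k u \<le> 1" for u by (auto simp: k_def)
  have [measurable]: "k \<in> borel_measurable borel" by (simp add: k_def)
  have "tight M"
    unfolding tight_def
  proof (intro conjI allI impI)
    fix e :: real assume "e > 0"
    have "measure (M n) {-1<..1} > 1 - e" for n
    proof -
      interpret real_distribution "M n" by (rule M)
      have "AE u in M n. u \<in> {-1<..1}" using M(2)[of n] by eventually_elim auto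
      then have "measure (M n) {-1<..1} = 1" by (subst prob_eq_1) auto
      with \<open>e > 0\<close> show ?thesis by simp
    qed
    then show "\<exists>a b. a < b \<and> (\<forall>n. measure (M n) {a<..b} > 1 - e)"
      by (intro exI[of _ "-1"] exI[of _ 1]) auto
  qed (rule M)
  from tight_imp_convergent_subsubsequence[OF this strict_mono_id] obtain r N where
    r: "strict_mono r" and N: "real_distribution N" and wc: "weak_conv_m (M \<circ> r) N"
    by (auto simp: id_def comp_def)
  interpret N: real_distribution N by (rule N)
  define N' where "N' = distr N borel k"
  have "real_distribution N'" unfolding N'_def by (rule N.real_distribution_distr) simp
  moreover have "AE u in N'. 0 \<le> u \<and> u \<le> 1"
    unfolding N'_def by (subst AE_distr_iff) (auto simp: kb)
  moreover have "g x = g 0 * (\<integral>u. u powr x \<partial>N')" if x: "x > 0" for x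
  proof -
    have "continuous_on UNIV (\<lambda>u. k u powr x)"
      using x kb by (intro continuous_on_powr' continuous_intros) (auto simp: k_def intro!: continuous_intros)
    then have "(\<lambda>n. \<integral>u. k u powr x \<partial>(M \<circ> r) n) \<longlonglongrightarrow> (\<integral>u. k u powr x \<partial>N)"
      using M N wc kb x
      by (intro weak_conv_imp_integral_bdd_continuous_conv[where B = 1])
         (auto simp: continuous_on_eq_continuous_at comp_def intro!: powr_le1)
    also have "(\<integral>u. k u powr x \<partial>N) = (\<integral>u. u powr x \<partial>N')"
      unfolding N'_def by (subst integral_distr) auto
    also have "(\<lambda>n. \<integral>u. k u powr x \<partial>(M \<circ> r) n) = (\<lambda>n. \<integral>u. u powr x \<partial>M (r n))"
    proof
      fix n
      interpret R: real_distribution "M (r n)" by (rule M)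
      show "(\<integral>u. k u powr x \<partial>(M \<circ> r) n) = (\<integral>u. u powr x \<partial>M (r n))"
        unfolding comp_def
        using M(2)[of "r n"] by (intro integral_cong_AE) (auto simp: k_def)
    qed
    finally have "(\<lambda>n. f (r n) 0 * (\<integral>u. u powr x \<partial>M (r n))) \<longlonglongrightarrow> g 0 * (\<integral>u. u powr x \<partial>N')"
      using LIMSEQ_subseq_LIMSEQ[OF lim(2)[of 0] r] by (intro tendsto_mult) (auto simp: comp_def)
    moreover have "(\<lambda>n. f (r n) 0 * (\<integral>u. u powr x \<partial>M (r n))) \<longlonglongrightarrow> g x"
      using LIMSEQ_subseq_LIMSEQ[OF lim(2)[of x] r] x by (simp add: comp_def flip: fM)
    ultimately show ?thesis using LIMSEQ_unique by blast
  qed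
  ultimately show ?case by blast
qed

text \<open>Continuity at $0$ excludes mass at $u = 0$, and decay at infinity excludes mass at $u = 1$, that is,
at rate $0$.\<close>

lemma comp_mono_laplace:
  assumes "comp_mono f" "f 0 > 0" "(f \<longlongrightarrow> f 0) (at_right 0)" "(f \<longlongrightarrow> 0) at_top"
  shows "\<exists>N. real_distribution N \<and> (AE s in N. 0 < s) \<and>
             (\<forall>x\<ge>0. f x = f 0 * (\<integral>s. exp (- (x * s)) \<partial>N))"
proof -
  from comp_mono_rep[OF assms(1)] obtain M where M: "real_distribution M" "AE u in M. 0 \<le> u \<and> u \<le> 1"
    and fM: "\<And>x. 0 < x \<Longrightarrow> f x = f 0 * (\<integral>u. u powr x \<partial>M)" by blast
  interpret M: real_distribution M by (rule M)
  have 0: "AE u in M. 0 < u"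
  proof -
    have "(\<lambda>n. \<integral>u. u powr (1 / real (Suc n)) \<partial>M) \<longlonglongrightarrow> (\<integral>u. indicator {0<..} u \<partial>M)"
    proof (rule integral_dominated_convergence[where w = "\<lambda>_. 1"])
      show "AE u in M. (\<lambda>n. u powr (1 / real (Suc n))) \<longlonglongrightarrow> indicator {0<..} u"
        using M(2)
      proof eventually_elim
        case (elim u)
        show ?case
        proof (cases "u = 0")
          case False
          with elim have u: "u > 0" by simp
          have "(\<lambda>n. u powr (1 / real (Suc n))) \<longlonglongrightarrow> u powr 0"
            using u by (intro tendsto_powr tendsto_const LIMSEQ_Suc lim_1_over_n) auto
          with u show ?thesis by simp
        qed simp
      qed
      show "AE u in M. norm (u powr (1 / real (Suc n))) \<le> 1" for n
        using M(2) by eventually_elim (auto intro!: powr_le1)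
    qed auto
    then have "(\<lambda>n. f 0 * (\<integral>u. u powr (1 / real (Suc n)) \<partial>M)) \<longlonglongrightarrow> f 0 * measure M {0<..}"
      by (intro tendsto_mult tendsto_const) simp
    also have "(\<lambda>n. f 0 * (\<integral>u. u powr (1 / real (Suc n)) \<partial>M)) = (\<lambda>n. f (1 / real (Suc n)))"
      by (intro ext fM[symmetric]) simp
    finally have "(\<lambda>n. f (1 / real (Suc n))) \<longlonglongrightarrow> f 0 * measure M {0<..}" .
    moreover have "filterlim (\<lambda>n. 1 / real (Suc n)) (at_right 0) sequentially" by real_asymp
    from filterlim_compose[OF assms(3) this] have "(\<lambda>n. f (1 / real (Suc n))) \<longlonglongrightarrow> f 0" .
    ultimately have "f 0 * measure M {0<..} = f 0" using LIMSEQ_unique by blast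
    then have "measure M {0<..} = 1" using assms(2) by simp
    then show ?thesis by (subst (asm) M.prob_eq_1) auto
  qed
  have 1: "AE u in M. u < 1"
  proof -
    have "(\<lambda>n. \<integral>u. u powr (real (Suc n)) \<partial>M) \<longlonglongrightarrow> (\<integral>u. indicator {1..} u \<partial>M)"
    proof (rule integral_dominated_convergence[where w = "\<lambda>_. 1"])
      show "AE u in M. (\<lambda>n. u powr (real (Suc n))) \<longlonglongrightarrow> indicator {1..} u"
        using M(2)
      proof eventually_elim
        case (elim u)
        show ?case
        proof (cases "u = 1")
          case False
          with elim have u: "0 \<le> u" "u < 1" by simp_all
          have "(\<lambda>n. u ^ Suc n) \<longlonglongrightarrow> 0"
            using u by (intro LIMSEQ_Suc LIMSEQ_realpow_zero) auto
          with u show ?thesis by (simp add: powr_realpow' del: of_nat_Suc power_Suc)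
        qed simp
      qed
      show "AE u in M. norm (u powr (real (Suc n))) \<le> 1" for n
        using M(2) by eventually_elim (auto intro!: powr_le1)
    qed auto
    then have "(\<lambda>n. f 0 * (\<integral>u. u powr (real (Suc n)) \<partial>M)) \<longlonglongrightarrow> f 0 * measure M {1..}"
      by (intro tendsto_mult tendsto_const) simp
    also have "(\<lambda>n. f 0 * (\<integral>u. u powr (real (Suc n)) \<partial>M)) = (\<lambda>n. f (real (Suc n)))"
      by (intro ext fM[symmetric]) simp
    finally have "(\<lambda>n. f (real (Suc n))) \<longlonglongrightarrow> f 0 * measure M {1..}" .
    moreover have "filterlim (\<lambda>n. real (Suc n)) at_top sequentially" by real_asymp
    from filterlim_compose[OF assms(4) this] have "(\<lambda>n. f (real (Suc n))) \<longlonglongrightarrow> 0" .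
    ultimately have "f 0 * measure M {1..} = 0" using LIMSEQ_unique by blast
    then have "measure M {1..} = 0" using assms(2) by simp
    then have "AE u in M. u \<notin> {1..}" by (subst (asm) M.prob_eq_0) auto
    then show ?thesis by eventually_elim auto
  qed
  define N where "N = distr M borel (\<lambda>u. - ln u)"
  have "real_distribution N" unfolding N_def by (rule M.real_distribution_distr) simp
  moreover have "AE s in N. 0 < s"
    unfolding N_def by (subst AE_distr_iff) (use 0 1 in \<open>auto elim: eventually_elim2 simp: ln_less_zero_iff\<close>)
  moreover have "f x = f 0 * (\<integral>s. exp (- (x * s)) \<partial>N)" if "x \<ge> 0" for x
  proof (cases "x = 0")
    case True
    interpret N: real_distribution N by fact
    show ?thesis using True N.prob_space by simp
  next
    case False
    with that have x: "x > 0" by simp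
    have "(\<integral>s. exp (- (x * s)) \<partial>N) = (\<integral>u. exp (- (x * - ln u)) \<partial>M)"
      unfolding N_def by (subst integral_distr) auto
    also have "\<dots> = (\<integral>u. u powr x \<partial>M)"
      by (intro integral_cong_AE) (use 0 in \<open>auto elim!: eventually_mono simp: powr_def\<close>)
    finally show ?thesis using fM[OF x] by simp
  qed
  ultimately show ?thesis by blast
qed

section \<open>Mittag-Leffler functions as Laplace transforms\<close>

lemma mittag_leffler_0 [simp]: "mittag_leffler \<alpha> 0 = 1"
  using powser_zero[of "\<lambda>k. 1 / Gamma (1 + \<alpha> * real k)"] by (simp add: mittag_leffler_def)

lemma mittag_leffler_ge_1:
  assumes "0 < \<alpha>" "\<alpha> \<le> 1" "0 \<le> z" shows "1 \<le> mittag_leffler \<alpha> z"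
proof -
  have "0 < 1 + \<alpha> * real k" for k using assms by (intro add_pos_nonneg) auto
  then have "sum (\<lambda>k. z ^ k / Gamma (1 + \<alpha> * real k)) {0} \<le> mittag_leffler \<alpha> z"
    unfolding mittag_leffler_def using assms
    by (intro sum_le_suminf summable_mittag_leffler) (auto intro!: divide_nonneg_nonneg less_imp_le[OF Gamma_real_pos])
  then show ?thesis by simp
qed

lemma mittag_leffler_tendsto_0:
  assumes "0 < \<alpha>" "\<alpha> < 1"
  shows "((\<lambda>z. mittag_leffler \<alpha> (- z)) \<longlongrightarrow> 0) at_top"
proof (rule real_tendsto_sandwich)
  have G: "Gamma (1 + \<alpha>) > 0" "Gamma (1 - \<alpha>) > 0" using assms by simp_all
  show "eventually (\<lambda>z. 1 / (1 + Gamma (1 - \<alpha>) * z) \<le> mittag_leffler \<alpha> (- z)) at_top"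
    using eventually_ge_at_top[of 0] by eventually_elim (intro mittag_leffler_lower assms)
  show "eventually (\<lambda>z. mittag_leffler \<alpha> (- z) \<le> 1 / (1 + z / Gamma (1 + \<alpha>))) at_top"
    using eventually_ge_at_top[of 0] by eventually_elim (intro mittag_leffler_upper assms)
  show "((\<lambda>z. 1 / (1 + z / Gamma (1 + \<alpha>))) \<longlongrightarrow> 0) at_top" using G by real_asymp
  show "((\<lambda>z. 1 / (1 + Gamma (1 - \<alpha>) * z)) \<longlongrightarrow> 0) at_top" using G by real_asymp
qed

lemma mittag_leffler_powr_laplace:
  assumes "0 < \<alpha>" "\<alpha> < 1" "0 < g" "g \<le> 1"
  shows "\<exists>N. real_distribution N \<and> (AE s in N. 0 < s) \<and>
             (\<forall>x\<ge>0. mittag_leffler \<alpha> (- (x powr g)) = (\<integral>s. exp (- (x * s)) \<partial>N))"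
proof -
  have comp_mono: "comp_mono (\<lambda>x. mittag_leffler \<alpha> (- (x powr g)))"
    using comp_mono_comp_powr[OF comp_mono_mittag_leffler[of \<alpha> 0], of g] assms by simp
  have "((\<lambda>x. mittag_leffler \<alpha> (- (x powr g))) \<longlongrightarrow> mittag_leffler \<alpha> (- 0)) (at_right 0)"
  proof (rule isCont_tendsto_compose[OF continuous_mittag_leffler])
    show "((\<lambda>x. - (x powr g)) \<longlongrightarrow> - 0) (at_right 0)" using assms by real_asymp
  qed (use assms in auto)
  moreover have "((\<lambda>x. mittag_leffler \<alpha> (- (x powr g))) \<longlongrightarrow> 0) at_top"
  proof (rule filterlim_compose[OF mittag_leffler_tendsto_0])
    show "filterlim (\<lambda>x. x powr g) at_top at_top" using assms by real_asymp
  qed (use assms in auto)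
  ultimately show ?thesis using comp_mono_laplace[OF comp_mono] by simp
qed

text \<open>Exponential tilting: if $N_L$ represents $x \mapsto E_\alpha(L - x)$, then the measure with density
$E_\alpha(L)\, e^{-Ls}$ with respect to $N_L$ represents $E_\alpha(-x)$, now for all $x \ge -L$.\<close>

lemma mittag_leffler_bilateral_laplace:
  assumes "0 < \<alpha>" "\<alpha> < 1" "0 \<le> L"
  shows "\<exists>N. real_distribution N \<and> (AE s in N. 0 < s) \<and>
             (\<forall>x\<ge>-L. has_bochner_integral N (\<lambda>s. exp (- (x * s))) (mittag_leffler \<alpha> (- x)))"
proof -
  define m where "m = mittag_leffler \<alpha> L"
  have m: "m \<ge> 1" unfolding m_def using assms by (intro mittag_leffler_ge_1) auto
  have "((\<lambda>x. mittag_leffler \<alpha> (L - x)) \<longlongrightarrow> mittag_leffler \<alpha> (L - 0)) (at_right 0)"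
  proof (rule isCont_tendsto_compose[OF continuous_mittag_leffler])
    show "((\<lambda>x. L - x) \<longlongrightarrow> L - 0) (at_right 0)" by (intro tendsto_diff tendsto_const tendsto_ident_at)
  qed (use assms in auto)
  moreover have "((\<lambda>x. mittag_leffler \<alpha> (- (x - L))) \<longlongrightarrow> 0) at_top"
  proof (rule filterlim_compose[OF mittag_leffler_tendsto_0])
    show "filterlim (\<lambda>x. x - L) at_top at_top" by real_asymp
  qed (use assms in auto)
  ultimately obtain N where N: "real_distribution N" "AE s in N. 0 < s"
    and g: "\<And>x. x \<ge> 0 \<Longrightarrow> mittag_leffler \<alpha> (L - x) = m * (\<integral>s. exp (- (x * s)) \<partial>N)"
    using comp_mono_laplace[OF comp_mono_mittag_leffler[of \<alpha> L]] assms m by (auto simp: m_def)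
  interpret N: real_distribution N by (rule N)
  have int: "integrable N (\<lambda>s. exp (- (x * s)))" if "x \<ge> 0" for x
  proof (rule N.integrable_const_bound[where B = 1])
    show "AE s in N. norm (exp (- (x * s))) \<le> 1"
      using N(2) by eventually_elim (use that in auto)
  qed auto
  define h where "h = (\<lambda>s. m * exp (- (L * s)))"
  have h0: "h s \<ge> 0" for s using m by (simp add: h_def)
  have hm [measurable]: "h \<in> borel_measurable borel" by (simp add: h_def)
  define N' where "N' = density N (\<lambda>s. ennreal (h s))"
  have main: "has_bochner_integral N' (\<lambda>s. exp (- (x * s))) (mittag_leffler \<alpha> (- x))" if x: "x \<ge> -L" for x
  proof -
    have "has_bochner_integral N (\<lambda>s. m * exp (- ((x + L) * s))) (m * (\<integral>s. exp (- ((x + L) * s)) \<partial>N))"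
      using x by (intro has_bochner_integral_mult_right has_bochner_integral_integrable int) auto
    also have "(\<lambda>s. m * exp (- ((x + L) * s))) = (\<lambda>s. h s *\<^sub>R exp (- (x * s)))"
      by (simp add: h_def fun_eq_iff algebra_simps flip: exp_add)
    also have "m * (\<integral>s. exp (- ((x + L) * s)) \<partial>N) = mittag_leffler \<alpha> (- x)"
      using g[of "x + L"] x by simp
    finally show ?thesis
      unfolding N'_def using h0 by (intro has_bochner_integral_density) auto
  qed
  have "emeasure N' (space N') = 1"
  proof -
    have "has_bochner_integral N' (\<lambda>s. 1::real) 1" using main[of 0] assms by simp
    then have "(\<integral>\<^sup>+s. ennreal 1 \<partial>N') = ennreal 1"
      using nn_integral_eq_integral[of N' "\<lambda>_. 1"] unfolding has_bochner_integral_iff by simp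
    then show ?thesis by simp
  qed
  then have "prob_space N'" by (rule prob_spaceI)
  then have "real_distribution N'"
    by (intro real_distribution.intro real_distribution_axioms.intro) (auto simp: N'_def)
  moreover have "AE s in N'. 0 < s"
    unfolding N'_def using N(2) by (subst AE_density) auto
  ultimately show ?thesis using main by blast
qed

section \<open>The heat kernel\<close>

definition heat :: "real \<Rightarrow> 'a::euclidean_space \<Rightarrow> real" where
  "heat s x = (4 * pi * s) powr (- (real DIM('a) / 2)) * exp (- (norm x)\<^sup>2 / (4 * s))"

lemma heat_nonneg [simp]: "0 \<le> heat s x"
  by (simp add: heat_def)

lemma heat_pos: "0 < s \<Longrightarrow> 0 < heat s x"
  by (simp add: heat_def)

lemma borel_measurable_heat' [measurable (raw)]:
  assumes [measurable]: "f \<in> borel_measurable M" "g \<in> borel_measurable M"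
  shows "(\<lambda>x. heat (f x) (g x)) \<in> borel_measurable M"
  unfolding heat_def by measurable

lemma heat_eq_prod_normal_density:
  assumes "s > 0"
  shows "heat s x = (\<Prod>b\<in>Basis. normal_density 0 (sqrt (2 * s)) (x \<bullet> b))"
proof -
  have "(norm x)\<^sup>2 = (\<Sum>b\<in>Basis. (x \<bullet> b)\<^sup>2)"
    by (simp add: norm_eq_sqrt_inner euclidean_inner[of x x] power2_eq_square sum_nonneg)
  then have "exp (- (norm x)\<^sup>2 / (4 * s)) = (\<Prod>b\<in>Basis. exp (- (x \<bullet> b)\<^sup>2 / (4 * s)))"
    by (simp add: exp_sum[symmetric] sum_negf sum_divide_distrib)
  moreover have "(4 * pi * s) powr (- (real DIM('a) / 2)) = (\<Prod>b\<in>(Basis::'a set). 1 / sqrt (4 * pi * s))"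
  proof -
    have "(4 * pi * s) powr (- (real DIM('a) / 2)) = ((4 * pi * s) powr (- (1/2))) ^ DIM('a)"
      using assms by (subst powr_mult_of_nat[symmetric]) auto
    also have "(4 * pi * s) powr (- (1/2)) = 1 / sqrt (4 * pi * s)"
      using powr_half_sqrt[of "4 * pi * s"] assms by (simp only: powr_minus inverse_eq_divide) simp
    finally show ?thesis by simp
  qed
  moreover have "normal_density 0 (sqrt (2 * s)) y = 1 / sqrt (4 * pi * s) * exp (- y\<^sup>2 / (4 * s))" for y
  proof -
    have e: "(sqrt (2 * s))\<^sup>2 = 2 * s"
      by (rule real_sqrt_pow2) (use assms in linarith)
    have e': "2 * pi * (2 * s) = 4 * pi * s" "2 * (2 * s) = 4 * s" by algebra+
    show ?thesis unfolding normal_density_def e e' diff_0_right ..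
  qed
  ultimately show ?thesis unfolding heat_def by (simp only: prod.distrib)
qed

text \<open>Fubini's theorem for products of functions of one coordinate each.\<close>

lemma lborel_prod:
  fixes f :: "'a::euclidean_space \<Rightarrow> real \<Rightarrow> 'b::{real_normed_field,banach,second_countable_topology}"
  assumes f: "\<And>b. b \<in> Basis \<Longrightarrow> integrable lborel (f b)"
  shows "integrable lborel (\<lambda>x. \<Prod>b\<in>Basis. f b (x \<bullet> b))"
    and "(LINT x|lborel. (\<Prod>b\<in>Basis. f b (x \<bullet> b))) = (\<Prod>b\<in>Basis. (LINT x|lborel. f b x))"
proof -
  interpret product_sigma_finite "\<lambda>_::'a. lborel :: real measure" ..
  have [measurable]: "f b \<in> borel_measurable borel" if "b \<in> Basis" for b
    using f[OF that] by auto
  have eq: "(\<Prod>b\<in>Basis. f b ((\<Sum>b\<in>Basis. w b *\<^sub>R b) \<bullet> b)) = (\<Prod>b\<in>Basis. f b (w b))" for w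
    by (intro prod.cong refl) (simp add: inner_sum_left_Basis)
  show "integrable lborel (\<lambda>x. \<Prod>b\<in>Basis. f b (x \<bullet> b))"
    by (subst lborel_eq, subst integrable_distr_eq) (use product_integrable_prod[of Basis f] f in \<open>auto simp: eq\<close>)
  show "(LINT x|lborel. (\<Prod>b\<in>Basis. f b (x \<bullet> b))) = (\<Prod>b\<in>Basis. (LINT x|lborel. f b x))"
    by (subst (1) lborel_eq, subst integral_distr) (use product_integral_prod[of Basis f] f in \<open>auto simp: eq\<close>)
qed

lemma normal_density_fourier:
  assumes "s > 0"
  shows "(LINT x|lborel. iexp (- (t * x)) * complex_of_real (normal_density 0 (sqrt (2 * s)) x))
       = complex_of_real (exp (- (s * t\<^sup>2)))"
proof -
  let ?c = "sqrt (2 * s)"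
  have c: "?c > 0" using assms by simp
  have nd: "?c * normal_density 0 ?c (?c * x) = std_normal_density x" for x
    using assms by (simp add: normal_density_def power_mult_distrib real_sqrt_mult field_simps)
  have "(LINT x|lborel. iexp (- (t * x)) * complex_of_real (normal_density 0 ?c x))
      = ?c *\<^sub>R (LINT x|lborel. iexp (- (t * (0 + ?c * x))) * complex_of_real (normal_density 0 ?c (0 + ?c * x)))"
    using c by (subst lborel_integral_real_affine[where c = ?c and t = 0]) auto
  also have "\<dots> = (LINT x|lborel. std_normal_density x *\<^sub>R iexp ((- t * ?c) * x))"
    unfolding nd[symmetric] by (subst integral_scaleR_right[symmetric])
      (auto simp: scaleR_conv_of_real mult_ac intro!: Bochner_Integration.integral_cong)
  also have "\<dots> = char std_normal_distribution (- t * ?c)"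
    unfolding char_def by (subst integral_density) auto
  also have "\<dots> = complex_of_real (exp (- (s * t\<^sup>2)))"
    using assms by (simp add: char_std_normal_distribution power_mult_distrib mult_ac)
  finally show ?thesis .
qed

lemma heat_fourier:
  assumes "s > 0"
  shows "(LINT x|lborel. iexp (- (x \<bullet> y)) * complex_of_real (heat s x))
       = complex_of_real (exp (- (s * (norm (y::'a::euclidean_space))\<^sup>2)))"
proof -
  let ?c = "sqrt (2 * s)"
  let ?f = "\<lambda>b x. iexp (- ((y \<bullet> b) * x)) * complex_of_real (normal_density 0 ?c x)"
  have "integrable lborel (?f b)" for b
  proof (rule Bochner_Integration.integrable_bound[where f = "normal_density 0 ?c"])
    show "integrable lborel (normal_density 0 ?c)" using assms by simp
  qed (auto simp: norm_mult simp del: of_real_minus of_real_mult)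
  note i = lborel_prod(2)[of ?f, OF this]
  have "iexp (- (x \<bullet> y)) * complex_of_real (heat s x) = (\<Prod>b\<in>Basis. ?f b (x \<bullet> b))" for x :: 'a
  proof -
    have "iexp (- (x \<bullet> y)) = (\<Prod>b\<in>Basis. iexp (- ((y \<bullet> b) * (x \<bullet> b))))"
      by (subst euclidean_inner) (simp add: exp_sum[symmetric] sum_negf sum_distrib_left mult_ac)
    then show ?thesis using assms by (simp add: heat_eq_prod_normal_density prod.distrib)
  qed
  then have "(LINT x|lborel. iexp (- (x \<bullet> y)) * complex_of_real (heat s x))
       = (\<Prod>b\<in>Basis. complex_of_real (exp (- (s * (y \<bullet> b)\<^sup>2))))"
    using i assms by (simp only: normal_density_fourier)
  also have "\<dots> = complex_of_real (exp (- (s * (norm y)\<^sup>2)))"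
  proof -
    have "(norm y)\<^sup>2 = (\<Sum>b\<in>Basis. (y \<bullet> b)\<^sup>2)"
      by (simp add: norm_eq_sqrt_inner euclidean_inner[of y y] power2_eq_square sum_nonneg)
    then show ?thesis by (simp add: exp_sum[symmetric] sum_negf sum_distrib_left flip: of_real_prod)
  qed
  finally show ?thesis .
qed

lemma heat_integral:
  assumes "s > 0"
  shows "has_bochner_integral lborel (heat s :: 'a::euclidean_space \<Rightarrow> real) 1"
proof -
  have "integrable lborel (\<lambda>x::'a. \<Prod>b\<in>Basis. normal_density 0 (sqrt (2 * s)) (x \<bullet> b))"
    "(LINT x|lborel. (\<Prod>b\<in>(Basis::'a set). normal_density 0 (sqrt (2 * s)) (x \<bullet> b))) = 1"
    using assms lborel_prod[of "\<lambda>_::'a. normal_density 0 (sqrt (2 * s))"] by simp_all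
  moreover have "(heat s :: 'a \<Rightarrow> real) = (\<lambda>x. \<Prod>b\<in>Basis. normal_density 0 (sqrt (2 * s)) (x \<bullet> b))"
    by (rule ext) (rule heat_eq_prod_normal_density[OF assms])
  ultimately show ?thesis by (simp add: has_bochner_integral_iff)
qed

lemma lborel_distr_reflect: "distr lborel borel (\<lambda>y::'a::euclidean_space. x - y) = lborel"
  using lborel_affine[of "-1" x] by (simp add: density_1)

lemma has_bochner_integral_reflect:
  fixes f :: "'a::euclidean_space \<Rightarrow> 'b::{banach,second_countable_topology}"
  assumes "has_bochner_integral lborel f I"
  shows "has_bochner_integral lborel (\<lambda>y. f (x - y)) I"
proof -
  have [measurable]: "f \<in> borel_measurable borel" using assms by (auto simp: has_bochner_integral_iff)
  have "has_bochner_integral (distr lborel borel (\<lambda>y. x - y)) f I" using assms by (simp add: lborel_distr_reflect)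
  then show ?thesis by (simp add: has_bochner_integral_iff integrable_distr_eq integral_distr)
qed

text \<open>Completing the square.\<close>

lemma heat_exp_integral:
  assumes "s > 0"
  shows "has_bochner_integral lborel (\<lambda>x::'a::euclidean_space. exp (a \<bullet> x) * heat s x) (exp (s * (norm a)\<^sup>2))"
proof -
  have "has_bochner_integral lborel (\<lambda>x. exp (s * (norm a)\<^sup>2) * heat s ((2 * s) *\<^sub>R a - x)) (exp (s * (norm a)\<^sup>2) * 1)"
    by (intro has_bochner_integral_mult_right has_bochner_integral_reflect heat_integral assms)
  moreover have "exp (s * (norm a)\<^sup>2) * heat s ((2 * s) *\<^sub>R a - x) = exp (a \<bullet> x) * heat s x" for x :: 'a
  proof -
    have "(norm ((2 * s) *\<^sub>R a - x))\<^sup>2 = 4 * s\<^sup>2 * (norm a)\<^sup>2 - 4 * s * (a \<bullet> x) + (norm x)\<^sup>2"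
      unfolding power2_norm_eq_inner
      by (simp add: inner_diff_left inner_diff_right inner_commute algebra_simps power2_eq_square)
    then have "- (norm ((2 * s) *\<^sub>R a - x))\<^sup>2 / (4 * s) = a \<bullet> x - s * (norm a)\<^sup>2 + - (norm x)\<^sup>2 / (4 * s)"
      using assms by (simp add: field_simps power2_eq_square)
    then have "exp (s * (norm a)\<^sup>2) * exp (- (norm ((2 * s) *\<^sub>R a - x))\<^sup>2 / (4 * s)) = exp (a \<bullet> x) * exp (- (norm x)\<^sup>2 / (4 * s))"
      by (simp flip: exp_add)
    then show ?thesis by (simp add: heat_def)
  qed
  ultimately show ?thesis by simp
qed

section \<open>Uniqueness of Fourier transforms\<close>

text \<open>A Gaussian is itself a Fourier transform, so averaging $h$ against it amounts, by Fubini, to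
averaging $\hat h = 0$.\<close>

lemma gaussian_average_eq_0:
  fixes h :: "'a::euclidean_space \<Rightarrow> real"
  assumes h: "integrable lborel h"
    and F: "\<And>y. (LINT x|lborel. iexp (- (x \<bullet> y)) * complex_of_real (h x)) = 0"
    and \<sigma>: "\<sigma> > 0"
  shows "(LINT y|lborel. h y * exp (- (\<sigma> * (norm (x - y))\<^sup>2))) = 0"
proof -
  have [measurable]: "h \<in> borel_measurable borel" using h by auto
  define f where "f = (\<lambda>y z. iexp (- (z \<bullet> (x - y))) * complex_of_real (heat \<sigma> z) * complex_of_real (h y))"
  have norm_f: "norm (f y z) = heat \<sigma> z * \<bar>h y\<bar>" for y z
    by (simp add: f_def norm_mult)
  have hi: "integrable lborel (heat \<sigma> :: 'a \<Rightarrow> real)" "(LINT z|lborel. heat \<sigma> (z::'a)) = 1"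
    using heat_integral[OF \<sigma>] by (auto simp: has_bochner_integral_iff)
  have [measurable]: "case_prod f \<in> borel_measurable (lborel \<Otimes>\<^sub>M lborel)"
    unfolding f_def by measurable
  have int: "integrable (lborel \<Otimes>\<^sub>M lborel) (case_prod f)"
  proof (rule lborel_pair.Fubini_integrable)
    show "integrable lborel (\<lambda>y. LINT z|lborel. norm (case_prod f (y, z)))"
      using h hi by (simp add: norm_f)
    show "AE y in lborel. integrable lborel (\<lambda>z. case_prod f (y, z))"
    proof (rule AE_I2)
      fix y :: 'a
      show "integrable lborel (\<lambda>z. case_prod f (y, z))"
        by (rule Bochner_Integration.integrable_bound[where f = "\<lambda>z. heat \<sigma> z * \<bar>h y\<bar>"])
           (use hi in \<open>auto simp: norm_f\<close>)
    qed
  qed simp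
  have "complex_of_real (LINT y|lborel. h y * exp (- (\<sigma> * (norm (x - y))\<^sup>2)))
      = (LINT y|lborel. (LINT z|lborel. f y z))"
  proof -
    have "(LINT z|lborel. f y z) = complex_of_real (h y * exp (- (\<sigma> * (norm (x - y))\<^sup>2)))" for y
    proof -
      have "(LINT z|lborel. f y z)
          = (LINT z|lborel. iexp (- (z \<bullet> (x - y))) * complex_of_real (heat \<sigma> z)) * complex_of_real (h y)"
        unfolding f_def by (rule integral_mult_left_zero)
      then show ?thesis by (simp only: heat_fourier[OF \<sigma>] of_real_mult) (rule mult.commute)
    qed
    then show ?thesis by (simp only: integral_complex_of_real)
  qed
  also have "\<dots> = (LINT z|lborel. (LINT y|lborel. f y z))"
    by (rule lborel_pair.Fubini_integral[OF int, symmetric])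
  also have "\<dots> = (LINT z|(lborel :: 'a measure). 0)"
  proof (rule Bochner_Integration.integral_cong[OF refl])
    fix z :: 'a
    have "f y z = iexp (- (z \<bullet> x)) * complex_of_real (heat \<sigma> z) * (iexp (- (y \<bullet> (- z))) * complex_of_real (h y))" for y
      by (simp add: f_def inner_diff_right inner_commute algebra_simps flip: exp_add)
    then show "(LINT y|lborel. f y z) = 0" using F[of "- z"] by simp
  qed
  finally show ?thesis by simp
qed

text \<open>If $h(x) > 0$, then the Gaussian averages around $x$ with $\sigma = n$ contain a positive contribution
of order $n^{-d/2}$ from the ball of radius $n^{-1/2}$, while the rest is at least
$-\|h\|_1 e^{-n\delta^2}$. For large $n$ the average cannot vanish.\<close>

lemma fourier_zero_imp_nonpos:
  fixes h :: "'a::euclidean_space \<Rightarrow> real"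
  assumes h: "integrable lborel h"
    and F: "\<And>y. (LINT x|lborel. iexp (- (x \<bullet> y)) * complex_of_real (h x)) = 0"
    and cont: "isCont h x"
  shows "h x \<le> 0"
proof (rule ccontr)
  assume "\<not> h x \<le> 0"
  then have a: "h x > 0" by simp
  define d where "d = real DIM('a)"
  define V where "V = unit_ball_vol d"
  have V: "V > 0" by (simp add: V_def d_def)
  from cont a have "eventually (\<lambda>y. h y > h x / 2) (nhds x)"
    by (intro order_tendstoD(1)[of h "h x"]) (auto simp: isCont_def tendsto_at_iff_tendsto_nhds)
  then obtain \<delta> where \<delta>: "\<delta> > 0" "\<And>y. dist y x < \<delta> \<Longrightarrow> h y > h x / 2"
    unfolding eventually_nhds_metric by blast
  define B where "B = (LINT y|lborel. \<bar>h y\<bar>)"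
  have bound: "h x / 2 * exp (- 1) * V \<le> B * (real n powr (d / 2) * exp (- (real n * \<delta>\<^sup>2)))"
    if n: "1 / sqrt (real n) < \<delta>" "n > 0" for n
  proof -
    define r where "r = 1 / sqrt (real n)"
    have r: "r > 0" "r < \<delta>" "real n * r\<^sup>2 = 1"
      using n by (auto simp: r_def power_divide)
    have "h x / 2 * exp (- 1) * indicator (ball x r) y - \<bar>h y\<bar> * exp (- (real n * \<delta>\<^sup>2))
          \<le> h y * exp (- (real n * (norm (x - y))\<^sup>2))" for y
    proof (cases "dist y x < \<delta>")
      case True
      then have hy: "h y > h x / 2" by (rule \<delta>)
      have "h x / 2 * exp (- 1) * indicator (ball x r) y \<le> h y * exp (- (real n * (norm (x - y))\<^sup>2))"
      proof (cases "y \<in> ball x r")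
        case True
        then have "real n * (norm (x - y))\<^sup>2 \<le> real n * r\<^sup>2"
          by (intro mult_left_mono power_mono) (auto simp: dist_norm)
        then have "exp (- 1) \<le> exp (- (real n * (norm (x - y))\<^sup>2))" using r by simp
        with hy a have "h x / 2 * exp (- 1) \<le> h y * exp (- (real n * (norm (x - y))\<^sup>2))"
          by (intro mult_mono) auto
        with True show ?thesis by simp
      qed (use hy a in auto)
      moreover have "\<bar>h y\<bar> * exp (- (real n * \<delta>\<^sup>2)) \<ge> 0" by simp
      ultimately show ?thesis by linarith
    next
      case False
      then have "y \<notin> ball x r" using r by (auto simp: dist_commute)
      moreover have "\<bar>h y\<bar> * exp (- (real n * (norm (x - y))\<^sup>2)) \<le> \<bar>h y\<bar> * exp (- (real n * \<delta>\<^sup>2))"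
        using False \<delta>(1)
        by (intro mult_left_mono) (auto simp: dist_norm norm_minus_commute intro!: mult_left_mono power_mono)
      moreover have "- (\<bar>h y\<bar> * exp (- (real n * (norm (x - y))\<^sup>2))) \<le> h y * exp (- (real n * (norm (x - y))\<^sup>2))"
        by (simp add: abs_if)
      ultimately show ?thesis by simp
    qed
    moreover have "integrable lborel (\<lambda>y. h y * exp (- (real n * (norm (x - y))\<^sup>2)))"
      by (rule Bochner_Integration.integrable_bound[OF h])
         (use borel_measurable_integrable[OF h] in \<open>auto simp: abs_mult mult_right_le_one_le\<close>)
    moreover have ib: "integrable lborel (\<lambda>y. indicator (ball x r) y :: real)"
      by (intro integrable_real_indicator) (use emeasure_lborel_ball_finite[of x r] in auto)
    ultimately have "(LINT y|lborel. h x / 2 * exp (- 1) * indicator (ball x r) y - \<bar>h y\<bar> * exp (- (real n * \<delta>\<^sup>2)))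
       \<le> (LINT y|lborel. h y * exp (- (real n * (norm (x - y))\<^sup>2)))"
      using h by (intro integral_mono) auto
    also have "\<dots> = 0" using n by (intro gaussian_average_eq_0 h F) auto
    also have "(LINT y|lborel. h x / 2 * exp (- 1) * indicator (ball x r) y - \<bar>h y\<bar> * exp (- (real n * \<delta>\<^sup>2)))
        = h x / 2 * exp (- 1) * measure lborel (ball x r) - B * exp (- (real n * \<delta>\<^sup>2))"
      using h ib by (simp add: B_def Bochner_Integration.integral_diff)
    also have "measure lborel (ball x r) = V * r ^ DIM('a)" using r by (simp add: content_ball V_def d_def)
    also have "r ^ DIM('a) = 1 / real n powr (d / 2)"
    proof -
      have "sqrt (real n) ^ DIM('a) = real n powr (d / 2)"
        using n powr_mult_of_nat[of "real n" "1/2" "DIM('a)"] by (simp add: d_def powr_half_sqrt)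
      then show ?thesis by (simp add: r_def power_divide)
    qed
    finally have "h x / 2 * exp (- 1) * V * (1 / real n powr (d / 2)) \<le> B * exp (- (real n * \<delta>\<^sup>2))"
      by (simp add: mult.assoc)
    then show ?thesis using n by (simp add: field_simps)
  qed
  have "(\<lambda>n. B * (real n powr (d / 2) * exp (- (real n * \<delta>\<^sup>2)))) \<longlonglongrightarrow> B * 0"
  proof (intro tendsto_mult tendsto_const)
    have "\<delta>\<^sup>2 > 0" "d / 2 > 0" using \<delta>(1) by (auto simp: d_def)
    then show "(\<lambda>n. real n powr (d / 2) * exp (- (real n * \<delta>\<^sup>2))) \<longlonglongrightarrow> 0"
      by real_asymp
  qed
  moreover have "eventually (\<lambda>n. 1 / sqrt (real n) < \<delta>) sequentially"
  proof -
    have "(\<lambda>n. 1 / sqrt (real n)) \<longlonglongrightarrow> 0" by real_asymp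
    then show ?thesis using \<delta>(1) by (rule order_tendstoD)
  qed
  then have "eventually (\<lambda>n. h x / 2 * exp (- 1) * V \<le> B * (real n powr (d / 2) * exp (- (real n * \<delta>\<^sup>2)))) sequentially"
    using eventually_gt_at_top[of 0] by eventually_elim (rule bound)
  ultimately have "h x / 2 * exp (- 1) * V \<le> B * 0"
    by (intro tendsto_lowerbound) auto
  then show False using a V by (simp add: mult_le_0_iff)
qed

lemma fourier_inj:
  fixes f g :: "'a::euclidean_space \<Rightarrow> real"
  assumes f: "integrable lborel f" "isCont f x" and g: "integrable lborel g" "isCont g x"
    and F: "\<And>y. (LINT x|lborel. iexp (- (x \<bullet> y)) * complex_of_real (f x))
               = (LINT x|lborel. iexp (- (x \<bullet> y)) * complex_of_real (g x))"
  shows "f x = g x"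
proof -
  have i: "integrable lborel (\<lambda>x. iexp (- (x \<bullet> y)) * complex_of_real (h x))" if "integrable lborel h"
    for h :: "'a \<Rightarrow> real" and y
    by (rule Bochner_Integration.integrable_bound[OF that])
       (use borel_measurable_integrable[OF that] in \<open>auto simp: norm_mult\<close>)
  have "f x - g x \<le> 0"
    by (rule fourier_zero_imp_nonpos[where h = "\<lambda>x. f x - g x"])
       (use f g F i in \<open>auto simp: right_diff_distrib\<close>)
  moreover have "g x - f x \<le> 0"
    by (rule fourier_zero_imp_nonpos[where h = "\<lambda>x. g x - f x"])
       (use f g F i in \<open>auto simp: right_diff_distrib\<close>)
  ultimately show ?thesis by simp
qed

section \<open>Mixtures of heat kernels\<close>

lemma powr_times_exp_bound:
  assumes "p > 0" "c > 0" "y \<ge> (0::real)"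
  shows "(1 + y) powr p * exp (- (c * y)) \<le> max 1 (p / c) powr p"
proof -
  define m where "m = max 1 (p / c)"
  have m: "m \<ge> 1" "m * (c / p) \<ge> 1" using assms by (auto simp: m_def max_def field_simps)
  have "1 + y \<le> m * 1 + m * (c / p) * y"
    using m assms mult_right_mono[OF m(2), of y] by simp
  also have "\<dots> = m * (1 + c * y / p)" by (simp add: algebra_simps)
  also have "\<dots> \<le> m * exp (c * y / p)" using m by (intro mult_left_mono exp_ge_add_one_self) auto
  finally have "(1 + y) powr p \<le> (m * exp (c * y / p)) powr p"
    using assms by (intro powr_mono2) auto
  also have "\<dots> = m powr p * exp (c * y)" using assms m by (simp add: powr_mult exp_powr_real)
  finally have "(1 + y) powr p * exp (- (c * y)) \<le> m powr p * exp (c * y) * exp (- (c * y))"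
    by (intro mult_right_mono) auto
  also have "\<dots> = m powr p" by (simp add: exp_minus)
  finally show ?thesis by (simp add: m_def)
qed

text \<open>Uniformly in $s$, the heat kernel is bounded by a multiple of $|x|^{-d}$. Hence mixtures are finite
and continuous off the origin.\<close>

lemma heat_le:
  fixes x :: "'a::euclidean_space"
  assumes "s > 0" "x \<noteq> 0"
  shows "heat s x \<le> max 1 (real DIM('a) / 2) powr (real DIM('a) / 2) * (pi * (norm x)\<^sup>2) powr (- (real DIM('a) / 2))"
proof -
  define p where "p = real DIM('a) / 2"
  define z where "z = (norm x)\<^sup>2 / (4 * s)"
  have z: "z > 0" using assms by (simp add: z_def)
  have p: "p > 0" by (simp add: p_def)
  have "4 * pi * s = pi * (norm x)\<^sup>2 / z" using assms by (simp add: z_def)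
  then have "(4 * pi * s) powr (- p) = (pi * (norm x)\<^sup>2) powr (- p) * z powr p"
    using z powr_divide[of "pi * (norm x)\<^sup>2" z "- p"] by (simp only: powr_minus[of z] divide_inverse inverse_inverse_eq)
  then have "heat s x = (pi * (norm x)\<^sup>2) powr (- p) * (z powr p * exp (- (1 * z)))"
    by (simp add: heat_def p_def z_def mult_ac)
  also have "\<dots> \<le> (pi * (norm x)\<^sup>2) powr (- p) * ((1 + z) powr p * exp (- (1 * z)))"
    using z p by (intro mult_left_mono mult_right_mono powr_mono2) auto
  also have "\<dots> \<le> (pi * (norm x)\<^sup>2) powr (- p) * max 1 (p / 1) powr p"
    using z p by (intro mult_left_mono powr_times_exp_bound) auto
  finally show ?thesis by (simp add: p_def mult.commute)
qed

lemma heat_antimono: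
  fixes x y :: "'a::euclidean_space"
  shows "0 < s \<Longrightarrow> norm x \<le> norm y \<Longrightarrow> heat s y \<le> heat s x"
  unfolding heat_def by (intro mult_left_mono) (auto intro!: divide_right_mono)

lemma heat_scale:
  fixes x :: "'a::euclidean_space"
  assumes "\<tau> > 0" "s > 0"
  shows "heat (\<tau> * s) x = \<tau> powr (- (real DIM('a) / 2)) * heat s ((1 / sqrt \<tau>) *\<^sub>R x)"
proof -
  have "(norm ((1 / sqrt \<tau>) *\<^sub>R x))\<^sup>2 = (norm x)\<^sup>2 / \<tau>"
    using assms by (simp add: power_divide)
  moreover have "(4 * pi * (\<tau> * s)) powr (- (real DIM('a) / 2))
     = \<tau> powr (- (real DIM('a) / 2)) * (4 * pi * s) powr (- (real DIM('a) / 2))"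
    using assms by (subst powr_mult[symmetric]) (auto simp: mult_ac)
  ultimately show ?thesis by (simp add: heat_def mult_ac)
qed

text \<open>The law of a random clock that is evaluated in the heat kernel.\<close>

locale mixing_distribution = real_distribution N for N :: "real measure" +
  assumes pos: "AE s in N. 0 < s"
begin

text \<open>At the origin the integral may diverge; the value is then $0$, as for every nonintegrable
function. Statements that depend on convergence exclude the origin.\<close>

definition mixture :: "real \<Rightarrow> 'a::euclidean_space \<Rightarrow> real" where
  "mixture \<tau> x = (\<integral>s. heat (\<tau> * s) x \<partial>N)"

lemma pair_sf: "pair_sigma_finite N (lborel :: 'a::euclidean_space measure)" ..

lemma mixture_nonneg: "0 \<le> mixture \<tau> x"
  unfolding mixture_def by simp

lemma integrable_mixture:
  assumes "\<tau> > 0" "x \<noteq> (0::'a::euclidean_space)"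
  shows "integrable N (\<lambda>s. heat (\<tau> * s) x)"
proof (rule integrable_const_bound)
  show "AE s in N. norm (heat (\<tau> * s) x) \<le> max 1 (real DIM('a) / 2) powr (real DIM('a) / 2) * (pi * (norm x)\<^sup>2) powr (- (real DIM('a) / 2))"
    using pos by eventually_elim (use assms in \<open>auto intro: heat_le\<close>)
qed simp

lemma mixture_pos:
  assumes "\<tau> > 0" "x \<noteq> (0::'a::euclidean_space)"
  shows "0 < mixture \<tau> x"
proof -
  have "mixture \<tau> x \<noteq> 0"
  proof
    assume "mixture \<tau> x = 0"
    then have "AE s in N. heat (\<tau> * s) x = 0"
      unfolding mixture_def using integrable_mixture[OF assms]
      by (subst (asm) integral_nonneg_eq_0_iff_AE) auto
    with pos have "AE s in N. False"
    proof eventually_elim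
      case (elim s)
      with assms heat_pos[of "\<tau> * s" x] show ?case by simp
    qed
    then show False by simp
  qed
  with mixture_nonneg[of \<tau> x] show ?thesis by simp
qed

lemma mixture_antimono:
  assumes "\<tau> > 0" "x \<noteq> (0::'a::euclidean_space)" "norm x \<le> norm (y::'a)"
  shows "mixture \<tau> y \<le> mixture \<tau> x"
proof -
  have "y \<noteq> 0" using assms by auto
  then show ?thesis unfolding mixture_def using assms
    by (intro integral_mono_AE integrable_mixture)
       (use pos in \<open>auto elim!: eventually_mono intro!: heat_antimono\<close>)
qed

lemma mixture_scale:
  assumes "\<tau> > 0"
  shows "mixture \<tau> (x::'a::euclidean_space) = \<tau> powr (- (real DIM('a) / 2)) * mixture 1 ((1 / sqrt \<tau>) *\<^sub>R x)"
proof -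
  have "mixture \<tau> x = (\<integral>s. \<tau> powr (- (real DIM('a) / 2)) * heat s ((1 / sqrt \<tau>) *\<^sub>R x) \<partial>N)"
    unfolding mixture_def
    by (intro integral_cong_AE) (use pos assms in \<open>auto elim!: eventually_mono simp: heat_scale\<close>)
  then show ?thesis by (simp add: mixture_def)
qed

lemma continuous_on_mixture:
  assumes "\<tau> > 0"
  shows "continuous_on (- {0}) (mixture \<tau> :: 'a::euclidean_space \<Rightarrow> real)"
proof (rule continuous_on_sequentiallyI)
  fix u :: "nat \<Rightarrow> 'a" and a
  assume u: "\<forall>n. u n \<in> - {0}" "a \<in> - {0}" "u \<longlonglongrightarrow> a"
  define b where "b = norm a / 2"
  have b: "b > 0" "b < norm a" using u by (auto simp: b_def)
  have "(\<lambda>n. norm (u n)) \<longlonglongrightarrow> norm a" using u by (intro tendsto_norm)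
  then have "eventually (\<lambda>n. b < norm (u n)) sequentially" using b by (intro order_tendstoD)
  then obtain k where k: "\<And>n. n \<ge> k \<Longrightarrow> b < norm (u n)" by (auto simp: eventually_sequentially)
  obtain e :: 'a where e: "e \<in> Basis" using nonempty_Basis by blast
  have be: "norm (b *\<^sub>R e) = b" using e b by simp
  have "(\<lambda>n. \<integral>s. heat (\<tau> * s) (u (n + k)) \<partial>N) \<longlonglongrightarrow> (\<integral>s. heat (\<tau> * s) a \<partial>N)"
  proof (rule integral_dominated_convergence[where w = "\<lambda>s. heat (\<tau> * s) (b *\<^sub>R e)"])
    show "integrable N (\<lambda>s. heat (\<tau> * s) (b *\<^sub>R e))"
      using be b assms by (intro integrable_mixture) auto
    show "AE s in N. (\<lambda>n. heat (\<tau> * s) (u (n + k))) \<longlonglongrightarrow> heat (\<tau> * s) a"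
      using pos
    proof eventually_elim
      case (elim s)
      then show ?case unfolding heat_def using LIMSEQ_ignore_initial_segment[OF u(3), of k] assms
        by (intro tendsto_intros) auto
    qed
    show "AE s in N. norm (heat (\<tau> * s) (u (n + k))) \<le> heat (\<tau> * s) (b *\<^sub>R e)" for n
      using pos
    proof eventually_elim
      case (elim s)
      have "norm (b *\<^sub>R e) \<le> norm (u (n + k))" unfolding be using k[of "n + k"] by simp
      then show ?case using elim assms by (auto intro!: heat_antimono)
    qed
  qed auto
  then have "(\<lambda>n. mixture \<tau> (u (n + k))) \<longlonglongrightarrow> mixture \<tau> a" by (simp add: mixture_def)
  then show "(\<lambda>n. mixture \<tau> (u n)) \<longlonglongrightarrow> mixture \<tau> a" by (rule LIMSEQ_offset)
qed

lemma mixture_fubini: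
  fixes q :: "'a::euclidean_space \<Rightarrow> 'b::{banach,second_countable_topology}"
  assumes \<tau>: "\<tau> > 0" and q [measurable]: "q \<in> borel_measurable borel"
    and J: "\<And>s. s > 0 \<Longrightarrow> has_bochner_integral lborel (\<lambda>x. norm (q x) * heat (\<tau> * s) x) (J s)"
    and J_int: "integrable N J"
  shows "integrable lborel (\<lambda>x. mixture \<tau> x *\<^sub>R q x)"
    and "(LINT x|lborel. mixture \<tau> x *\<^sub>R q x) = (\<integral>s. (LINT x|lborel. heat (\<tau> * s) x *\<^sub>R q x) \<partial>N)"
proof -
  interpret pair_sigma_finite N "lborel :: 'a measure" by (rule pair_sf)
  define f where "f = (\<lambda>s x. heat (\<tau> * s) x *\<^sub>R q x)"
  have [measurable]: "case_prod f \<in> borel_measurable (N \<Otimes>\<^sub>M lborel)"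
    unfolding f_def by measurable
  have int: "integrable (N \<Otimes>\<^sub>M lborel) (case_prod f)"
  proof (rule Fubini_integrable)
    have "AE s in N. (LINT x|lborel. norm (case_prod f (s, x))) = J s"
      using pos by eventually_elim (use J in \<open>simp add: f_def has_bochner_integral_iff mult.commute\<close>)
    then show "integrable N (\<lambda>s. LINT x|lborel. norm (case_prod f (s, x)))"
      by (subst integrable_cong_AE[where g = J]) (use J_int in auto)
    show "AE s in N. integrable lborel (\<lambda>x. case_prod f (s, x))"
      using pos
    proof eventually_elim
      case (elim s)
      then have "integrable lborel (\<lambda>x. norm (q x) * heat (\<tau> * s) x)"
        using J by (auto simp: has_bochner_integral_iff)
      then show ?case
        by (rule Bochner_Integration.integrable_bound) (auto simp: f_def mult.commute)
    qed
  qed simp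
  have ae: "AE x in lborel. (\<integral>s. f s x \<partial>N) = mixture \<tau> x *\<^sub>R q x"
    using AE_lborel_singleton[of "0::'a"]
    by eventually_elim (simp add: f_def mixture_def integrable_mixture \<tau>)
  have m [measurable]: "mixture \<tau> \<in> borel_measurable (borel :: 'a measure)"
    unfolding mixture_def[abs_def] by measurable
  show "integrable lborel (\<lambda>x. mixture \<tau> x *\<^sub>R q x)"
    using integrable_snd[OF int] by (subst integrable_cong_AE[where g = "\<lambda>x. (\<integral>s. f s x \<partial>N)"])
      (use ae in \<open>auto elim!: eventually_mono\<close>)
  have "(LINT x|lborel. mixture \<tau> x *\<^sub>R q x) = (LINT x|lborel. (\<integral>s. f s x \<partial>N))"
    by (rule integral_cong_AE) (use ae in \<open>auto elim!: eventually_mono\<close>)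
  also have "\<dots> = (\<integral>s. (LINT x|lborel. f s x) \<partial>N)" by (rule Fubini_integral[OF int])
  finally show "(LINT x|lborel. mixture \<tau> x *\<^sub>R q x) = (\<integral>s. (LINT x|lborel. heat (\<tau> * s) x *\<^sub>R q x) \<partial>N)"
    by (simp add: f_def)
qed

lemma mixture_exp_integral:
  assumes "\<tau> > 0" "integrable N (\<lambda>s. exp (\<tau> * s * (norm a)\<^sup>2))"
  shows "has_bochner_integral lborel (\<lambda>x::'a::euclidean_space. exp (a \<bullet> x) * mixture \<tau> x) (\<integral>s. exp (\<tau> * s * (norm a)\<^sup>2) \<partial>N)"
proof -
  have J: "has_bochner_integral lborel (\<lambda>x::'a. norm (exp (a \<bullet> x)) * heat (\<tau> * s) x) (exp (\<tau> * s * (norm a)\<^sup>2))" if "s > 0" for s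
    using heat_exp_integral[of "\<tau> * s" a] that assms by simp
  have "(\<integral>s. (LINT x|lborel. heat (\<tau> * s) x *\<^sub>R exp (a \<bullet> x)) \<partial>N) = (\<integral>s. exp (\<tau> * s * (norm a)\<^sup>2) \<partial>N)"
    by (intro integral_cong_AE)
       (use J pos in \<open>auto elim!: eventually_mono simp: has_bochner_integral_iff mult.commute\<close>)
  then show ?thesis
    using mixture_fubini[OF assms(1) _ J assms(2)]
    by (simp add: has_bochner_integral_iff mult.commute)
qed

lemma mixture_integral:
  assumes "\<tau> > 0"
  shows "has_bochner_integral lborel (mixture \<tau> :: 'a::euclidean_space \<Rightarrow> real) 1"
  using mixture_exp_integral[of \<tau> "0::'a"] assms prob_space by simp

lemma mixture_fourier:
  assumes "\<tau> > 0"
  shows "(LINT x|lborel. iexp (- (x \<bullet> y)) * complex_of_real (mixture \<tau> x))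
      = complex_of_real (\<integral>s. exp (- (\<tau> * (norm (y::'a::euclidean_space))\<^sup>2 * s)) \<partial>N)"
proof -
  have J: "has_bochner_integral lborel (\<lambda>x::'a. norm (iexp (- (x \<bullet> y))) * heat (\<tau> * s) x) 1" if "s > 0" for s
    using heat_integral[of "\<tau> * s"] that assms by simp
  have "(LINT x|lborel. iexp (- (x \<bullet> y)) * complex_of_real (mixture \<tau> x))
      = (LINT x|lborel. mixture \<tau> x *\<^sub>R iexp (- (x \<bullet> y)))"
    by (simp add: scaleR_conv_of_real mult.commute)
  also have "\<dots> = (\<integral>s. (LINT x|lborel. heat (\<tau> * s) x *\<^sub>R iexp (- (x \<bullet> y))) \<partial>N)"
    by (rule mixture_fubini(2)[OF assms _ J]) auto
  also have "\<dots> = (\<integral>s. complex_of_real (exp (- (\<tau> * (norm y)\<^sup>2 * s))) \<partial>N)"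
  proof (rule integral_cong_AE)
    show "AE s in N. (LINT x|lborel. heat (\<tau> * s) x *\<^sub>R iexp (- (x \<bullet> y))) = complex_of_real (exp (- (\<tau> * (norm y)\<^sup>2 * s)))"
      using pos
    proof eventually_elim
      case (elim s)
      then show ?case using heat_fourier[of "\<tau> * s" y] assms
        by (simp add: scaleR_conv_of_real mult_ac)
    qed
  qed auto
  finally show ?thesis by simp
qed

end

section \<open>The singularity of a mixture at the origin\<close>

text \<open>Euler's integral, rescaled. It expresses a negative power as a Laplace transform.\<close>

lemma Gamma_scaled:
  assumes "p > 0" "r > 0"
  shows "(\<integral>\<^sup>+l. ennreal (indicator {0..} l * l powr (p - 1) * exp (- (l * r))) \<partial>lborel) = ennreal (Gamma p * r powr (- p))"
proof -
  let ?w = "\<lambda>l::real. indicator {0..} l * l powr (p - 1) * exp (- (l * r)) :: real"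
  have "ennreal (Gamma p) = (\<integral>\<^sup>+t. ennreal (indicator {0..} t * t powr (p - 1) / exp t) \<partial>lborel)"
    using assms by (rule_tac Gamma_conv_nn_integral_real)
  also have "\<dots> = ennreal r * (\<integral>\<^sup>+l. ennreal (indicator {0..} (0 + r * l) * (0 + r * l) powr (p - 1) / exp (0 + r * l)) \<partial>lborel)"
    using assms by (subst nn_integral_real_affine[where c = r and t = 0]) auto
  also have "\<dots> = (\<integral>\<^sup>+l. ennreal (r powr p) * ennreal (?w l) \<partial>lborel)"
  proof (subst nn_integral_cmult[symmetric], simp, rule nn_integral_cong)
    fix l :: real
    have "r * (indicator {0..} (0 + r * l) * (0 + r * l) powr (p - 1) / exp (0 + r * l))
        = r powr p * (?w l)"
    proof (cases "l \<ge> 0")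
      case True
      have "r * r powr (p - 1) = r powr p" using assms by (simp add: powr_mult_base)
      with True assms show ?thesis
        by (simp add: powr_mult exp_minus divide_inverse mult_ac)
    next
      case False
      then have "\<not> 0 \<le> r * l" using assms by (simp add: zero_le_mult_iff)
      with False show ?thesis by simp
    qed
    then show "ennreal r * ennreal (indicator {0..} (0 + r * l) * (0 + r * l) powr (p - 1) / exp (0 + r * l))
        = ennreal (r powr p) * ennreal (?w l)"
      using assms by (simp flip: ennreal_mult')
  qed
  also have "\<dots> = ennreal (r powr p) * (\<integral>\<^sup>+l. ennreal (?w l) \<partial>lborel)"
    by (rule nn_integral_cmult) simp
  finally have "ennreal (r powr (- p)) * ennreal (Gamma p) = ennreal (r powr (- p)) * (ennreal (r powr p) * (\<integral>\<^sup>+l. ennreal (?w l) \<partial>lborel))"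
    by simp
  also have "\<dots> = (\<integral>\<^sup>+l. ennreal (?w l) \<partial>lborel)"
    using assms by (simp add: mult.assoc[symmetric] powr_minus flip: ennreal_mult')
  finally show ?thesis using assms by (simp add: ennreal_mult' mult.commute)
qed

text \<open>A clock whose Laplace transform decays like that of a law with mass of order $\tau^g$ in
$(0,\tau)$.\<close>

locale power_mixture = mixing_distribution N for N +
  fixes g a b :: real
  assumes g: "0 < g" and a: "0 < a" and b: "0 < b"
    and laplace_lower: "\<And>l. 0 \<le> l \<Longrightarrow> a / (1 + l powr g) \<le> (\<integral>s. exp (- (l * s)) \<partial>N)"
    and laplace_upper: "\<And>l. 0 \<le> l \<Longrightarrow> (\<integral>s. exp (- (l * s)) \<partial>N) \<le> b / (1 + l powr g)"
begin

lemma integrable_exp: "0 \<le> l \<Longrightarrow> integrable N (\<lambda>s. exp (- (l * s)))"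
proof (rule integrable_const_bound[where B = 1])
  assume "0 \<le> l"
  then show "AE s in N. norm (exp (- (l * s))) \<le> 1"
    using pos by (auto elim!: eventually_mono)
qed simp

text \<open>A Tauberian estimate. The mass of $(0,K\tau]$ is at least of order $\tau^g$, since the part of the
Laplace integral at $1/\tau$ beyond $K\tau$ is at most $e^{-K/2}$ times the Laplace transform at $1/(2\tau)$. The mass of
$(0,\epsilon\tau]$ is at most of order $(\epsilon\tau)^g$ by Chebyshev's inequality. For large $K$ and small
$\epsilon$ the difference is positive. The bound $4 = 2^2$ on $\tau = |x|^2$ covers $|x| \le 2$.\<close>

lemma window_mass:
  "\<exists>\<epsilon>>0. \<exists>K>0. \<exists>c>0. \<forall>\<tau>. 0 < \<tau> \<and> \<tau> \<le> 4 \<longrightarrow> c * \<tau> powr g \<le> prob {\<epsilon> * \<tau><..K * \<tau>}"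
proof -
  have "eventually (\<lambda>K. exp (- (K / 2)) < a / (2 * (2 powr g * b))) at_top"
  proof -
    have "((\<lambda>K::real. exp (- (K / 2))) \<longlongrightarrow> 0) at_top" by real_asymp
    then show ?thesis using a b by (intro order_tendstoD) auto
  qed
  then have "\<exists>K. exp (- (K / 2)) < a / (2 * (2 powr g * b)) \<and> K > 0"
    using eventually_happens'[OF _ eventually_conj[OF _ eventually_gt_at_top[of "0::real"]]] by auto
  then obtain K where K: "K > 0" "exp (- (K / 2)) < a / (2 * (2 powr g * b))" by blast
  define c where "c = a / 2 / (1 + 4 powr g)"
  have c: "c > 0" using a unfolding c_def by (auto intro!: divide_pos_pos add_pos_pos)
  define \<epsilon> where "\<epsilon> = (c / (2 * exp 1 * b)) powr (1 / g)"
  \<comment> \<open>This $\epsilon$ makes the mass below $\epsilon\tau$ at most half of the lower bound for the mass below $K\tau$.\<close>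
  have \<epsilon>: "\<epsilon> > 0" "exp 1 * b * \<epsilon> powr g = c / 2"
    using c b g by (auto simp: \<epsilon>_def powr_powr field_simps)
  have main: "c / 2 * \<tau> powr g \<le> prob {\<epsilon> * \<tau><..K * \<tau>}" if \<tau>: "0 < \<tau>" "\<tau> \<le> 4" for \<tau>
  proof -
    define T where "T = \<tau> powr g"
    have T: "T > 0" "T \<le> 4 powr g" using \<tau> g by (auto simp: T_def intro!: powr_mono2)
    have inv: "(1 / \<tau>) powr g = 1 / T" using \<tau> by (simp add: T_def powr_divide)
    have 1: "c * T \<le> prob {..K * \<tau>}"
    proof -
      have ind: "integrable N (indicat_real {..K * \<tau>})"
        by (rule integrable_const_bound[where B = 1]) auto
      have "a / (1 + (1 / \<tau>) powr g) \<le> (\<integral>s. exp (- (1 / \<tau> * s)) \<partial>N)"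
        using \<tau> by (intro laplace_lower) auto
      also have "\<dots> \<le> (\<integral>s. indicator {..K * \<tau>} s + exp (- (K / 2)) * exp (- (1 / (2 * \<tau>) * s)) \<partial>N)"
      proof (rule integral_mono_AE)
        show "AE s in N. exp (- (1 / \<tau> * s)) \<le> indicator {..K * \<tau>} s + exp (- (K / 2)) * exp (- (1 / (2 * \<tau>) * s))"
          using pos
        proof eventually_elim
          case (elim s)
          show ?case
          proof (cases "s \<le> K * \<tau>")
            case True
            have "exp (- (1 / \<tau> * s)) \<le> 1" using elim \<tau> by simp
            with True show ?thesis by (simp add: add_increasing2)
          next
            case False
            then have "K / 2 \<le> 1 / (2 * \<tau>) * s" using \<tau> by (simp add: field_simps)
            then have "- (1 / \<tau> * s) \<le> - (K / 2) + - (1 / (2 * \<tau>) * s)" by simp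
            then have "exp (- (1 / \<tau> * s)) \<le> exp (- (K / 2)) * exp (- (1 / (2 * \<tau>) * s))"
              by (simp only: exp_le_cancel_iff flip: exp_add)
            with False show ?thesis by simp
          qed
        qed
      qed (use \<tau> integrable_exp[of "1 / \<tau>"] integrable_exp[of "1 / (2 * \<tau>)"] ind in auto)
      also have "\<dots> = prob {..K * \<tau>} + exp (- (K / 2)) * (\<integral>s. exp (- (1 / (2 * \<tau>) * s)) \<partial>N)"
        using \<tau> integrable_exp[of "1 / (2 * \<tau>)"] ind by (subst Bochner_Integration.integral_add) auto
      also have "(\<integral>s. exp (- (1 / (2 * \<tau>) * s)) \<partial>N) \<le> b / (1 + (1 / (2 * \<tau>)) powr g)"
        using \<tau> by (intro laplace_upper) auto
      also have "(1 / (2 * \<tau>)) powr g = 1 / (2 powr g * T)"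
        using \<tau> by (simp add: T_def powr_divide powr_mult)
      finally have "a / (1 + 1 / T) \<le> prob {..K * \<tau>} + exp (- (K / 2)) * (b / (1 + 1 / (2 powr g * T)))"
        using inv by simp
      moreover have "exp (- (K / 2)) * (b / (1 + 1 / (2 powr g * T))) \<le> a / 2 / (1 + 1 / T)"
      proof -
        have g2: "2 powr g \<ge> 1" using g by (simp add: ge_one_powr_ge_zero)
        have "(1 + 1 / T) \<le> 2 powr g * (1 + 1 / (2 powr g * T))"
          using g2 T by (simp add: field_simps)
        then have "b / (1 + 1 / (2 powr g * T)) \<le> 2 powr g * b / (1 + 1 / T)"
          using b T by (simp add: divide_simps add_pos_pos mult_ac split: if_splits)
        then have "exp (- (K / 2)) * (b / (1 + 1 / (2 powr g * T))) \<le> a / (2 * (2 powr g * b)) * (2 powr g * b / (1 + 1 / T))"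
          using K T b a by (intro mult_mono) (auto intro!: divide_nonneg_nonneg add_nonneg_nonneg)
        also have "\<dots> = a / 2 / (1 + 1 / T)" using b by simp
        finally show ?thesis .
      qed
      moreover have "x / y = 2 * (x / 2 / y)" for x y :: real by (cases "y = 0") (auto simp: field_simps)
      then have "a / (1 + 1 / T) = 2 * (a / 2 / (1 + 1 / T))" .
      ultimately have "a / 2 / (1 + 1 / T) \<le> prob {..K * \<tau>}" by linarith
      moreover have "c * T \<le> a / 2 / (1 + 1 / T)"
      proof -
        have "a / 2 / (1 + 1 / T) = a / 2 * T / (1 + T)" using T by (simp add: field_simps)
        also have "\<dots> \<ge> a / 2 * T / (1 + 4 powr g)"
          using T a by (intro divide_left_mono) (auto intro!: mult_pos_pos add_pos_pos)
        finally show ?thesis by (simp add: c_def)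
      qed
      ultimately show ?thesis by simp
    qed
    have 2: "prob {..\<epsilon> * \<tau>} \<le> c / 2 * T"
    proof -
      have "exp (- 1) * prob {..\<epsilon> * \<tau>} = (\<integral>s. exp (- 1) * indicator {..\<epsilon> * \<tau>} s \<partial>N)" by simp
      also have "\<dots> \<le> (\<integral>s. exp (- (1 / (\<epsilon> * \<tau>) * s)) \<partial>N)"
      proof (rule integral_mono)
        have "integrable N (indicat_real {..\<epsilon> * \<tau>})"
          by (rule integrable_const_bound[where B = 1]) auto
        then show "integrable N (\<lambda>s. exp (- 1) * indicat_real {..\<epsilon> * \<tau>} s)" by simp
        show "integrable N (\<lambda>s. exp (- (1 / (\<epsilon> * \<tau>) * s)))"
          using \<epsilon> \<tau> by (intro integrable_exp) auto
        show "exp (- 1) * indicat_real {..\<epsilon> * \<tau>} s \<le> exp (- (1 / (\<epsilon> * \<tau>) * s))" for s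
          using \<epsilon> \<tau> by (cases "s \<le> \<epsilon> * \<tau>") (auto simp: field_simps)
      qed
      also have "\<dots> \<le> b / (1 + (1 / (\<epsilon> * \<tau>)) powr g)" using \<epsilon> \<tau> by (intro laplace_upper) auto
      also have "(1 / (\<epsilon> * \<tau>)) powr g = 1 / (\<epsilon> powr g * T)"
        using \<epsilon> \<tau> by (simp add: T_def powr_divide powr_mult)
      also have "b / (1 + 1 / (\<epsilon> powr g * T)) \<le> b / (1 / (\<epsilon> powr g * T))"
      proof -
        have "b / (1 + y) \<le> b / y" if "y > 0" for y :: real
          using that b by (intro divide_left_mono) (auto intro!: mult_pos_pos)
        then show ?thesis by this (use \<epsilon> T in simp)
      qed
      finally have "exp 1 * (exp (- 1) * prob {..\<epsilon> * \<tau>}) \<le> exp 1 * (b * (\<epsilon> powr g * T))"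
        by (intro mult_left_mono) auto
      also have "exp 1 * (exp (- 1) * prob {..\<epsilon> * \<tau>}) = prob {..\<epsilon> * \<tau>}"
        by (simp add: exp_minus)
      also have "exp 1 * (b * (\<epsilon> powr g * T)) = (exp 1 * b * \<epsilon> powr g) * T" by simp
      finally show ?thesis using \<epsilon>(2) by simp
    qed
    have "prob {..K * \<tau>} \<le> prob ({\<epsilon> * \<tau><..K * \<tau>} \<union> {..\<epsilon> * \<tau>})"
      by (intro finite_measure_mono) auto
    also have "\<dots> \<le> prob {\<epsilon> * \<tau><..K * \<tau>} + prob {..\<epsilon> * \<tau>}"
      by (intro measure_Un_le) auto
    finally show ?thesis using 1 2 by (simp add: T_def)
  qed
  show ?thesis
    using \<epsilon>(1) K(1) main c by (intro exI[of _ \<epsilon>] exI[of _ K] exI[of _ "c / 2"] conjI) auto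
qed

text \<open>Doubling $|x|$ loses a fixed fraction of the contribution of the scales $s \approx |x|^2$. For
$d > 2g$ this is the lower bound for the kernel itself, for $d = 2g$ it is a fixed amount per dyadic
step, hence a logarithm.\<close>

lemma mixture_drop_lower:
  "\<exists>c>0. \<forall>x::'a::euclidean_space. x \<noteq> 0 \<and> norm x \<le> 2 \<longrightarrow>
     mixture 1 (2 *\<^sub>R x) + c * norm x powr (2 * g - real DIM('a)) \<le> mixture 1 x"
proof -
  from window_mass obtain \<epsilon> K c where eK: "\<epsilon> > 0" "K > 0" "c > 0"
    and w: "\<And>\<tau>. 0 < \<tau> \<Longrightarrow> \<tau> \<le> 4 \<Longrightarrow> c * \<tau> powr g \<le> prob {\<epsilon> * \<tau><..K * \<tau>}" by blast
  define p where "p = real DIM('a) / 2"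
  define m where "m = (4 * pi * K) powr (- p) * exp (- (1 / (4 * \<epsilon>))) * (1 - exp (- (3 / (4 * K))))"
  have m: "m > 0" using eK by (simp add: m_def)
  have "mixture 1 (2 *\<^sub>R x) + m * c * norm x powr (2 * g - real DIM('a)) \<le> mixture 1 x"
    if x: "x \<noteq> 0" "norm x \<le> 2" for x :: 'a
  proof -
    define \<tau> where "\<tau> = (norm x)\<^sup>2"
    have \<tau>: "0 < \<tau>" "\<tau> \<le> 4" using x power_mono[of "norm x" 2 2] by (auto simp: \<tau>_def)
    have \<tau>powr: "\<tau> powr q = norm x powr (2 * q)" for q
      using x by (simp add: \<tau>_def powr_powr flip: powr_numeral)
    \<comment> \<open>On the window $1/(4K) \le z \le 1/(4\epsilon)$ holds for $z = |x|^2/4s$, off the window only monotonicity is used.\<close>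
    have key: "heat s (2 *\<^sub>R x) + m * \<tau> powr (- p) * indicator {\<epsilon> * \<tau><..K * \<tau>} s \<le> heat s x" if s: "s > 0" for s
    proof (cases "s \<in> {\<epsilon> * \<tau><..K * \<tau>}")
      case True
      define z where "z = \<tau> / (4 * s)"
      have z: "1 / (4 * K) \<le> z" "z \<le> 1 / (4 * \<epsilon>)"
        using True s eK \<tau> by (auto simp: z_def field_simps)
      have h1: "heat s x = (4 * pi * s) powr (- p) * exp (- z)"
        by (simp add: heat_def p_def z_def \<tau>_def)
      have h2: "heat s (2 *\<^sub>R x) = (4 * pi * s) powr (- p) * (exp (- z) * exp (- (3 * z)))"
        by (simp add: heat_def p_def z_def \<tau>_def power_mult_distrib flip: exp_add)
      have "(4 * pi * K * \<tau>) powr (- p) \<le> (4 * pi * s) powr (- p)"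
        using True s by (intro powr_mono2') (auto simp: p_def)
      moreover have "(4 * pi * K * \<tau>) powr (- p) = (4 * pi * K) powr (- p) * \<tau> powr (- p)"
        using eK \<tau> by (intro powr_mult)
      moreover have "exp (- (1 / (4 * \<epsilon>))) \<le> exp (- z)" "1 - exp (- (3 / (4 * K))) \<le> 1 - exp (- (3 * z))"
        using z by auto
      ultimately have "(4 * pi * K) powr (- p) * \<tau> powr (- p) * (exp (- (1 / (4 * \<epsilon>))) * (1 - exp (- (3 / (4 * K)))))
          \<le> (4 * pi * s) powr (- p) * (exp (- z) * (1 - exp (- (3 * z))))"
        using eK by (intro mult_mono) auto
      then have "m * \<tau> powr (- p) \<le> (4 * pi * s) powr (- p) * (exp (- z) * (1 - exp (- (3 * z))))"
        by (simp add: m_def mult_ac)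
      with True show ?thesis by (simp add: h1 h2 algebra_simps)
    next
      case False
      then show ?thesis using s by (auto intro!: heat_antimono)
    qed
    have i: "integrable N (\<lambda>s. heat s x)" "integrable N (\<lambda>s. heat s (2 *\<^sub>R x))"
      using integrable_mixture[of 1 x] integrable_mixture[of 1 "2 *\<^sub>R x"] x by auto
    have ind: "integrable N (indicat_real {\<epsilon> * \<tau><..K * \<tau>})"
      by (rule integrable_const_bound[where B = 1]) auto
    have "mixture 1 (2 *\<^sub>R x) + m * \<tau> powr (- p) * prob {\<epsilon> * \<tau><..K * \<tau>}
        = (\<integral>s. heat s (2 *\<^sub>R x) + m * \<tau> powr (- p) * indicator {\<epsilon> * \<tau><..K * \<tau>} s \<partial>N)"
      using i ind by (subst Bochner_Integration.integral_add) (auto simp: mixture_def)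
    also have "\<dots> \<le> mixture 1 x"
      unfolding mixture_def using i ind key pos
      by (intro integral_mono_AE) (auto elim!: eventually_mono)
    finally have "mixture 1 (2 *\<^sub>R x) + m * \<tau> powr (- p) * prob {\<epsilon> * \<tau><..K * \<tau>} \<le> mixture 1 x" .
    moreover have "m * \<tau> powr (- p) * (c * \<tau> powr g) \<le> m * \<tau> powr (- p) * prob {\<epsilon> * \<tau><..K * \<tau>}"
      using m \<tau> by (intro mult_left_mono w) auto
    moreover have "m * \<tau> powr (- p) * (c * \<tau> powr g) = m * c * norm x powr (2 * g - real DIM('a))"
      using x by (simp add: \<tau>powr p_def mult_ac flip: powr_add)
    ultimately show ?thesis by simp
  qed
  then show ?thesis using m eK by (intro exI[of _ "m * c"]) auto
qed

text \<open>The Gaussian factor cuts off the scales $s \ll r$, so that the integrand is at most a multiple of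
$(s+r)^{-p}$. By Euler's integral and Fubini this power integrates to an integral over the Laplace
transform of $N$, which is at most $b\lambda^{-g}$. The result is finite for $p > g$.\<close>

lemma power_gaussian_moment:
  assumes "p > g"
  shows "\<exists>C>0. \<forall>r>0. (\<integral>s. s powr (- p) * exp (- (r / (4 * s))) \<partial>N) \<le> C * r powr (g - p)
            \<and> integrable N (\<lambda>s. s powr (- p) * exp (- (r / (4 * s))))"
proof -
  have p: "p > 0" "p - g > 0" using assms g by auto
  define M where "M = max 1 (p / (1/4)) powr p"
  have M: "M > 0" by (simp add: M_def)
  define C where "C = M * (b * Gamma (p - g) / Gamma p)"
  have C: "C > 0" using M b p by (simp add: C_def)
  have "(\<integral>s. s powr (- p) * exp (- (r / (4 * s))) \<partial>N) \<le> C * r powr (g - p)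
            \<and> integrable N (\<lambda>s. s powr (- p) * exp (- (r / (4 * s))))" if r: "r > 0" for r
  proof -
    let ?h = "\<lambda>s. s powr (- p) * exp (- (r / (4 * s)))"
    let ?w = "\<lambda>l::real. indicator {0..} l * l powr (p - 1) * exp (- (l * r)) :: real"
    let ?v = "\<lambda>l::real. indicator {0..} l * l powr ((p - g) - 1) * exp (- (l * r)) :: real"
    have pt: "?h s \<le> M * (s + r) powr (- p)" if s: "s > 0" for s
    proof -
      have "(1 + r / s) powr p * exp (- (1/4 * (r / s))) \<le> M"
        unfolding M_def using r s p by (intro powr_times_exp_bound) auto
      moreover have "(s + r) powr p = s powr p * (1 + r / s) powr p"
      proof -
        have "s + r = s * (1 + r / s)" using s by (simp add: field_simps)
        then show ?thesis using s r by (simp add: powr_mult)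
      qed
      ultimately have "(s + r) powr p * (?h s) \<le> M"
        using s by (simp add: powr_minus field_simps)
      then show ?thesis using s r by (simp add: powr_minus field_simps)
    qed
    have "(\<integral>\<^sup>+s. ennreal (?h s) \<partial>N) \<le> (\<integral>\<^sup>+s. ennreal (M / Gamma p) * ennreal (Gamma p * (s + r) powr (- p)) \<partial>N)"
    proof (rule nn_integral_mono_AE)
      show "AE s in N. ennreal (?h s) \<le> ennreal (M / Gamma p) * ennreal (Gamma p * (s + r) powr (- p))"
        using pos
      proof eventually_elim
        case (elim s)
        have "Gamma p > 0" using p by simp
        then show ?case using pt[OF elim] M
          by (simp flip: ennreal_mult' add: ennreal_leI)
      qed
    qed
    also have "\<dots> = ennreal (M / Gamma p) * (\<integral>\<^sup>+s. ennreal (Gamma p * (s + r) powr (- p)) \<partial>N)"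
      by (rule nn_integral_cmult) simp
    also have "(\<integral>\<^sup>+s. ennreal (Gamma p * (s + r) powr (- p)) \<partial>N)
       = (\<integral>\<^sup>+s. (\<integral>\<^sup>+l. ennreal (?w l) * ennreal (exp (- (l * s))) \<partial>lborel) \<partial>N)"
    proof (rule nn_integral_cong_AE)
      show "AE s in N. ennreal (Gamma p * (s + r) powr (- p)) = (\<integral>\<^sup>+l. ennreal (?w l) * ennreal (exp (- (l * s))) \<partial>lborel)"
        using pos
      proof eventually_elim
        case (elim s)
        then show ?case using r p
          by (subst Gamma_scaled[symmetric]) (auto simp: algebra_simps exp_add exp_diff exp_minus divide_inverse intro!: nn_integral_cong simp flip: ennreal_mult'')
      qed
    qed
    also have "\<dots> = (\<integral>\<^sup>+l. (\<integral>\<^sup>+s. ennreal (?w l) * ennreal (exp (- (l * s))) \<partial>N) \<partial>lborel)"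
    proof -
      interpret pair_sigma_finite lborel N ..
      show ?thesis by (rule Fubini') measurable
    qed
    also have "\<dots> \<le> (\<integral>\<^sup>+l. ennreal b * ennreal (?v l) \<partial>lborel)"
    proof (rule nn_integral_mono_AE)
      show "AE l in lborel. (\<integral>\<^sup>+s. ennreal (?w l) * ennreal (exp (- (l * s))) \<partial>N)
        \<le> ennreal b * ennreal (?v l)"
        using AE_lborel_singleton[of 0]
      proof eventually_elim
        case (elim l)
        show ?case
        proof (cases "l > 0")
          case True
          have "(\<integral>\<^sup>+s. ennreal (?w l) * ennreal (exp (- (l * s))) \<partial>N)
              = ennreal (l powr (p - 1) * exp (- (l * r))) * (\<integral>\<^sup>+s. ennreal (exp (- (l * s))) \<partial>N)"
            using True by (subst nn_integral_cmult) auto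
          also have "(\<integral>\<^sup>+s. ennreal (exp (- (l * s))) \<partial>N) = ennreal (\<integral>s. exp (- (l * s)) \<partial>N)"
            using True by (intro nn_integral_eq_integral integrable_exp) auto
          also have "\<dots> \<le> ennreal (b * l powr (- g))"
          proof (rule ennreal_leI)
            have "(\<integral>s. exp (- (l * s)) \<partial>N) \<le> b / (1 + l powr g)" using True by (intro laplace_upper) auto
            also have "\<dots> \<le> b / l powr g" using True b by (intro divide_left_mono) (auto intro!: mult_pos_pos add_pos_pos)
            finally show "(\<integral>s. exp (- (l * s)) \<partial>N) \<le> b * l powr (- g)" by (simp add: powr_minus divide_inverse)
          qed
          also have "ennreal (l powr (p - 1) * exp (- (l * r))) * ennreal (b * l powr (- g))
             = ennreal b * ennreal (?v l)"
          proof -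
            have "l powr (p - 1) * l powr (- g) = l powr ((p - g) - 1)" by (simp flip: powr_add add: algebra_simps)
            then have "l powr (p - 1) * exp (- (l * r)) * (b * l powr (- g)) = b * (l powr ((p - g) - 1) * exp (- (l * r)))"
              by (metis (no_types, lifting) mult.assoc mult.commute mult.left_commute)
            then show ?thesis using True b by (simp flip: ennreal_mult')
          qed
          finally show ?thesis by (simp add: mult_left_mono)
        next
          case False
          with elim have "indicator {0..} l = (0::real)" by auto
          then show ?thesis by simp
        qed
      qed
    qed
    also have "\<dots> = ennreal b * ennreal (Gamma (p - g) * r powr (- (p - g)))"
      using p r by (subst nn_integral_cmult) (auto simp: Gamma_scaled)
    also have "ennreal (M / Gamma p) * (ennreal b * ennreal (Gamma (p - g) * r powr (- (p - g)))) = ennreal (C * r powr (g - p))"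
      using p M b by (simp add: C_def mult_ac flip: ennreal_mult')
    finally have nn: "(\<integral>\<^sup>+s. ennreal (?h s) \<partial>N) \<le> ennreal (C * r powr (g - p))"
      by (simp add: mult_left_mono)
    have int: "integrable N (\<lambda>s. ?h s)"
    proof (rule integrableI_bounded)
      show "(\<integral>\<^sup>+s. ennreal (norm (?h s)) \<partial>N) < \<infinity>"
        using le_less_trans[OF nn ennreal_less_top] by simp
    qed simp
    moreover have "(\<integral>s. ?h s \<partial>N) \<le> C * r powr (g - p)"
      using nn nn_integral_eq_integral[OF int] C by (simp add: ennreal_le_iff)
    ultimately show ?thesis by simp
  qed
  then show ?thesis using C by (intro exI[of _ C]) auto
qed

lemma mixture_upper:
  assumes "real DIM('a::euclidean_space) > 2 * g"
  shows "\<exists>C>0. \<forall>x::'a. x \<noteq> 0 \<longrightarrow> mixture 1 x \<le> C * norm x powr (2 * g - real DIM('a))"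
proof -
  define p where "p = real DIM('a) / 2"
  have "p > g" using assms by (simp add: p_def)
  from power_gaussian_moment[OF this] obtain C where C: "C > 0"
    and mom: "\<And>r. r > 0 \<Longrightarrow> (\<integral>s. s powr (- p) * exp (- (r / (4 * s))) \<partial>N) \<le> C * r powr (g - p)" by blast
  have "mixture 1 x \<le> ((4 * pi) powr (- p) * C) * norm x powr (2 * g - real DIM('a))" if x: "x \<noteq> 0" for x :: 'a
  proof -
    have "mixture 1 x = (\<integral>s. (4 * pi) powr (- p) * (s powr (- p) * exp (- ((norm x)\<^sup>2 / (4 * s)))) \<partial>N)"
      unfolding mixture_def
      by (intro integral_cong_AE) (use pos in \<open>auto elim!: eventually_mono simp: heat_def p_def powr_mult\<close>)
    also have "\<dots> = (4 * pi) powr (- p) * (\<integral>s. s powr (- p) * exp (- ((norm x)\<^sup>2 / (4 * s))) \<partial>N)" by simp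
    also have "\<dots> \<le> (4 * pi) powr (- p) * (C * ((norm x)\<^sup>2) powr (g - p))"
      using x by (intro mult_left_mono mom) auto
    also have "((norm x)\<^sup>2) powr (g - p) = norm x powr (2 * g - real DIM('a))"
      using x by (simp add: p_def powr_powr right_diff_distrib flip: powr_numeral)
    finally show ?thesis by (simp add: mult.assoc)
  qed
  then show ?thesis using C by (intro exI[of _ "(4 * pi) powr (- p) * C"]) auto
qed

text \<open>In the critical dimension \<open>power_gaussian_moment\<close> does not apply to the kernel, only to its decrease
over one dyadic step, where $1 - e^{-3z} \le 3z$ gains one power of $|x|^2/s$.\<close>

lemma mixture_drop_upper:
  assumes "real DIM('a::euclidean_space) = 2 * g"
  shows "\<exists>C>0. \<forall>x::'a. x \<noteq> 0 \<longrightarrow> mixture 1 x \<le> mixture 1 (2 *\<^sub>R x) + C"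
proof -
  define p where "p = real DIM('a) / 2"
  have pg: "p = g" using assms by (simp add: p_def)
  have "p + 1 > g" using pg by simp
  from power_gaussian_moment[OF this] obtain C where C: "C > 0"
    and mom: "\<And>r. r > 0 \<Longrightarrow> (\<integral>s. s powr (- (p + 1)) * exp (- (r / (4 * s))) \<partial>N) \<le> C * r powr (g - (p + 1))"
    and momi: "\<And>r. r > 0 \<Longrightarrow> integrable N (\<lambda>s. s powr (- (p + 1)) * exp (- (r / (4 * s))))" by blast
  define D where "D = (4 * pi) powr (- p) * (3 / 4)"
  have D: "D > 0" by (simp add: D_def)
  have "mixture 1 x \<le> mixture 1 (2 *\<^sub>R x) + D * C" if x: "x \<noteq> 0" for x :: 'a
  proof -
    define r where "r = (norm x)\<^sup>2"
    have r: "r > 0" using x by (simp add: r_def)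
    have i: "integrable N (\<lambda>s. heat s x)" "integrable N (\<lambda>s. heat s (2 *\<^sub>R x))"
      using integrable_mixture[of 1 x] integrable_mixture[of 1 "2 *\<^sub>R x"] x by auto
    have key: "heat s x \<le> heat s (2 *\<^sub>R x) + D * r * (s powr (- (p + 1)) * exp (- (r / (4 * s))))" if s: "s > 0" for s
    proof -
      define z where "z = r / (4 * s)"
      have h1: "heat s x = (4 * pi) powr (- p) * s powr (- p) * exp (- z)"
        using s by (simp add: heat_def p_def z_def r_def powr_mult)
      have h2: "heat s (2 *\<^sub>R x) = (4 * pi) powr (- p) * s powr (- p) * (exp (- z) * exp (- (3 * z)))"
        using s by (simp add: heat_def p_def z_def r_def powr_mult power_mult_distrib flip: exp_add)
      have "1 - exp (- (3 * z)) \<le> 3 * z" using exp_ge_add_one_self[of "- (3 * z)"] by simp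
      then have "(4 * pi) powr (- p) * s powr (- p) * exp (- z) * (1 - exp (- (3 * z)))
          \<le> (4 * pi) powr (- p) * s powr (- p) * exp (- z) * (3 * z)"
        by (intro mult_left_mono) auto
      also have "\<dots> = D * r * (s powr (- (p + 1)) * exp (- z))"
      proof -
        have "s powr (- (p + 1)) = s powr (- p) / s" using s by (simp add: powr_diff)
        then show ?thesis using s by (simp add: D_def z_def)
      qed
      finally show ?thesis unfolding h1 h2 by (simp add: z_def algebra_simps)
    qed
    have "mixture 1 x \<le> (\<integral>s. heat s (2 *\<^sub>R x) + D * r * (s powr (- (p + 1)) * exp (- (r / (4 * s)))) \<partial>N)"
      unfolding mixture_def using i momi[OF r] pos key
      by (intro integral_mono_AE) (auto elim!: eventually_mono)
    also have "\<dots> = mixture 1 (2 *\<^sub>R x) + D * r * (\<integral>s. s powr (- (p + 1)) * exp (- (r / (4 * s))) \<partial>N)"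
      using i momi[OF r] by (subst Bochner_Integration.integral_add) (auto simp: mixture_def)
    also have "\<dots> \<le> mixture 1 (2 *\<^sub>R x) + D * r * (C * r powr (g - (p + 1)))"
      using D r by (intro add_left_mono mult_left_mono mom) auto
    also have "r powr (g - (p + 1)) = 1 / r" using r by (simp add: pg powr_minus divide_inverse)
    finally show ?thesis using r by simp
  qed
  then show ?thesis using C D by (intro exI[of _ "D * C"]) auto
qed

end

lemma dyadic_lower:
  fixes f :: "real \<Rightarrow> real"
  assumes drop: "\<And>r. 0 < r \<Longrightarrow> r \<le> 2 \<Longrightarrow> f (2 * r) + c \<le> f r" and nonneg: "\<And>r. 0 \<le> f r"
  shows "0 < r \<Longrightarrow> r \<le> 2 / 2 ^ n \<Longrightarrow> c * (real n + 1) \<le> f r"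
proof (induction n arbitrary: r)
  case 0
  with drop[of r] nonneg[of "2 * r"] show ?case by simp
next
  case (Suc n)
  then have "r \<le> 2 / 2 ^ n" by (simp add: field_simps)
  also have "2 / 2 ^ n \<le> (2::real)" by (simp add: field_simps)
  finally have "r \<le> 2" .
  with Suc.prems drop[of r] have "f (2 * r) + c \<le> f r" by simp
  moreover have "c * (real n + 1) \<le> f (2 * r)" using Suc by (intro Suc.IH) (auto simp: field_simps)
  ultimately show ?case by (simp add: algebra_simps)
qed

lemma dyadic_upper:
  fixes f :: "real \<Rightarrow> real"
  assumes drop: "\<And>r. 0 < r \<Longrightarrow> f r \<le> f (2 * r) + c" and base: "\<And>r. 1 \<le> r \<Longrightarrow> f r \<le> A"
  shows "0 < r \<Longrightarrow> 1 / 2 ^ n \<le> r \<Longrightarrow> f r \<le> A + c * real n"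
proof (induction n arbitrary: r)
  case 0
  then show ?case using base by simp
next
  case (Suc n)
  then have "f (2 * r) \<le> A + c * real n" by (intro Suc.IH) (auto simp: field_simps)
  with drop[of r] Suc.prems show ?case by (simp add: algebra_simps)
qed

lemma log_lower_bound:
  fixes f :: "real \<Rightarrow> real"
  assumes drop: "\<And>r. 0 < r \<Longrightarrow> r \<le> 2 \<Longrightarrow> f (2 * r) + c \<le> f r" and nonneg: "\<And>r. 0 \<le> f r"
    and r: "0 < r" "r \<le> 2" and c: "0 < c" and B: "0 < B"
  shows "c / (1 + B * ln 2) * (1 + B * ln (2 / r)) \<le> f r"
proof -
  define L where "L = ln (2 / r) / ln 2"
  have L: "L \<ge> 0" "ln (2 / r) = L * ln 2" using r by (auto simp: L_def)
  \<comment> \<open>The number of doublings that keep $r$ in the range of \<open>drop\<close>.\<close>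
  define n where "n = nat \<lfloor>L\<rfloor>"
  have n: "real n \<le> L" "L < real n + 1" using L unfolding n_def by linarith+
  have "2 ^ n \<le> exp (L * ln 2)" using n by (simp add: powr_realpow[symmetric] powr_def)
  also have "\<dots> = 2 / r" using r by (simp flip: L(2))
  finally have "r \<le> 2 / 2 ^ n" using r by (simp add: field_simps)
  then have 1: "c * (real n + 1) \<le> f r" using r by (intro dyadic_lower drop nonneg)
  have "1 + B * ln (2 / r) \<le> (1 + B * ln 2) * (real n + 1)"
  proof -
    have "B * ln 2 * L \<le> B * ln 2 * (real n + 1)" using n B by (intro mult_left_mono) auto
    then show ?thesis by (simp add: L(2) algebra_simps)
  qed
  moreover have "1 + B * ln 2 > 0" using B by (simp add: add_pos_nonneg)
  ultimately have "c / (1 + B * ln 2) * (1 + B * ln (2 / r)) \<le> c / (1 + B * ln 2) * ((1 + B * ln 2) * (real n + 1))"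
    using c by (intro mult_left_mono) auto
  also have "\<dots> = c * (real n + 1)" using \<open>1 + B * ln 2 > 0\<close> by simp
  finally show ?thesis using 1 by simp
qed

lemma log_upper_bound:
  fixes f :: "real \<Rightarrow> real"
  assumes drop: "\<And>r. 0 < r \<Longrightarrow> f r \<le> f (2 * r) + c" and base: "\<And>r. 1 \<le> r \<Longrightarrow> f r \<le> A"
    and r: "0 < r" "r \<le> 2" and c: "0 < c" and B: "0 < B" and A: "0 \<le> A"
  shows "f r \<le> (A + c / (B * ln 2)) * (1 + B * ln (2 / r))"
proof -
  define L where "L = ln (2 / r) / ln 2"
  have L: "L \<ge> 0" "ln (2 / r) = L * ln 2" using r by (auto simp: L_def)
  \<comment> \<open>The number of doublings that take $r$ beyond $1$.\<close>
  define n where "n = nat \<lceil>L - 1\<rceil>"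
  have n: "real n \<le> L" "L \<le> real n + 1" using L unfolding n_def by linarith+
  have "2 / r = exp (L * ln 2)" using r by (simp flip: L(2))
  also have "\<dots> \<le> exp ((real n + 1) * ln 2)" using n by simp
  also have "\<dots> = 2 powr (real (Suc n))" by (simp add: powr_def add.commute)
  also have "\<dots> = 2 * 2 ^ n" by (subst powr_realpow) auto
  finally have "1 / 2 ^ n \<le> r" using r by (simp add: field_simps)
  then have "f r \<le> A + c * real n" using r by (intro dyadic_upper drop base)
  also have "\<dots> \<le> A + c * L" using n c by simp
  also have "\<dots> \<le> (A + c / (B * ln 2)) * (1 + B * ln (2 / r))"
  proof -
    have "(A + c / (B * ln 2)) * (1 + B * ln (2 / r)) = A + c * L + (A * B * ln 2 * L + c / (B * ln 2))"
      using B by (simp add: L(2) field_simps)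
    moreover have "0 \<le> A * B * ln 2 * L + c / (B * ln 2)" using A B L c by simp
    ultimately show ?thesis by linarith
  qed
  finally show ?thesis .
qed

text \<open>The shape of the self-similar kernel near the origin. In the critical dimension the summand $1$
keeps it positive up to $r = 2$.\<close>

definition origin_profile :: "real \<Rightarrow> nat \<Rightarrow> real \<Rightarrow> real" where
  "origin_profile \<beta> d r = (if real d > \<beta> then r powr (\<beta> - real d) else 1 + \<beta> * ln (2 / r))"

context power_mixture
begin

lemma mixture_profile:
  assumes d: "2 * g \<le> real DIM('a::euclidean_space)"
  shows "\<exists>c1>0. \<exists>c2>0. \<forall>x::'a. x \<noteq> 0 \<and> norm x < 2 \<longrightarrow>
     c1 * origin_profile (2 * g) DIM('a) (norm x) \<le> mixture 1 x \<and>
     mixture 1 x \<le> c2 * origin_profile (2 * g) DIM('a) (norm x)"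
proof -
  from mixture_drop_lower[where ?'a = 'a] obtain c where c: "c > 0"
    and low: "\<And>x::'a. x \<noteq> 0 \<Longrightarrow> norm x \<le> 2 \<Longrightarrow>
       mixture 1 (2 *\<^sub>R x) + c * norm x powr (2 * g - real DIM('a)) \<le> mixture 1 x" by blast
  show ?thesis
  proof (cases "real DIM('a) > 2 * g")
    case True
    from mixture_upper[OF True] obtain C where C: "C > 0"
      and up: "\<And>x::'a. x \<noteq> 0 \<Longrightarrow> mixture 1 x \<le> C * norm x powr (2 * g - real DIM('a))" by blast
    have "c * norm x powr (2 * g - real DIM('a)) \<le> mixture 1 x" if "x \<noteq> 0" "norm x \<le> 2" for x :: 'a
      using low[OF that] mixture_nonneg[of 1 "2 *\<^sub>R x"] by linarith
    then show ?thesis using up c C True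
      by (intro exI[of _ c] exI[of _ C]) (auto simp: origin_profile_def)
  next
    case False
    with d have eq: "real DIM('a) = 2 * g" by simp
    from mixture_drop_upper[OF eq] obtain C where C: "C > 0"
      and up: "\<And>x::'a. x \<noteq> 0 \<Longrightarrow> mixture 1 x \<le> mixture 1 (2 *\<^sub>R x) + C" by blast
    obtain e :: 'a where e: "e \<in> Basis" using nonempty_Basis by blast
    define f where "f = (\<lambda>r. mixture 1 (r *\<^sub>R e))"
    have nre: "norm (r *\<^sub>R e) = r" if "r > 0" for r using e that by simp
    have ne0: "r *\<^sub>R e \<noteq> 0" if "r > 0" for r using e that by auto
    have fx: "mixture 1 x = f (norm x)" if "x \<noteq> 0" for x :: 'a
      using that nre[of "norm x"] ne0[of "norm x"] unfolding f_def
      by (intro antisym mixture_antimono) auto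
    have f_low: "f (2 * r) + c \<le> f r" if "0 < r" "r \<le> 2" for r
      using low[of "r *\<^sub>R e"] that nre[of r] ne0[of r] eq by (simp add: f_def)
    have f_up: "f r \<le> f (2 * r) + C" if "0 < r" for r
      using up[of "r *\<^sub>R e"] that ne0[of r] by (simp add: f_def)
    have f_nonneg: "0 \<le> f r" for r by (simp add: f_def mixture_nonneg)
    have f1: "f r \<le> f 1" if "1 \<le> r" for r
      unfolding f_def using that nre ne0 e by (intro mixture_antimono) auto
    have "c / (1 + 2 * g * ln 2) > 0" using c g by (intro divide_pos_pos add_pos_pos) auto
    moreover have "f 1 + C / (2 * g * ln 2) > 0" using C g f_nonneg[of 1] by (intro add_nonneg_pos) auto
    moreover have "c / (1 + 2 * g * ln 2) * (1 + 2 * g * ln (2 / norm x)) \<le> mixture 1 x"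
      "mixture 1 x \<le> (f 1 + C / (2 * g * ln 2)) * (1 + 2 * g * ln (2 / norm x))"
      if x: "x \<noteq> 0" "norm x < 2" for x :: 'a
      unfolding fx[OF x(1)] using x c C g f_nonneg
      by (intro log_lower_bound log_upper_bound f_low f_up f1; simp)+
    ultimately show ?thesis using False
      by (intro exI[of _ "c / (1 + 2 * g * ln 2)"] exI[of _ "f 1 + C / (2 * g * ln 2)"]) (auto simp: origin_profile_def)
  qed
qed

end

section \<open>The fundamental solution as a mixture\<close>

context mixing_distribution
begin

text \<open>If $|z|$ is at least the fixed point $\rho = q/(1-q)$ of $r \mapsto q(r+1)$, then $|w| \le |z|$ and
monotonicity suffices. Otherwise $|z|$ and $|w|$ are bounded, and the values at $|z| = 2$ and at
the largest possible $|w|$ are compared.\<close>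

lemma mixture_outside:
  assumes q: "0 < q" "q < 1"
  shows "\<exists>D>0. \<forall>(z::'a::euclidean_space) (w::'a). 2 \<le> norm z \<and> w \<noteq> 0 \<and> norm w \<le> q * (norm z + 1) \<longrightarrow> mixture 1 z \<le> D * mixture 1 w"
proof -
  obtain e :: 'a where e: "e \<in> Basis" using nonempty_Basis by blast
  define \<rho> where "\<rho> = q / (1 - q)"
  define R where "R = q * (\<rho> + 1)"
  have \<rho>: "\<rho> > 0" using q by (simp add: \<rho>_def)
  have R: "R > 0" using q \<rho> unfolding R_def by (intro mult_pos_pos add_pos_pos) auto
  define A where "A = mixture 1 (2 *\<^sub>R e)"
  define B where "B = mixture 1 (R *\<^sub>R e)"
  have ne: "2 *\<^sub>R e \<noteq> 0" "R *\<^sub>R e \<noteq> 0" using e R by auto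
  have AB: "A > 0" "B > 0" unfolding A_def B_def using ne by (auto intro: mixture_pos)
  have "mixture 1 z \<le> max 1 (A / B) * mixture 1 w"
    if z: "2 \<le> norm z" and w: "w \<noteq> 0" "norm w \<le> q * (norm z + 1)" for z w :: 'a
  proof (cases "\<rho> \<le> norm z")
    case True
    then have "q * (norm z + 1) \<le> norm z" using q by (simp add: \<rho>_def field_simps)
    then have "mixture 1 z \<le> 1 * mixture 1 w" using w by (simp add: mixture_antimono)
    also have "\<dots> \<le> max 1 (A / B) * mixture 1 w" by (intro mult_right_mono mixture_nonneg) auto
    finally show ?thesis .
  next
    case False
    have "q * (norm z + 1) \<le> R" unfolding R_def using False q by (intro mult_left_mono) auto
    then have "norm w \<le> norm (R *\<^sub>R e)" using w e R by simp
    then have "B \<le> mixture 1 w" unfolding B_def using w by (intro mixture_antimono) auto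
    moreover have "mixture 1 z \<le> A" unfolding A_def using z e ne by (intro mixture_antimono) auto
    ultimately have "mixture 1 z \<le> A / B * mixture 1 w"
      using AB mult_left_mono[of B "mixture 1 w" "A / B"] by simp
    also have "\<dots> \<le> max 1 (A / B) * mixture 1 w" by (intro mult_right_mono mixture_nonneg) auto
    finally show ?thesis .
  qed
  then show ?thesis by (intro exI[of _ "max 1 (A / B)"]) auto
qed

lemma fundamental_solution_eq_mixture:
  fixes Z :: "real \<Rightarrow> 'a::euclidean_space \<Rightarrow> real"
  assumes Z: "fundamental_solution \<alpha> \<beta> Z" and \<beta>: "0 < \<beta>" and t: "0 < t" and x: "x \<noteq> 0"
    and laplace: "\<And>l. 0 \<le> l \<Longrightarrow> mittag_leffler \<alpha> (- (l powr (\<beta> / 2))) = (\<integral>s. exp (- (l * s)) \<partial>N)"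
  shows "Z t x = mixture (t powr (2 * \<alpha> / \<beta>)) x"
proof -
  define \<tau> where "\<tau> = t powr (2 * \<alpha> / \<beta>)"
  have \<tau>: "\<tau> > 0" using t by (simp add: \<tau>_def)
  have ZI: "integrable lborel (Z t)" "continuous_on (- {0}) (Z t)"
    using Z t by (auto simp: fundamental_solution_def has_bochner_integral_iff)
  have open0: "open (- {0::'a})" by auto
  have "Z t x = mixture \<tau> x"
  proof (rule fourier_inj[where f = "Z t" and g = "mixture \<tau>" and x = x])
    show "isCont (Z t) x" "isCont (mixture \<tau>) x"
      using ZI(2) continuous_on_mixture[OF \<tau>, where ?'a = 'a] x open0
      by (auto simp: continuous_on_eq_continuous_at)
    show "integrable lborel (mixture \<tau> :: 'a \<Rightarrow> real)"
      using mixture_integral[OF \<tau>, where ?'a = 'a] by (simp add: has_bochner_integral_iff)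
    fix y :: 'a
    have "fourier_transform (Z t) y = complex_of_real ((2 * pi) powr (- real DIM('a) / 2) *
                mittag_leffler \<alpha> (- (norm y powr \<beta>) * t powr \<alpha>))"
      using Z t by (simp add: fundamental_solution_def)
    then have "(LINT x|lborel. exp (- \<i> * complex_of_real (x \<bullet> y)) * complex_of_real (Z t x))
        = complex_of_real (mittag_leffler \<alpha> (- (norm y powr \<beta>) * t powr \<alpha>))"
      by (simp add: fourier_transform_def)
    moreover have "(\<tau> * (norm y)\<^sup>2) powr (\<beta> / 2) = norm y powr \<beta> * t powr \<alpha>"
    proof (cases "y = 0")
      case False
      then show ?thesis using \<beta> t
        by (simp add: powr_mult \<tau>_def powr_powr flip: powr_numeral)
    qed (use \<beta> in simp)
    then have "(LINT x|lborel. iexp (- (x \<bullet> y)) * complex_of_real (mixture \<tau> x))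
       = complex_of_real (mittag_leffler \<alpha> (- (norm y powr \<beta>) * t powr \<alpha>))"
      using mixture_fourier[OF \<tau>, of y] laplace[of "\<tau> * (norm y)\<^sup>2"] \<tau> by simp
    ultimately show "(LINT x|lborel. iexp (- (x \<bullet> y)) * complex_of_real (Z t x))
        = (LINT x|lborel. iexp (- (x \<bullet> y)) * complex_of_real (mixture \<tau> x))"
      by simp
  qed (fact ZI)
  then show ?thesis by (simp add: \<tau>_def)
qed

lemma fundamental_solution_mixture:
  assumes \<beta>: "0 < \<beta>"
    and laplace: "\<And>l. 0 \<le> l \<Longrightarrow> mittag_leffler \<alpha> (- (l powr (\<beta> / 2))) = (\<integral>s. exp (- (l * s)) \<partial>N)"
  shows "fundamental_solution \<alpha> \<beta> (\<lambda>t. mixture (t powr (2 * \<alpha> / \<beta>)) :: 'a::euclidean_space \<Rightarrow> real)"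
  unfolding fundamental_solution_def
proof (intro allI impI conjI)
  fix t :: real assume t: "0 < t"
  define \<tau> where "\<tau> = t powr (2 * \<alpha> / \<beta>)"
  have \<tau>: "\<tau> > 0" using t by (simp add: \<tau>_def)
  show "has_bochner_integral lborel (mixture (t powr (2 * \<alpha> / \<beta>)) :: 'a \<Rightarrow> real) 1"
    using mixture_integral[OF \<tau>] by (simp add: \<tau>_def)
  show "continuous_on (- {0}) (mixture (t powr (2 * \<alpha> / \<beta>)) :: 'a \<Rightarrow> real)"
    using continuous_on_mixture[OF \<tau>] by (simp add: \<tau>_def)
  fix y :: 'a
  have "(\<tau> * (norm y)\<^sup>2) powr (\<beta> / 2) = norm y powr \<beta> * t powr \<alpha>"
  proof (cases "y = 0")
    case False
    then show ?thesis using \<beta> t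
      by (simp add: powr_mult \<tau>_def powr_powr flip: powr_numeral)
  qed (use \<beta> in simp)
  then show "fourier_transform (mixture (t powr (2 * \<alpha> / \<beta>))) y =
              complex_of_real ((2 * pi) powr (- real DIM('a) / 2) *
                mittag_leffler \<alpha> (- (norm y powr \<beta>) * t powr \<alpha>))"
    using mixture_fourier[OF \<tau>, of y] laplace[of "\<tau> * (norm y)\<^sup>2"] \<tau>
    by (simp add: fourier_transform_def \<tau>_def)
qed (rule mixture_nonneg)

end

lemma power_mixture_mittag_leffler:
  assumes "0 < \<alpha>" "\<alpha> < 1" "0 < g" "mixing_distribution N"
    and laplace: "\<And>l. 0 \<le> l \<Longrightarrow> mittag_leffler \<alpha> (- (l powr g)) = (\<integral>s. exp (- (l * s)) \<partial>N)"
  shows "power_mixture N g (1 / max 1 (Gamma (1 - \<alpha>))) (max 1 (Gamma (1 + \<alpha>)))"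
proof -
  interpret mixing_distribution N by fact
  have G: "Gamma (1 - \<alpha>) > 0" "Gamma (1 + \<alpha>) > 0" using assms by simp_all
  show ?thesis
  proof (unfold_locales)
    fix l :: real assume l: "0 \<le> l"
    define z where "z = l powr g"
    have z: "z \<ge> 0" by (simp add: z_def)
    have "1 + Gamma (1 - \<alpha>) * z \<le> max 1 (Gamma (1 - \<alpha>)) * (1 + z)"
      using z mult_right_mono[of "Gamma (1 - \<alpha>)" "max 1 (Gamma (1 - \<alpha>))" z] by (simp add: ring_distribs add_mono)
    then have "1 / (max 1 (Gamma (1 - \<alpha>)) * (1 + z)) \<le> 1 / (1 + Gamma (1 - \<alpha>) * z)"
      using z G by (intro divide_left_mono) (auto intro!: mult_pos_pos add_pos_nonneg)
    also have "\<dots> \<le> mittag_leffler \<alpha> (- z)" using assms z by (intro mittag_leffler_lower)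
    finally show "1 / max 1 (Gamma (1 - \<alpha>)) / (1 + l powr g) \<le> (\<integral>s. exp (- (l * s)) \<partial>N)"
      using laplace[OF l] by (simp add: z_def)
    have "mittag_leffler \<alpha> (- z) \<le> 1 / (1 + z / Gamma (1 + \<alpha>))" using assms z by (intro mittag_leffler_upper)
    also have "\<dots> \<le> max 1 (Gamma (1 + \<alpha>)) / (1 + z)"
    proof -
      have "1 \<le> max 1 (Gamma (1 + \<alpha>)) / Gamma (1 + \<alpha>)" using G by (simp add: field_simps)
      then have "1 + z \<le> max 1 (Gamma (1 + \<alpha>)) + max 1 (Gamma (1 + \<alpha>)) / Gamma (1 + \<alpha>) * z"
        using z mult_right_mono[of 1 "max 1 (Gamma (1 + \<alpha>)) / Gamma (1 + \<alpha>)" z] by (intro add_mono) auto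
      then have "1 + z \<le> max 1 (Gamma (1 + \<alpha>)) * (1 + z / Gamma (1 + \<alpha>))" by (simp add: ring_distribs)
      moreover have "1 + z / Gamma (1 + \<alpha>) > 0" "1 + z > 0" using z G by (auto intro!: add_pos_nonneg)
      ultimately show ?thesis by (simp add: divide_simps mult_ac)
    qed
    finally show "(\<integral>s. exp (- (l * s)) \<partial>N) \<le> max 1 (Gamma (1 + \<alpha>)) / (1 + l powr g)"
      using laplace[OF l] by (simp add: z_def)
  qed (use assms G in auto)
qed

section \<open>From kernel bounds to the Harnack inequality\<close>

text \<open>The truncated convolutions whose quotient occurs in the Harnack inequality.\<close>

definition local_potential :: "('a::euclidean_space \<Rightarrow> real) \<Rightarrow> real \<Rightarrow> ('a \<Rightarrow> real) \<Rightarrow> 'a \<Rightarrow> real" where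
  "local_potential \<kappa> R u x = (LINT y|lborel. \<kappa> (x - y) * (indicat_real (ball x R) y * u y))"

lemma AE_lborel_minus_nonzero: "AE y in lborel. x - y \<noteq> (0::'a::euclidean_space)"
  using AE_lborel_singleton[of x] by eventually_elim auto

lemma conv_pos:
  fixes u :: "'a::euclidean_space \<Rightarrow> real"
  assumes int: "integrable lborel (\<lambda>y. Z (x - y) * u y)"
    and Zpos: "\<And>z. z \<noteq> 0 \<Longrightarrow> 0 < Z z" and unn: "\<And>y. 0 \<le> u y"
    and cont: "continuous_on UNIV u" and nz: "\<exists>y. u y \<noteq> 0"
  shows "0 < (LINT y|lborel. Z (x - y) * u y)"
proof -
  have nn: "AE y in lborel. 0 \<le> Z (x - y) * u y"
    using AE_lborel_minus_nonzero[of x]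
  proof eventually_elim
    case (elim y)
    then show ?case using Zpos[OF elim] unn[of y] by simp
  qed
  have "(LINT y|lborel. Z (x - y) * u y) \<noteq> 0"
  proof
    assume "(LINT y|lborel. Z (x - y) * u y) = 0"
    then have "AE y in lborel. Z (x - y) * u y = 0"
      using integral_nonneg_eq_0_iff_AE[OF int nn] by simp
    then have ae: "AE y in lborel. u y = 0"
      using AE_lborel_minus_nonzero[of x]
    proof eventually_elim
      case (elim y)
      with Zpos[of "x - y"] show ?case by simp
    qed
    define U where "U = u -` (- {0})"
    have "open U" unfolding U_def using cont by (intro open_vimage) auto
    moreover have "U \<noteq> {}" using nz by (auto simp: U_def)
    ultimately have "\<not> U \<in> null_sets lborel"
      using negligible_iff_null_sets[of U] open_not_negligible[of U] null_sets_completionI[of U lborel] by blast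
    moreover have "U \<in> null_sets lborel"
      using ae \<open>open U\<close> by (subst AE_iff_null_sets) (auto simp: U_def elim!: eventually_mono)
    ultimately show False by simp
  qed
  with integral_nonneg_AE[OF nn] show ?thesis by simp
qed

lemma local_potential_nonneg:
  assumes "\<And>y. 0 \<le> u y" "\<And>z. z \<noteq> 0 \<Longrightarrow> norm z < R \<Longrightarrow> 0 \<le> \<kappa> z"
  shows "0 \<le> local_potential \<kappa> R u x"
  unfolding local_potential_def
proof (rule integral_nonneg_AE)
  show "AE y in lborel. 0 \<le> \<kappa> (x - y) * (indicat_real (ball x R) y * u y)"
    using AE_lborel_minus_nonzero[of x]
    by eventually_elim (use assms in \<open>auto simp: indicator_def dist_norm\<close>)
qed

text \<open>Near the origin $\kappa$ is dominated by the integrable kernel $Z$, so local integrability of the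
Riesz and logarithmic kernels comes for free.\<close>

lemma integrable_local_potential:
  fixes u \<kappa> :: "'a::euclidean_space \<Rightarrow> real"
  assumes [measurable]: "\<kappa> \<in> borel_measurable borel" "u \<in> borel_measurable borel"
    and unn: "\<And>y. 0 \<le> u y" and m: "m > 0"
    and low: "\<And>z. z \<noteq> 0 \<Longrightarrow> norm z < R \<Longrightarrow> m * \<kappa> z \<le> Z z"
    and knn: "\<And>z. z \<noteq> 0 \<Longrightarrow> norm z < R \<Longrightarrow> 0 \<le> \<kappa> z"
    and int: "integrable lborel (\<lambda>y. Z (x - y) * u y)"
  shows "integrable lborel (\<lambda>y. \<kappa> (x - y) * (indicat_real (ball x R) y * u y))"
proof (rule Bochner_Integration.integrable_bound)
  show "integrable lborel (\<lambda>y. (Z (x - y) * u y) / m)" using int by simp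
  show "AE y in lborel. norm (\<kappa> (x - y) * (indicat_real (ball x R) y * u y)) \<le> norm (Z (x - y) * u y / m)"
    using AE_lborel_minus_nonzero[of x]
  proof eventually_elim
    case (elim y)
    show ?case
    proof (cases "y \<in> ball x R")
      case True
      then have n: "norm (x - y) < R" by (simp add: dist_norm)
      have "0 \<le> \<kappa> (x - y)" "m * \<kappa> (x - y) \<le> Z (x - y)" using knn low elim n by auto
      then have "m * \<kappa> (x - y) * u y \<le> Z (x - y) * u y" "0 \<le> m * \<kappa> (x - y) * u y"
        using unn[of y] m by (auto intro: mult_right_mono)
      with True m unn[of y] \<open>0 \<le> \<kappa> (x - y)\<close> show ?thesis by (simp add: field_simps)
    qed simp
  qed
  have "indicat_real (ball x R) \<in> borel_measurable lborel" by (intro borel_measurable_indicator) auto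
  moreover have "u \<in> borel_measurable lborel" "(\<lambda>y. \<kappa> (x - y)) \<in> borel_measurable lborel"
    using assms(1,2) by simp_all
  ultimately show "(\<lambda>y. \<kappa> (x - y) * (indicat_real (ball x R) y * u y)) \<in> borel_measurable lborel"
    by (intro borel_measurable_times)
qed

text \<open>The data in the ball around $x_1$ contribute at most $M_1 p_1$ to $u(t_1,x_1)$, the remaining data at
most $D\,u(t_2,x_2)$, and $p_1 = (p_1/p_2)\, p_2 \le (p_1/p_2)\, u(t_2,x_2)/m_2$. If $p_2 = 0$, the right-hand side is
infinite because $u(t_2,x_2)$ is strictly positive.\<close>

lemma harnack_from_kernel_bounds:
  fixes u \<kappa>1 \<kappa>2 Z1 Z2 :: "'a::euclidean_space \<Rightarrow> real"
  assumes meas [measurable]: "\<kappa>1 \<in> borel_measurable borel" "\<kappa>2 \<in> borel_measurable borel"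
    and unn: "\<And>y. 0 \<le> u y" and cont: "continuous_on UNIV u" and nz: "\<exists>y. u y \<noteq> 0"
    and Z2: "\<And>z. z \<noteq> 0 \<Longrightarrow> 0 < Z2 z"
    and k1: "\<And>z. z \<noteq> 0 \<Longrightarrow> norm z < R1 \<Longrightarrow> 0 \<le> \<kappa>1 z \<and> m1 * \<kappa>1 z \<le> Z1 z \<and> Z1 z \<le> M1 * \<kappa>1 z"
    and k2: "\<And>z. z \<noteq> 0 \<Longrightarrow> norm z < R2 \<Longrightarrow> 0 \<le> \<kappa>2 z \<and> m2 * \<kappa>2 z \<le> Z2 z"
    and m: "m1 > 0" "m2 > 0" "M1 > 0"
    and outside: "\<And>y. R1 \<le> norm (x1 - y) \<Longrightarrow> Z1 (x1 - y) \<le> D * Z2 (x2 - y)"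
    and C: "D \<le> C" "M1 / m2 \<le> C" and D: "D > 0"
    and int1: "integrable lborel (\<lambda>y. Z1 (x1 - y) * u y)"
    and int2: "integrable lborel (\<lambda>y. Z2 (x2 - y) * u y)"
  shows "ereal (LINT y|lborel. Z1 (x1 - y) * u y)
      \<le> ereal C * (1 + ext_ratio (local_potential \<kappa>1 R1 u x1) (local_potential \<kappa>2 R2 u x2))
         * ereal (LINT y|lborel. Z2 (x2 - y) * u y)"
proof -
  have [measurable]: "u \<in> borel_measurable borel" using cont by (rule borel_measurable_continuous_onI)
  define U1 where "U1 = (LINT y|lborel. Z1 (x1 - y) * u y)"
  define U2 where "U2 = (LINT y|lborel. Z2 (x2 - y) * u y)"
  define p1 where "p1 = local_potential \<kappa>1 R1 u x1"
  define p2 where "p2 = local_potential \<kappa>2 R2 u x2"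
  have i1: "integrable lborel (\<lambda>y. \<kappa>1 (x1 - y) * (indicat_real (ball x1 R1) y * u y))"
    by (rule integrable_local_potential[where Z = Z1 and m = m1]) (use unn k1 m int1 in auto)
  have i2: "integrable lborel (\<lambda>y. \<kappa>2 (x2 - y) * (indicat_real (ball x2 R2) y * u y))"
    by (rule integrable_local_potential[where Z = Z2 and m = m2]) (use unn k2 m int2 in auto)
  have U2: "U2 > 0" unfolding U2_def by (rule conv_pos) (use int2 Z2 unn cont nz in auto)
  have p2: "0 \<le> p2" unfolding p2_def by (rule local_potential_nonneg) (use k2 unn in auto)
  have p1: "0 \<le> p1" unfolding p1_def by (rule local_potential_nonneg) (use k1 unn in auto)
  have low2: "m2 * p2 \<le> U2"
  proof -
    have "m2 * p2 = (LINT y|lborel. m2 * (\<kappa>2 (x2 - y) * (indicat_real (ball x2 R2) y * u y)))"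
      by (simp add: p2_def local_potential_def)
    also have "\<dots> \<le> U2" unfolding U2_def
    proof (rule integral_mono_AE)
      show "AE y in lborel. m2 * (\<kappa>2 (x2 - y) * (indicat_real (ball x2 R2) y * u y)) \<le> Z2 (x2 - y) * u y"
        using AE_lborel_minus_nonzero[of x2]
      proof eventually_elim
        case (elim y)
        show ?case
        proof (cases "y \<in> ball x2 R2")
          case True
          then have "norm (x2 - y) < R2" by (simp add: dist_norm)
          then have "m2 * \<kappa>2 (x2 - y) \<le> Z2 (x2 - y)" using k2 elim by auto
          then have "m2 * \<kappa>2 (x2 - y) * u y \<le> Z2 (x2 - y) * u y" using unn[of y] by (rule mult_right_mono)
          with True show ?thesis by (simp add: mult.assoc)
        next
          case False
          then show ?thesis using Z2[OF elim] unn[of y] by simp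
        qed
      qed
    qed (use i2 int2 in auto)
    finally show ?thesis .
  qed
  have up1: "U1 \<le> M1 * p1 + D * U2"
  proof -
    have "U1 \<le> (LINT y|lborel. M1 * (\<kappa>1 (x1 - y) * (indicat_real (ball x1 R1) y * u y)) + D * (Z2 (x2 - y) * u y))"
      unfolding U1_def
    proof (rule integral_mono_AE)
      show "AE y in lborel. Z1 (x1 - y) * u y \<le> M1 * (\<kappa>1 (x1 - y) * (indicat_real (ball x1 R1) y * u y)) + D * (Z2 (x2 - y) * u y)"
        using AE_lborel_minus_nonzero[of x1] AE_lborel_minus_nonzero[of x2]
      proof eventually_elim
        case (elim y)
        have nn: "0 \<le> D * (Z2 (x2 - y) * u y)" using D Z2[OF elim(2)] unn[of y] by simp
        show ?case
        proof (cases "y \<in> ball x1 R1")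
          case True
          then have "norm (x1 - y) < R1" by (simp add: dist_norm)
          then have "Z1 (x1 - y) \<le> M1 * \<kappa>1 (x1 - y)" using k1 elim by auto
          then have "Z1 (x1 - y) * u y \<le> M1 * \<kappa>1 (x1 - y) * u y" using unn[of y] by (rule mult_right_mono)
          with True nn show ?thesis by (simp add: mult.assoc)
        next
          case False
          then have "R1 \<le> norm (x1 - y)" by (simp add: dist_norm)
          then have "Z1 (x1 - y) \<le> D * Z2 (x2 - y)" by (rule outside)
          then have "Z1 (x1 - y) * u y \<le> D * Z2 (x2 - y) * u y" using unn[of y] by (rule mult_right_mono)
          with False show ?thesis by (simp add: mult.assoc)
        qed
      qed
    qed (use i1 int1 int2 in auto)
    also have "\<dots> = M1 * p1 + D * U2"
      using i1 int2 by (subst Bochner_Integration.integral_add) (auto simp: p1_def U2_def local_potential_def)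
    finally show ?thesis .
  qed
  have Cpos: "C > 0" using C D by simp
  have "ereal U1 \<le> ereal C * (1 + ext_ratio p1 p2) * ereal U2"
  proof (cases "p2 = 0")
    case True
    then show ?thesis using Cpos U2 by (simp add: ext_ratio_def)
  next
    case False
    with p2 have p2: "p2 > 0" by simp
    have "M1 * p1 = (M1 / m2) * (p1 / p2) * (m2 * p2)" using m p2 by simp
    also have "\<dots> \<le> C * (p1 / p2) * U2"
      using C m p1 p2 low2 Cpos by (intro mult_mono mult_nonneg_nonneg) auto
    finally have "M1 * p1 + D * U2 \<le> C * (p1 / p2) * U2 + C * U2"
      using C U2 by (intro add_mono mult_right_mono) auto
    with up1 have "U1 \<le> C * (1 + p1 / p2) * U2" by (simp add: algebra_simps)
    then show ?thesis using False by (simp add: ext_ratio_def one_ereal_def)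
  qed
  then show ?thesis by (simp add: U1_def U2_def p1_def p2_def)
qed

text \<open>The convolution kernels of both cases of the Harnack inequality. Multiplied by a constant, they are
the kernels that match $Z(t,\cdot)$ on the ball of radius $2t^{\alpha/\beta}$.\<close>

definition harnack_kernel :: "real \<Rightarrow> real \<Rightarrow> real \<Rightarrow> 'a::euclidean_space \<Rightarrow> real" where
  "harnack_kernel \<alpha> \<beta> t z = (if real DIM('a) > \<beta> then riesz_kernel \<beta> z
     else 1 + \<beta> * ln 2 + \<alpha> * ln t - \<beta> * riesz_const DIM('a) \<beta> * riesz_kernel \<beta> z)"

lemma borel_measurable_harnack_kernel [measurable]: "harnack_kernel \<alpha> \<beta> t \<in> borel_measurable borel"
  unfolding harnack_kernel_def[abs_def] riesz_kernel_def[abs_def] by measurable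

lemma riesz_const_pos: "0 < \<beta> \<Longrightarrow> \<beta> < real d \<Longrightarrow> 0 < riesz_const d \<beta>"
  unfolding riesz_const_def by (auto intro!: divide_pos_pos mult_pos_pos Gamma_real_pos)

lemma riesz_ratio_eq:
  assumes "real DIM('a::euclidean_space) > \<beta>"
  shows "riesz_ratio \<alpha> \<beta> u t1 t2 x1 (x2::'a) = ext_ratio
     (local_potential (harnack_kernel \<alpha> \<beta> t1) (2 * t1 powr (\<alpha> / \<beta>)) u x1)
     (local_potential (harnack_kernel \<alpha> \<beta> t2) (2 * t2 powr (\<alpha> / \<beta>)) u x2)"
  using assms by (simp add: riesz_ratio_def Let_def space_conv_def local_potential_def harnack_kernel_def mult.commute)

lemma log_ratio_eq:
  assumes "real DIM('a::euclidean_space) = \<beta>"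
  shows "log_ratio \<alpha> \<beta> u t1 t2 x1 (x2::'a) = ext_ratio
     (local_potential (harnack_kernel \<alpha> \<beta> t1) (2 * t1 powr (\<alpha> / \<beta>)) u x1)
     (local_potential (harnack_kernel \<alpha> \<beta> t2) (2 * t2 powr (\<alpha> / \<beta>)) u x2)"
  using assms by (simp add: log_ratio_def Let_def space_conv_def local_potential_def harnack_kernel_def)

text \<open>The powers of $t$ cancel to $t^{-\alpha}$; in the critical dimension the scale enters the kernel through
$\alpha \log t$.\<close>

lemma origin_profile_scaled:
  fixes z :: "'a::euclidean_space"
  assumes "0 < \<beta>" "\<beta> \<le> real DIM('a)" "0 < t" "z \<noteq> 0"
  shows "t powr (- (\<alpha> * real DIM('a) / \<beta>)) * origin_profile \<beta> DIM('a) (norm z / t powr (\<alpha> / \<beta>))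
       = (if real DIM('a) > \<beta> then riesz_const DIM('a) \<beta> else 1) * t powr (- \<alpha>) * harnack_kernel \<alpha> \<beta> t z"
proof (cases "real DIM('a) > \<beta>")
  case True
  define d where "d = real DIM('a)"
  have "t powr (- (\<alpha> * d / \<beta>)) * (norm z / t powr (\<alpha> / \<beta>)) powr (\<beta> - d)
      = t powr (- (\<alpha> * d / \<beta>)) * t powr (- (\<alpha> / \<beta> * (\<beta> - d))) * norm z powr (\<beta> - d)"
    by (subst powr_divide) (auto simp: powr_powr powr_minus divide_inverse)
  also have "t powr (- (\<alpha> * d / \<beta>)) * t powr (- (\<alpha> / \<beta> * (\<beta> - d))) = t powr (- \<alpha>)"
    using assms by (subst powr_add[symmetric]) (simp add: field_simps)
  finally show ?thesis
    using True riesz_const_pos[OF assms(1) True]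
    by (simp add: origin_profile_def harnack_kernel_def riesz_kernel_def d_def)
next
  case False
  with assms have eq: "real DIM('a) = \<beta>" by simp
  have "ln (2 / (norm z / t powr (\<alpha> / \<beta>))) = ln 2 - ln (norm z) + \<alpha> / \<beta> * ln t"
  proof -
    have T: "t powr (\<alpha> / \<beta>) > 0" using assms by simp
    have "2 / (norm z / t powr (\<alpha> / \<beta>)) = 2 / norm z * t powr (\<alpha> / \<beta>)" by simp
    then have "ln (2 / (norm z / t powr (\<alpha> / \<beta>))) = ln (2 / norm z) + ln (t powr (\<alpha> / \<beta>))"
      using ln_mult_pos[of "2 / norm z" "t powr (\<alpha> / \<beta>)"] T assms by simp
    then show ?thesis using assms by (simp add: ln_div ln_powr)
  qed
  then have prof: "origin_profile \<beta> DIM('a) (norm z / t powr (\<alpha> / \<beta>)) = 1 + \<beta> * ln 2 + \<alpha> * ln t - \<beta> * ln (norm z)"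
    using False assms(1) by (simp only: origin_profile_def if_False) (simp add: algebra_simps)
  have "riesz_const DIM('a) \<beta> \<noteq> 0"
  proof -
    have "0 < Gamma (real DIM('a) / 2)" by (intro Gamma_real_pos) simp
    then have "Gamma (real DIM('a) / 2) \<noteq> 0" by linarith
    then show ?thesis using False by (simp add: riesz_const_def)
  qed
  then have "harnack_kernel \<alpha> \<beta> t z = 1 + \<beta> * ln 2 + \<alpha> * ln t - \<beta> * ln (norm z)"
    using False by (simp add: harnack_kernel_def riesz_kernel_def)
  moreover have "\<alpha> * real DIM('a) / \<beta> = \<alpha>" using eq assms(1) by simp
  ultimately show ?thesis using False prof by simp
qed

lemma sqrt_powr_double: "0 < t \<Longrightarrow> sqrt (t powr (2 * a)) = t powr a"
  by (simp add: powr_half_sqrt[symmetric] powr_powr)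

lemma (in power_mixture) mixture_near_origin:
  assumes \<beta>: "\<beta> = 2 * g" and d: "\<beta> \<le> real DIM('a::euclidean_space)"
  shows "\<exists>c1>0. \<exists>c2>0. \<forall>t>0. \<forall>z::'a. z \<noteq> 0 \<and> norm z < 2 * t powr (\<alpha> / \<beta>) \<longrightarrow>
     0 < harnack_kernel \<alpha> \<beta> t z \<and>
     c1 * t powr (- \<alpha>) * harnack_kernel \<alpha> \<beta> t z \<le> mixture (t powr (2 * \<alpha> / \<beta>)) z \<and>
     mixture (t powr (2 * \<alpha> / \<beta>)) z \<le> c2 * t powr (- \<alpha>) * harnack_kernel \<alpha> \<beta> t z"
proof -
  have b0: "\<beta> > 0" using g \<beta> by simp
  define k where "k = (if real DIM('a) > \<beta> then riesz_const DIM('a) \<beta> else 1)"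
  have k: "k > 0" using riesz_const_pos[OF b0] by (auto simp: k_def)
  from mixture_profile[where ?'a = 'a] d \<beta> obtain c1 c2 where c: "c1 > 0" "c2 > 0"
    and prof: "\<And>x::'a. x \<noteq> 0 \<Longrightarrow> norm x < 2 \<Longrightarrow>
      c1 * origin_profile \<beta> DIM('a) (norm x) \<le> mixture 1 x \<and>
     mixture 1 x \<le> c2 * origin_profile \<beta> DIM('a) (norm x)" by auto
  have "0 < harnack_kernel \<alpha> \<beta> t z \<and>
     c1 * k * t powr (- \<alpha>) * harnack_kernel \<alpha> \<beta> t z \<le> mixture (t powr (2 * \<alpha> / \<beta>)) z \<and>
     mixture (t powr (2 * \<alpha> / \<beta>)) z \<le> c2 * k * t powr (- \<alpha>) * harnack_kernel \<alpha> \<beta> t z"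
    if t: "t > 0" and z: "z \<noteq> 0" "norm z < 2 * t powr (\<alpha> / \<beta>)" for t and z :: 'a
  proof -
    define \<tau> where "\<tau> = t powr (2 * \<alpha> / \<beta>)"
    have \<tau>: "\<tau> > 0" using t by (simp add: \<tau>_def)
    have sq: "sqrt \<tau> = t powr (\<alpha> / \<beta>)" using sqrt_powr_double[OF t, of "\<alpha> / \<beta>"] by (simp add: \<tau>_def)
    define w where "w = (1 / sqrt \<tau>) *\<^sub>R z"
    have w: "w \<noteq> 0" "norm w = norm z / t powr (\<alpha> / \<beta>)" "norm w < 2"
      using z \<tau> t by (auto simp: w_def sq field_simps)
    have "\<tau> powr (- (real DIM('a) / 2)) = t powr (- (\<alpha> * real DIM('a) / \<beta>))"
      by (simp add: \<tau>_def powr_powr)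
    then have mix: "mixture \<tau> z = t powr (- (\<alpha> * real DIM('a) / \<beta>)) * mixture 1 w"
      using mixture_scale[OF \<tau>, of z] by (simp add: w_def)
    have prof': "t powr (- (\<alpha> * real DIM('a) / \<beta>)) * origin_profile \<beta> DIM('a) (norm w)
        = k * t powr (- \<alpha>) * harnack_kernel \<alpha> \<beta> t z"
      unfolding w(2) k_def by (rule origin_profile_scaled[OF b0 d t z(1)])
    have "t powr (- (\<alpha> * real DIM('a) / \<beta>)) * (c1 * origin_profile \<beta> DIM('a) (norm w)) \<le> mixture \<tau> z"
      unfolding mix using prof[OF w(1,3)] by (intro mult_left_mono) auto
    then have lo: "c1 * k * t powr (- \<alpha>) * harnack_kernel \<alpha> \<beta> t z \<le> mixture \<tau> z"
      by (metis prof' mult.assoc mult.left_commute)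
    have "mixture \<tau> z \<le> t powr (- (\<alpha> * real DIM('a) / \<beta>)) * (c2 * origin_profile \<beta> DIM('a) (norm w))"
      unfolding mix using prof[OF w(1,3)] by (intro mult_left_mono) auto
    then have up: "mixture \<tau> z \<le> c2 * k * t powr (- \<alpha>) * harnack_kernel \<alpha> \<beta> t z"
      by (metis prof' mult.assoc mult.left_commute)
    have "0 < mixture \<tau> z" using \<tau> z by (intro mixture_pos)
    with up have "0 < (c2 * k * t powr (- \<alpha>)) * harnack_kernel \<alpha> \<beta> t z" by simp
    moreover have "0 < c2 * k * t powr (- \<alpha>)" using c k t by simp
    ultimately have "0 < harnack_kernel \<alpha> \<beta> t z" by (rule zero_less_mult_pos)
    with lo up show ?thesis by (simp add: \<tau>_def)
  qed
  then show ?thesis using c k by (intro exI[of _ "c1 * k"] exI[of _ "c2 * k"] conjI) auto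
qed

text \<open>Here $w = x_2 - y$ is allowed to be longer than $z = x_1 - y$ by one unit of self-similar length,
which bounds $|x_1 - x_2|$.\<close>

lemma (in mixing_distribution) mixture_outside_scaled:
  assumes \<alpha>\<beta>: "0 < \<alpha>" "0 < \<beta>" and s: "1 < s"
  shows "\<exists>D>0. \<forall>t>0. \<forall>(z::'a::euclidean_space) (w::'a).
     2 * t powr (\<alpha> / \<beta>) \<le> norm z \<and> w \<noteq> 0 \<and> norm w \<le> norm z + t powr (\<alpha> / \<beta>) \<longrightarrow>
     mixture (t powr (2 * \<alpha> / \<beta>)) z \<le> D * mixture ((s * t) powr (2 * \<alpha> / \<beta>)) w"
proof -
  define q where "q = s powr (- (\<alpha> / \<beta>))"
  have q: "0 < q" "q < 1" using s \<alpha>\<beta> by (auto simp: q_def powr_minus inverse_less_1_iff intro!: gr_one_powr)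
  from mixture_outside[OF q, where ?'a = 'a] obtain D where D: "D > 0"
    and out': "\<forall>(z::'a) (w::'a). 2 \<le> norm z \<and> w \<noteq> 0 \<and> norm w \<le> q * (norm z + 1) \<longrightarrow> mixture 1 z \<le> D * mixture 1 w"
    by (elim exE conjE) (rule that)
  have out: "mixture 1 z \<le> D * mixture 1 w" if "2 \<le> norm z" "w \<noteq> 0" "norm w \<le> q * (norm z + 1)" for z w :: 'a
    using out' that by simp
  define p where "p = real DIM('a) / 2"
  define E where "E = D * (s powr (2 * \<alpha> / \<beta>)) powr p"
  have "mixture (t powr (2 * \<alpha> / \<beta>)) z \<le> E * mixture ((s * t) powr (2 * \<alpha> / \<beta>)) w"
    if t: "t > 0" and z: "2 * t powr (\<alpha> / \<beta>) \<le> norm z" and w: "w \<noteq> 0" "norm w \<le> norm z + t powr (\<alpha> / \<beta>)"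
    for t and z w :: 'a
  proof -
    define \<tau>1 where "\<tau>1 = t powr (2 * \<alpha> / \<beta>)"
    define \<tau>2 where "\<tau>2 = (s * t) powr (2 * \<alpha> / \<beta>)"
    have \<tau>: "\<tau>1 > 0" "\<tau>2 > 0" using t s by (auto simp: \<tau>1_def \<tau>2_def)
    have sq: "sqrt \<tau>1 = t powr (\<alpha> / \<beta>)" "sqrt \<tau>2 = (s * t) powr (\<alpha> / \<beta>)"
      using sqrt_powr_double[of t "\<alpha> / \<beta>"] sqrt_powr_double[of "s * t" "\<alpha> / \<beta>"] t s
      by (simp_all add: \<tau>1_def \<tau>2_def)
    have qq: "q * sqrt \<tau>2 = sqrt \<tau>1"
      using t s by (simp add: sq q_def powr_mult powr_minus)
    have \<tau>2: "\<tau>2 = s powr (2 * \<alpha> / \<beta>) * \<tau>1" using t s by (simp add: \<tau>1_def \<tau>2_def powr_mult)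
    have "mixture 1 ((1 / sqrt \<tau>1) *\<^sub>R z) \<le> D * mixture 1 ((1 / sqrt \<tau>2) *\<^sub>R w)"
    proof (rule out)
      show "2 \<le> norm ((1 / sqrt \<tau>1) *\<^sub>R z)" using z \<tau> t by (simp add: sq field_simps)
      show "(1 / sqrt \<tau>2) *\<^sub>R w \<noteq> 0" using w \<tau> by simp
      have "norm w / sqrt \<tau>2 \<le> (norm z + sqrt \<tau>1) / sqrt \<tau>2"
        using w \<tau> by (intro divide_right_mono) (auto simp: sq)
      also have "\<dots> = q * (norm z / sqrt \<tau>1 + 1)"
        using \<tau> q by (simp add: qq[symmetric] field_simps)
      finally show "norm ((1 / sqrt \<tau>2) *\<^sub>R w) \<le> q * (norm ((1 / sqrt \<tau>1) *\<^sub>R z) + 1)"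
        using \<tau> by simp
    qed
    then have "\<tau>1 powr (- p) * mixture 1 ((1 / sqrt \<tau>1) *\<^sub>R z) \<le> \<tau>1 powr (- p) * (D * mixture 1 ((1 / sqrt \<tau>2) *\<^sub>R w))"
      by (intro mult_left_mono) auto
    also have "\<tau>1 powr (- p) * mixture 1 ((1 / sqrt \<tau>1) *\<^sub>R z) = mixture \<tau>1 z"
      using mixture_scale[OF \<tau>(1), of z] by (simp add: p_def)
    also have "\<tau>1 powr (- p) = (s powr (2 * \<alpha> / \<beta>)) powr p * \<tau>2 powr (- p)"
      unfolding \<tau>2 using \<tau> s by (simp add: powr_mult powr_minus)
    also have "(s powr (2 * \<alpha> / \<beta>)) powr p * \<tau>2 powr (- p) * (D * mixture 1 ((1 / sqrt \<tau>2) *\<^sub>R w))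
       = E * (\<tau>2 powr (- p) * mixture 1 ((1 / sqrt \<tau>2) *\<^sub>R w))" by (simp add: E_def)
    also have "\<tau>2 powr (- p) * mixture 1 ((1 / sqrt \<tau>2) *\<^sub>R w) = mixture \<tau>2 w"
      using mixture_scale[OF \<tau>(2), of w] by (simp add: p_def)
    finally show ?thesis by (simp add: \<tau>1_def \<tau>2_def)
  qed
  moreover have "E > 0" using D s by (simp add: E_def)
  ultimately show ?thesis by (intro exI[of _ E]) auto
qed

lemma smooth_of_order_continuous: "smooth_of_order k u \<Longrightarrow> continuous_on UNIV u"
  unfolding smooth_of_order_def by (drule spec[of _ 0]) (simp add: zero_enat_def[symmetric])

text \<open>For $d < \beta$ the assertion is void.\<close>

lemma harnack_constant_exists:
  fixes k :: enat
  assumes \<alpha>: "0 < \<alpha>" "\<alpha> < 1" and \<beta>: "0 < \<beta>" "\<beta> \<le> 2"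
  shows "\<exists>C. harnack_constant TYPE('a::euclidean_space) k \<alpha> \<beta> C"
proof (cases "\<beta> \<le> real DIM('a)")
  case False
  then show ?thesis by (intro exI[of _ "\<lambda>_. 1"]) (auto simp: harnack_constant_def)
next
  case True
  define g where "g = \<beta> / 2"
  have g': "0 < g" "g \<le> 1" "\<beta> = 2 * g" using \<beta> by (auto simp: g_def)
  obtain N where N: "real_distribution N" "AE s in N. 0 < s"
    and lap: "\<And>l. 0 \<le> l \<Longrightarrow> mittag_leffler \<alpha> (- (l powr g)) = (\<integral>s. exp (- (l * s)) \<partial>N)"
    using mittag_leffler_powr_laplace[OF \<alpha> g'(1,2)] by blast
  interpret real_distribution N by fact
  interpret mixing_distribution N by unfold_locales fact
  interpret power_mixture N g "1 / max 1 (Gamma (1 - \<alpha>))" "max 1 (Gamma (1 + \<alpha>))"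
    by (rule power_mixture_mittag_leffler[OF \<alpha> g'(1) _ lap]) unfold_locales
  from mixture_near_origin[OF g'(3) True, of \<alpha>] obtain c1 c2 where c: "c1 > 0" "c2 > 0"
    and near: "\<And>t z. t > 0 \<Longrightarrow> z \<noteq> (0::'a) \<Longrightarrow> norm z < 2 * t powr (\<alpha> / \<beta>) \<Longrightarrow>
     0 < harnack_kernel \<alpha> \<beta> t z \<and>
     c1 * t powr (- \<alpha>) * harnack_kernel \<alpha> \<beta> t z \<le> mixture (t powr (2 * \<alpha> / \<beta>)) z \<and>
     mixture (t powr (2 * \<alpha> / \<beta>)) z \<le> c2 * t powr (- \<alpha>) * harnack_kernel \<alpha> \<beta> t z" by blast
  have "\<forall>s. \<exists>D. 1 < s \<longrightarrow> D > 0 \<and> (\<forall>t>0. \<forall>(z::'a) (w::'a).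
     2 * t powr (\<alpha> / \<beta>) \<le> norm z \<and> w \<noteq> 0 \<and> norm w \<le> norm z + t powr (\<alpha> / \<beta>) \<longrightarrow>
     mixture (t powr (2 * \<alpha> / \<beta>)) z \<le> D * mixture ((s * t) powr (2 * \<alpha> / \<beta>)) w)"
    using mixture_outside_scaled[OF \<alpha>(1) \<beta>(1), where ?'a = 'a] by blast
  from choice[OF this] obtain D where DD: "\<forall>s. 1 < s \<longrightarrow> D s > 0 \<and> (\<forall>t>0. \<forall>(z::'a) (w::'a).
     2 * t powr (\<alpha> / \<beta>) \<le> norm z \<and> w \<noteq> 0 \<and> norm w \<le> norm z + t powr (\<alpha> / \<beta>) \<longrightarrow>
     mixture (t powr (2 * \<alpha> / \<beta>)) z \<le> D s * mixture ((s * t) powr (2 * \<alpha> / \<beta>)) w)" ..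
  then have D: "D s > 0" if "1 < s" for s using that by simp
  have out: "mixture (t powr (2 * \<alpha> / \<beta>)) z \<le> D s * mixture ((s * t) powr (2 * \<alpha> / \<beta>)) w"
    if "1 < s" "t > 0" "2 * t powr (\<alpha> / \<beta>) \<le> norm z" "w \<noteq> 0" "norm w \<le> norm z + t powr (\<alpha> / \<beta>)"
    for s t and z w :: 'a
    using DD that by simp
  define C where "C = (\<lambda>s. max (D s) (c2 / c1 * s powr \<alpha>))"
  have main: "ereal (u t1 x1) \<le> ereal (C (t2 / t1)) * (1 + ext_ratio
     (local_potential (harnack_kernel \<alpha> \<beta> t1) (2 * t1 powr (\<alpha> / \<beta>)) u0 x1)
     (local_potential (harnack_kernel \<alpha> \<beta> t2) (2 * t2 powr (\<alpha> / \<beta>)) u0 x2)) * ereal (u t2 x2)"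
    if r: "0 < r" and sm: "smooth_of_order k u0" and u0: "\<forall>x. 0 \<le> u0 x" "\<exists>x. u0 x \<noteq> 0"
      and ms: "mild_solution \<alpha> \<beta> T u0 u" and t1: "(2 * r) powr (\<beta> / \<alpha>) \<le> t1" and t12: "t1 < t2"
      and t2: "t2 \<le> t1 + (2 * r) powr (\<beta> / \<alpha>)" and T: "t1 + (2 * r) powr (\<beta> / \<alpha>) \<le> T"
      and x: "x1 \<in> ball 0 r" "x2 \<in> ball 0 r"
    for r T u0 u t1 t2 and x1 x2 :: 'a
  proof -
    have "0 < (2 * r) powr (\<beta> / \<alpha>)" using r by simp
    with t1 t12 t2 T have pos: "0 < t1" "0 < t2" "t1 \<le> T" "t2 \<le> T" by linarith+
    define s where "s = t2 / t1"
    have s: "1 < s" "s * t1 = t2" using pos t12 by (auto simp: s_def)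
    from ms obtain Z where Z: "fundamental_solution \<alpha> \<beta> Z"
      and rep: "\<And>t x. 0 < t \<Longrightarrow> t \<le> T \<Longrightarrow> integrable lborel (\<lambda>y. Z t (x - y) * u0 y)"
        "\<And>t x. 0 < t \<Longrightarrow> t \<le> T \<Longrightarrow> u t x = (LINT y|lborel. Z t (x - y) * u0 y)"
      by (auto simp: mild_solution_def)
    have Zeq: "Z t z = mixture (t powr (2 * \<alpha> / \<beta>)) z" if "t > 0" "z \<noteq> 0" for t z
      using that lap by (intro fundamental_solution_eq_mixture[OF Z \<beta>(1)]) (auto simp: g_def)
    have dist: "norm (x1 - x2) < t1 powr (\<alpha> / \<beta>)"
    proof -
      have "norm (x1 - x2) \<le> norm x1 + norm x2" by (rule norm_triangle_ineq4)
      also have "\<dots> < 2 * r" using x by simp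
      also have "2 * r = ((2 * r) powr (\<beta> / \<alpha>)) powr (\<alpha> / \<beta>)" using r \<alpha> \<beta> by (simp add: powr_powr)
      also have "\<dots> \<le> t1 powr (\<alpha> / \<beta>)" using t1 \<alpha> \<beta> by (intro powr_mono2) auto
      finally show ?thesis .
    qed
    have "ereal (LINT y|lborel. Z t1 (x1 - y) * u0 y) \<le> ereal (C s) * (1 + ext_ratio
     (local_potential (harnack_kernel \<alpha> \<beta> t1) (2 * t1 powr (\<alpha> / \<beta>)) u0 x1)
     (local_potential (harnack_kernel \<alpha> \<beta> t2) (2 * t2 powr (\<alpha> / \<beta>)) u0 x2)) * ereal (LINT y|lborel. Z t2 (x2 - y) * u0 y)"
    proof (rule harnack_from_kernel_bounds[where D = "D s" and ?m1.0 = "c1 * t1 powr (- \<alpha>)"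
          and ?M1.0 = "c2 * t1 powr (- \<alpha>)" and ?m2.0 = "c1 * t2 powr (- \<alpha>)"])
      show "continuous_on UNIV u0" using sm by (rule smooth_of_order_continuous)
      show "0 < Z t2 z" if "z \<noteq> 0" for z using that pos by (simp add: Zeq mixture_pos)
      show "0 \<le> harnack_kernel \<alpha> \<beta> t1 z \<and> c1 * t1 powr (- \<alpha>) * harnack_kernel \<alpha> \<beta> t1 z \<le> Z t1 z
          \<and> Z t1 z \<le> c2 * t1 powr (- \<alpha>) * harnack_kernel \<alpha> \<beta> t1 z"
        if "z \<noteq> 0" "norm z < 2 * t1 powr (\<alpha> / \<beta>)" for z
        using near[OF pos(1) that] pos that by (simp add: Zeq)
      show "0 \<le> harnack_kernel \<alpha> \<beta> t2 z \<and> c1 * t2 powr (- \<alpha>) * harnack_kernel \<alpha> \<beta> t2 z \<le> Z t2 z"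
        if "z \<noteq> 0" "norm z < 2 * t2 powr (\<alpha> / \<beta>)" for z
        using near[OF pos(2) that] pos that by (simp add: Zeq)
      show "Z t1 (x1 - y) \<le> D s * Z t2 (x2 - y)" if y: "2 * t1 powr (\<alpha> / \<beta>) \<le> norm (x1 - y)" for y
      proof -
        have t1p: "0 < t1 powr (\<alpha> / \<beta>)" using pos by simp
        have e: "x2 - y = (x1 - y) - (x1 - x2)" by simp
        have "norm (x1 - y) - norm (x1 - x2) \<le> norm (x2 - y)" unfolding e by (rule norm_triangle_ineq2)
        then have "0 < norm (x2 - y)" using dist y t1p by linarith
        then have n2: "x2 - y \<noteq> 0" by simp
        have n1: "x1 - y \<noteq> 0" using y t1p by auto
        have "norm (x2 - y) \<le> norm (x1 - y) + norm (x1 - x2)" unfolding e by (rule norm_triangle_ineq4)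
        then have "norm (x2 - y) \<le> norm (x1 - y) + t1 powr (\<alpha> / \<beta>)" using dist by simp
        from out[OF s(1) pos(1) y n2 this] show ?thesis using pos n1 n2 s by (simp add: Zeq)
      qed
      show "c2 * t1 powr - \<alpha> / (c1 * t2 powr - \<alpha>) \<le> C s"
      proof -
        have "c2 * t1 powr - \<alpha> / (c1 * t2 powr - \<alpha>) = c2 / c1 * s powr \<alpha>"
          using pos c by (simp add: s_def powr_divide powr_minus field_simps)
        then show ?thesis by (simp add: C_def)
      qed
    qed (use u0 c pos D[OF s(1)] rep in \<open>auto simp: C_def\<close>)
    then show ?thesis using rep pos by (simp add: s_def)
  qed
  have "harnack_constant TYPE('a) k \<alpha> \<beta> C"
    unfolding harnack_constant_def
  proof (intro conjI allI impI ballI, goal_cases)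
    case (1 s)
    then show ?case using D[of s] by (simp add: C_def less_max_iff_disj)
  next
    case (2 r T u0 u t1 t2 x1 x2)
    then show ?case unfolding riesz_ratio_eq[OF 2(4)]
      by (intro main[of r u0 T]) (elim conjE, assumption)+
  next
    case (3 r T u0 u t1 t2 x1 x2)
    then show ?case unfolding log_ratio_eq[OF 3(4)]
      by (intro main[of r u0 T]) (elim conjE, assumption)+
  qed
  then show ?thesis by blast
qed

section \<open>Blow-up of the constant for $\beta = 2$\<close>

text \<open>Once $\alpha k \ge 1$, monotonicity of the Gamma function gives $\Gamma(1+\alpha k) \le k!$. The finitely many
terms $z^k/k!$ with $k < K$ are bounded by $2^K (z/2)^k/k!$, which sum to at most $2^K e^{z/2}$.\<close>

lemma mittag_leffler_growth:
  assumes "0 < \<alpha>" "\<alpha> \<le> 1"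
  shows "\<exists>c. \<forall>z\<ge>0. exp z - c * exp (z / 2) \<le> mittag_leffler \<alpha> z"
proof -
  obtain K :: nat where K: "1 / \<alpha> \<le> real K" using real_arch_simple by blast
  have \<alpha>K: "1 \<le> \<alpha> * real k" if "k \<ge> K" for k
  proof -
    have "\<alpha> * (1 / \<alpha>) \<le> \<alpha> * real k" using K that assms by (intro mult_left_mono) auto
    then show ?thesis using assms by simp
  qed
  have Gam: "Gamma (1 + \<alpha> * real k) \<le> fact k" if "k \<ge> K" for k
  proof -
    have "\<alpha> * real k \<le> 1 * real k" using assms by (intro mult_right_mono) auto
    then have "1 + \<alpha> * real k = 1 + real k \<or> Gamma (1 + \<alpha> * real k) < Gamma (1 + real k)"
      using Gamma_real_strict_mono[of "1 + \<alpha> * real k" "1 + real k"] \<alpha>K[OF that] by (auto simp: less_eq_real_def)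
    then show ?thesis using Gamma_fact[of k, where ?'a = real] by auto
  qed
  have "exp z - 2 ^ K * exp (z / 2) \<le> mittag_leffler \<alpha> z" if z: "z \<ge> 0" for z
  proof -
    have Gpos: "0 < Gamma (1 + \<alpha> * real k)" for k using assms by (intro Gamma_real_pos add_pos_nonneg) auto
    have e: "(\<lambda>k. z ^ k / fact k) sums exp z" "(\<lambda>k. (z / 2) ^ k / fact k) sums exp (z / 2)"
      using exp_converges[of z] exp_converges[of "z / 2"] by (simp_all add: scaleR_conv_of_real field_simps)
    have le: "z ^ k / fact k \<le> z ^ k / Gamma (1 + \<alpha> * real k) + 2 ^ K * ((z / 2) ^ k / fact k)" for k
    proof (cases "k \<ge> K")
      case True
      have "z ^ k / fact k \<le> z ^ k / Gamma (1 + \<alpha> * real k)"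
        using Gam[OF True] Gpos z by (intro divide_left_mono) auto
      moreover have "0 \<le> 2 ^ K * ((z / 2) ^ k / fact k)" using z by simp
      ultimately show ?thesis by linarith
    next
      case False
      then have "(2::real) ^ k \<le> 2 ^ K" by (intro power_increasing) auto
      then have "2 ^ k * ((z / 2) ^ k / fact k) \<le> 2 ^ K * ((z / 2) ^ k / fact k)"
        using z by (intro mult_right_mono) auto
      moreover have "2 ^ k * ((z / 2) ^ k / fact k) = z ^ k / fact k" by (simp add: power_divide)
      moreover have "0 \<le> z ^ k / Gamma (1 + \<alpha> * real k)" using z Gpos[of k] by simp
      ultimately show ?thesis by linarith
    qed
    have s: "(\<lambda>k. z ^ k / Gamma (1 + \<alpha> * real k) + 2 ^ K * ((z / 2) ^ k / fact k)) sums (mittag_leffler \<alpha> z + 2 ^ K * exp (z / 2))"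
      unfolding mittag_leffler_def using summable_mittag_leffler[OF assms, of z]
      by (intro sums_add sums_mult e summable_sums)
    have "exp z \<le> mittag_leffler \<alpha> z + 2 ^ K * exp (z / 2)"
      by (rule sums_le[OF le e(1) s])
    then show ?thesis by simp
  qed
  then show ?thesis by blast
qed

lemma cont_differentiable_exp_inner:
  "cont_differentiable n (\<lambda>x::'a::euclidean_space. c * exp (a \<bullet> x) + b)"
proof (induction n arbitrary: c b)
  case 0
  show ?case by (auto intro!: continuous_intros)
next
  case (Suc n)
  have D: "((\<lambda>x. c * exp (a \<bullet> x) + b) has_derivative (\<lambda>v. (c * (a \<bullet> v)) * exp (a \<bullet> x) + 0)) (at x)" for x :: 'a
    by (auto intro!: derivative_eq_intros simp: mult_ac)
  have "(\<lambda>x. c * exp (a \<bullet> x) + b) differentiable_on UNIV"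
    using D by (auto simp: differentiable_on_def differentiable_def)
  moreover have "frechet_derivative (\<lambda>x. c * exp (a \<bullet> x) + b) (at x) v = (c * (a \<bullet> v)) * exp (a \<bullet> x) + 0" for x v :: 'a
    using frechet_derivative_at[OF D[of x]] by (simp add: fun_eq_iff)
  ultimately show ?case using Suc[of "c * (a \<bullet> v)" 0 for v] by simp
qed

lemma local_potential_reflect:
  fixes \<kappa> u :: "'a::euclidean_space \<Rightarrow> real"
  assumes "integrable lborel (\<lambda>z. \<kappa> z * (indicat_real (ball 0 R) z * u (x - z)))"
  shows "local_potential \<kappa> R u x = (LINT z|lborel. \<kappa> z * (indicat_real (ball 0 R) z * u (x - z)))"
proof -
  have "has_bochner_integral lborel (\<lambda>y. \<kappa> (x - y) * (indicat_real (ball 0 R) (x - y) * u (x - (x - y))))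
     (LINT z|lborel. \<kappa> z * (indicat_real (ball 0 R) z * u (x - z)))"
    by (rule has_bochner_integral_reflect) (rule has_bochner_integral_integrable[OF assms])
  moreover have "indicat_real (ball 0 R) (x - y) = indicat_real (ball x R) y" for y
    by (simp add: indicator_def dist_norm norm_minus_commute)
  ultimately show ?thesis by (simp add: local_potential_def has_bochner_integral_iff)
qed

lemma harnack_kernel_mono_time:
  assumes "0 < \<alpha>" "0 < t1" "t1 \<le> t2"
  shows "harnack_kernel \<alpha> \<beta> t1 z \<le> harnack_kernel \<alpha> \<beta> t2 z"
  using assms by (simp add: harnack_kernel_def)

text \<open>The inequality with $r = 1/2$, $T = 2$, $t_1 = 1$, $t_2 = s$ for the datum $e^{A e\cdot y} + e^{9A/4}$. Points of the
ball of radius $2$ around $x_1 = e/4$ satisfy $e \cdot y \le 9/4$. There the datum is at most twice its constant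
part, and so the ratio is at most $2$.\<close>

lemma harnack_constant_lower_bound:
  assumes \<alpha>: "0 < \<alpha>" "\<alpha> < 1" and d: "2 \<le> real DIM('a::euclidean_space)"
    and C: "harnack_constant TYPE('a) k \<alpha> 2 C" and s: "1 < s" "s \<le> 2" and A: "0 \<le> A"
  shows "exp (A / 4) * mittag_leffler \<alpha> (A\<^sup>2) / (3 * (exp (- (A / 4)) * mittag_leffler \<alpha> (A\<^sup>2 * s powr \<alpha>) + exp (9 / 4 * A))) \<le> C s"
proof -
  \<comment> \<open>The solution up to time $2$ needs the exponential moments of $N$ up to $A^2 2^\alpha$.\<close>
  define L where "L = A\<^sup>2 * 2 powr \<alpha>"
  have L: "0 \<le> L" by (simp add: L_def)
  obtain N where N: "real_distribution N" "AE s in N. 0 < s"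
    and lap: "\<And>x. -L \<le> x \<Longrightarrow> has_bochner_integral N (\<lambda>s. exp (- (x * s))) (mittag_leffler \<alpha> (- x))"
    using mittag_leffler_bilateral_laplace[OF \<alpha> L] by blast
  interpret real_distribution N by fact
  interpret mixing_distribution N by unfold_locales fact
  have lap1: "mittag_leffler \<alpha> (- (l powr 1)) = (\<integral>s. exp (- (l * s)) \<partial>N)" if "0 \<le> l" for l
    using lap[of l] L that by (simp add: has_bochner_integral_iff)
  interpret power_mixture N 1 "1 / max 1 (Gamma (1 - \<alpha>))" "max 1 (Gamma (1 + \<alpha>))"
    by (rule power_mixture_mittag_leffler[OF \<alpha> _ _ lap1]) (simp, unfold_locales)
  define Z where "Z = (\<lambda>t. mixture (t powr (2 * \<alpha> / 2)) :: 'a \<Rightarrow> real)"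
  have Z: "fundamental_solution \<alpha> 2 Z"
    unfolding Z_def by (rule fundamental_solution_mixture) (use lap1 in auto)
  from mixture_near_origin[of 2, OF mult_1_right[symmetric] d, of \<alpha>] obtain c1 c2 where c: "c1 > 0" "c2 > 0"
    and near': "\<And>t z. t > 0 \<Longrightarrow> z \<noteq> (0::'a) \<Longrightarrow> norm z < 2 * t powr (\<alpha> / 2) \<Longrightarrow>
     0 < harnack_kernel \<alpha> 2 t z \<and>
     c1 * t powr (- \<alpha>) * harnack_kernel \<alpha> 2 t z \<le> mixture (t powr (2 * \<alpha> / 2)) z \<and>
     mixture (t powr (2 * \<alpha> / 2)) z \<le> c2 * t powr (- \<alpha>) * harnack_kernel \<alpha> 2 t z" by blast
  have near: "0 < harnack_kernel \<alpha> 2 t z \<and> c1 * t powr (- \<alpha>) * harnack_kernel \<alpha> 2 t z \<le> Z t z"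
    if "t > 0" "z \<noteq> 0" "norm z < 2 * t powr (\<alpha> / 2)" for t and z :: 'a
    using near'[OF that] by (simp add: Z_def)
  obtain e :: 'a where e: "e \<in> Basis" using nonempty_Basis by blast
  let ?a = "A *\<^sub>R e"
  let ?k = "harnack_kernel \<alpha> 2 :: real \<Rightarrow> 'a \<Rightarrow> real"
  define B where "B = exp (9 / 4 * A)"
  have B: "B > 0" by (simp add: B_def)
  define u0 where "u0 = (\<lambda>x::'a. exp (?a \<bullet> x) + B)"
  have u0pos: "0 < u0 x" for x using B by (simp add: u0_def add_pos_pos)
  define E where "E = (\<lambda>t. mittag_leffler \<alpha> (A\<^sup>2 * t powr \<alpha>))"
  have conv: "has_bochner_integral lborel (\<lambda>y. Z t (x - y) * u0 y) (exp (?a \<bullet> x) * E t + B)"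
    if t: "0 < t" "t \<le> 2" for t x
  proof -
    define \<tau> where "\<tau> = t powr (2 * \<alpha> / 2)"
    have \<tau>: "\<tau> > 0" using t by (simp add: \<tau>_def)
    have n: "(norm (- ?a))\<^sup>2 = A\<^sup>2" using e by (simp add: power_mult_distrib)
    have "\<tau> \<le> 2 powr \<alpha>" using t \<alpha> unfolding \<tau>_def by (auto intro!: powr_mono2)
    then have "A\<^sup>2 * \<tau> \<le> L" unfolding L_def by (intro mult_left_mono) auto
    then have "has_bochner_integral N (\<lambda>s. exp (- (- (A\<^sup>2 * \<tau>) * s))) (mittag_leffler \<alpha> (- (- (A\<^sup>2 * \<tau>))))"
      by (intro lap) auto
    then have "has_bochner_integral N (\<lambda>s. exp (\<tau> * s * (norm (- ?a))\<^sup>2)) (E t)"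
      unfolding n by (simp add: E_def \<tau>_def mult_ac)
    then have 1: "has_bochner_integral lborel (\<lambda>z. exp (- ?a \<bullet> z) * mixture \<tau> z) (E t)"
      using mixture_exp_integral[OF \<tau>, of "- ?a"] by (simp add: has_bochner_integral_iff)
    have "has_bochner_integral lborel (\<lambda>y. exp (?a \<bullet> x) * (exp (- ?a \<bullet> (x - y)) * mixture \<tau> (x - y)) + B * mixture \<tau> (x - y))
       (exp (?a \<bullet> x) * E t + B * 1)"
      by (intro has_bochner_integral_add has_bochner_integral_mult_right
          has_bochner_integral_reflect[OF 1] has_bochner_integral_reflect[OF mixture_integral[OF \<tau>]])
    moreover have "exp (?a \<bullet> x) * (exp (- ?a \<bullet> (x - y)) * mixture \<tau> (x - y)) + B * mixture \<tau> (x - y)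
        = Z t (x - y) * u0 y" for y
    proof -
      have "?a \<bullet> x + - ?a \<bullet> (x - y) = ?a \<bullet> y"
        by (simp add: inner_diff_right algebra_simps)
      then have e1: "exp (?a \<bullet> x) * exp (- ?a \<bullet> (x - y)) = exp (?a \<bullet> y)"
        by (simp only: exp_add[symmetric])
      have "p * (q * m) + B * m = m * (v + B)" if "p * q = v" for p q m v :: real
        using that by (simp add: algebra_simps)
      from this[OF e1] show ?thesis by (simp only: Z_def u0_def \<tau>_def)
    qed
    ultimately show ?thesis by simp
  qed
  define u where "u = (\<lambda>t x. if t = 0 then u0 x else exp (?a \<bullet> x) * E t + B)"
  have ms: "mild_solution \<alpha> 2 2 u0 u"
    unfolding mild_solution_def
    by (intro exI[of _ Z] conjI Z) (use conv in \<open>auto simp: u_def has_bochner_integral_iff\<close>)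
  have sm: "smooth_of_order k u0"
    using cont_differentiable_exp_inner[of _ 1 ?a B] by (simp add: smooth_of_order_def u0_def)
  define x1 where "x1 = (1/4) *\<^sub>R e"
  define x2 where "x2 = - (1/4) *\<^sub>R e"
  have nx: "norm x1 = 1/4" "norm x2 = 1/4" using e by (auto simp: x1_def x2_def)
  have u1: "u 1 x1 = exp (A / 4) * mittag_leffler \<alpha> (A\<^sup>2) + B"
    using e by (simp add: u_def x1_def E_def)
  have u2: "u s x2 = exp (- (A / 4)) * mittag_leffler \<alpha> (A\<^sup>2 * s powr \<alpha>) + B"
    using e s by (simp add: u_def x2_def E_def)
  have ML1: "1 \<le> mittag_leffler \<alpha> z" if "0 \<le> z" for z using \<alpha> that by (intro mittag_leffler_ge_1) auto
  have u2pos: "u s x2 > 0" unfolding u2 using ML1[of "A\<^sup>2 * s powr \<alpha>"] B by (intro add_pos_pos mult_pos_pos) auto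
  define R where "R = (\<lambda>t::real. 2 * t powr (\<alpha> / 2))"
  let ?I = "\<lambda>t. indicat_real (ball (0::'a) (R t))"
  define P where "P = (\<lambda>t x. local_potential (?k t) (R t) u0 x)"
  define G where "G = (\<lambda>t. LINT z|(lborel :: 'a measure). ?k t z * ?I t z)"
  have [measurable]: "ball (0::'a) \<rho> \<in> sets borel" for \<rho> by simp
  have int_k: "integrable lborel (\<lambda>z::'a. ?k t z * ?I t z)" if t: "t > 0" for t
  proof (rule Bochner_Integration.integrable_bound)
    have "integrable lborel (Z t)" using Z t by (auto simp: fundamental_solution_def has_bochner_integral_iff)
    then show "integrable lborel (\<lambda>z. Z t z / (c1 * t powr (- \<alpha>)))" by simp
    show "AE z in lborel. norm (?k t z * ?I t z) \<le> norm (Z t z / (c1 * t powr (- \<alpha>)))"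
      using AE_lborel_singleton[of "0::'a"]
    proof eventually_elim
      case (elim z)
      show ?case
      proof (cases "norm z < R t")
        case True
        then have "0 < ?k t z" "c1 * t powr (- \<alpha>) * ?k t z \<le> Z t z"
          using near[OF t elim] by (auto simp: R_def)
        moreover have "0 < c1 * t powr (- \<alpha>)" using c t by simp
        moreover have "0 \<le> Z t z" by (simp add: Z_def mixture_nonneg)
        ultimately show ?thesis using True by (simp add: pos_le_divide_eq mult.commute)
      qed simp
    qed
  qed measurable
  have int_ku: "integrable lborel (\<lambda>z::'a. ?k t z * (?I t z * u0 (x - z)))"
    (is "integrable lborel ?f") if t: "t > 0" for t x
  proof (rule Bochner_Integration.integrable_bound)
    define M where "M = exp (A * (norm x + R t)) + B"
    show "integrable lborel (\<lambda>z::'a. M * (?k t z * ?I t z))"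
      using int_k[OF t] by simp
    show "AE z in lborel. norm (?f z) \<le> norm (M * (?k t z * ?I t z))"
    proof (rule AE_I2)
      fix z :: 'a
      show "norm (?f z) \<le> norm (M * (?k t z * ?I t z))"
      proof (cases "norm z < R t")
        case True
        have "e \<bullet> (x - z) \<le> norm e * norm (x - z)" by (rule norm_cauchy_schwarz)
        also have "\<dots> \<le> norm x + R t" using e True norm_triangle_ineq4[of x z] by simp
        finally have "A * (e \<bullet> (x - z)) \<le> A * (norm x + R t)" using A by (rule mult_left_mono)
        then have "u0 (x - z) \<le> M" by (simp add: u0_def M_def)
        then have "\<bar>?k t z\<bar> * u0 (x - z) \<le> \<bar>?k t z\<bar> * M"
          by (intro mult_left_mono) auto
        with True u0pos[of "x - z"] show ?thesis by (simp add: abs_mult M_def B_def mult.commute)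
      qed simp
    qed
    show "?f \<in> borel_measurable lborel" unfolding u0_def by measurable
  qed
  have Peq: "P t x = (LINT z|lborel. ?k t z * (?I t z * u0 (x - z)))"
    if "t > 0" for t x
    unfolding P_def by (rule local_potential_reflect) (rule int_ku[OF that])
  have kpos: "0 < ?k t z" if "t > 0" "z \<noteq> 0" "norm z < R t" for t and z :: 'a
    using near[of t z] that by (simp add: R_def)
  have P1: "P 1 x1 \<le> 2 * B * G 1"
  proof -
    have "P 1 x1 \<le> (LINT z|lborel. 2 * B * (?k 1 z * ?I 1 z))"
      unfolding Peq[OF zero_less_one]
    proof (rule integral_mono_AE)
      show "AE z in lborel. ?k 1 z * (?I 1 z * u0 (x1 - z)) \<le> 2 * B * (?k 1 z * ?I 1 z)"
        using AE_lborel_singleton[of "0::'a"]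
      proof eventually_elim
        case (elim z)
        show ?case
        proof (cases "norm z < R 1")
          case True
          have "e \<bullet> (x1 - z) \<le> norm e * norm (x1 - z)" by (rule norm_cauchy_schwarz)
          also have "\<dots> \<le> 9 / 4" using e True norm_triangle_ineq4[of x1 z] nx by (simp add: R_def)
          finally have "A * (e \<bullet> (x1 - z)) \<le> A * (9 / 4)" using A by (rule mult_left_mono)
          then have "u0 (x1 - z) \<le> 2 * B" by (simp add: u0_def B_def mult.commute)
          then have "?k 1 z * u0 (x1 - z) \<le> ?k 1 z * (2 * B)"
            using kpos[of 1 z] elim True by (intro mult_left_mono) auto
          with True show ?thesis by (simp add: mult_ac)
        qed simp
      qed
    qed (use int_ku[of 1 x1] int_k[of 1] in auto)
    also have "\<dots> = 2 * B * G 1" by (simp add: G_def)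
    finally show ?thesis .
  qed
  have P2: "B * G s \<le> P s x2"
  proof -
    have s0: "s > 0" using s by simp
    have "B * G s = (LINT z|lborel. B * (?k s z * ?I s z))"
      by (simp add: G_def)
    also have "\<dots> \<le> P s x2"
      unfolding Peq[OF s0]
    proof (rule integral_mono_AE)
      show "AE z in lborel. B * (?k s z * ?I s z) \<le> ?k s z * (?I s z * u0 (x2 - z))"
        using AE_lborel_singleton[of "0::'a"]
      proof eventually_elim
        case (elim z)
        show ?case
        proof (cases "norm z < R s")
          case True
          have "B \<le> u0 (x2 - z)" by (simp add: u0_def)
          then have "?k s z * B \<le> ?k s z * u0 (x2 - z)"
            using kpos[OF s0 elim True] by (intro mult_left_mono) auto
          with True show ?thesis by (simp add: mult_ac)
        qed simp
      qed
    qed (use int_ku[of s x2] int_k[of s] s0 in auto)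
    finally show ?thesis .
  qed
  \<comment> \<open>For $d = 2$ the kernel increases with time, and in every dimension the ball grows.\<close>
  have G12: "G 1 \<le> G s"
    unfolding G_def
  proof (rule integral_mono_AE)
    have R1s: "R 1 \<le> R s" using s \<alpha> by (auto simp: R_def ge_one_powr_ge_zero)
    show "AE z in lborel. ?k 1 z * ?I 1 z \<le> ?k s z * ?I s z"
      using AE_lborel_singleton[of "0::'a"]
    proof eventually_elim
      case (elim z)
      show ?case
      proof (cases "norm z < R 1")
        case True
        then show ?thesis using R1s harnack_kernel_mono_time[of \<alpha> 1 s 2 z] \<alpha> s by simp
      next
        case False
        then show ?thesis using kpos[of s z] elim s by (cases "norm z < R s") auto
      qed
    qed
  qed (use int_k s in auto)
  have G1: "G 1 > 0"
  proof -
    have nn: "AE z in lborel. 0 \<le> ?k 1 z * ?I 1 z"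
      using AE_lborel_singleton[of "0::'a"]
      by eventually_elim (use kpos[of 1] in \<open>auto simp: indicator_def intro: less_imp_le\<close>)
    have "G 1 \<noteq> 0"
    proof
      assume "G 1 = 0"
      then have "AE z in lborel. ?k 1 z * ?I 1 z = 0"
        unfolding G_def using integral_nonneg_eq_0_iff_AE[OF int_k[of 1] nn] by simp
      then have "AE z in lborel. (z::'a) \<notin> ball 0 (R 1)"
        using AE_lborel_singleton[of "0::'a"]
      proof eventually_elim
        case (elim z)
        then show ?case using kpos[of 1 z] by (auto simp: indicator_def)
      qed
      then have "ball (0::'a) (R 1) \<in> null_sets lborel"
        by (subst AE_iff_null_sets) auto
      then have "negligible (ball (0::'a) (R 1))"
        by (simp add: negligible_iff_null_sets null_sets_completionI)
      then show False using open_not_negligible[of "ball (0::'a) (R 1)"] by (simp add: R_def)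
    qed
    moreover have "0 \<le> G 1" unfolding G_def by (rule integral_nonneg_AE[OF nn])
    ultimately show ?thesis by simp
  qed
  have Pspos: "P s x2 > 0" using P2 G12 G1 B mult_pos_pos[of B "G s"] by linarith
  have ratio: "P 1 x1 / P s x2 \<le> 2"
  proof -
    have "P 1 x1 \<le> 2 * (B * G 1)" using P1 by simp
    also have "\<dots> \<le> 2 * (B * G s)" using G12 B by simp
    also have "\<dots> \<le> 2 * P s x2" using P2 by simp
    finally show ?thesis using Pspos by (simp add: pos_divide_le_eq)
  qed
  have Cs: "C s > 0" using C s by (simp add: harnack_constant_def)
  have "ereal (u 1 x1) \<le> ereal (C (s / 1)) * (1 + ext_ratio (P 1 x1) (P s x2)) * ereal (u s x2)"
  proof -
    have hyp: "0 < (1/2::real) \<and> smooth_of_order k u0 \<and> (\<forall>x. 0 \<le> u0 x) \<and> (\<exists>x. u0 x \<noteq> 0) \<and>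
        mild_solution \<alpha> 2 2 u0 u \<and> (2 * (1/2)) powr (2 / \<alpha>) \<le> (1::real) \<and> 1 < s \<and>
        s \<le> 1 + (2 * (1/2)) powr (2 / \<alpha>) \<and> 1 + (2 * (1/2)) powr (2 / \<alpha>) \<le> (2::real)"
      using sm u0pos ms s less_imp_le[OF u0pos] by (auto intro!: exI[of _ 0] simp: less_imp_neq[OF u0pos, symmetric])
    have x: "x1 \<in> ball 0 (1/2)" "x2 \<in> ball 0 (1/2)" using nx by simp_all
    have H: "(real DIM('a) > 2 \<longrightarrow>
              ereal (u 1 x1) \<le> ereal (C (s / 1)) * (1 + riesz_ratio \<alpha> 2 u0 1 s x1 x2) * ereal (u s x2)) \<and>
           (real DIM('a) = 2 \<longrightarrow>
              ereal (u 1 x1) \<le> ereal (C (s / 1)) * (1 + log_ratio \<alpha> 2 u0 1 s x1 x2) * ereal (u s x2))"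
      using C hyp x unfolding harnack_constant_def by blast
    show ?thesis
    proof (cases "real DIM('a) > 2")
      case True
      with H show ?thesis unfolding riesz_ratio_eq[OF True] by (simp add: P_def R_def)
    next
      case False
      with d have eq: "real DIM('a) = 2" by simp
      with H show ?thesis unfolding log_ratio_eq[OF eq] by (simp add: P_def R_def)
    qed
  qed
  then have "u 1 x1 \<le> C s * (1 + P 1 x1 / P s x2) * u s x2"
    using Pspos by (simp add: ext_ratio_def one_ereal_def)
  also have "\<dots> \<le> C s * 3 * u s x2"
    using ratio Cs u2pos by (intro mult_right_mono mult_left_mono) auto
  finally have "u 1 x1 / (3 * u s x2) \<le> C s" using u2pos by (simp add: pos_divide_le_eq mult_ac)
  moreover have "exp (A / 4) * mittag_leffler \<alpha> (A\<^sup>2) / (3 * u s x2) \<le> u 1 x1 / (3 * u s x2)"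
    unfolding u1 using u2pos B by (intro divide_right_mono) auto
  ultimately show ?thesis by (simp add: u2 B_def)
qed

text \<open>Given $M$, first $A$ is chosen so large that $E_\alpha(A^2) \ge e^{5A/2}$ and $e^{A/2}/6 > M$, then $s \to 1$. The
exponent $5/2 = 9/4 + 1/4$ makes the constant part of the datum at most the exponential part of the
solution at $x_2$.\<close>

lemma harnack_constant_blowup:
  assumes \<alpha>: "0 < \<alpha>" "\<alpha> < 1" and d: "2 \<le> real DIM('a::euclidean_space)"
    and C: "harnack_constant TYPE('a) k \<alpha> 2 C"
  shows "filterlim C at_top (at_right 1)"
  unfolding filterlim_at_top
proof
  fix M :: real
  obtain c where c: "\<And>z. 0 \<le> z \<Longrightarrow> exp z - c * exp (z / 2) \<le> mittag_leffler \<alpha> z"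
    using mittag_leffler_growth[of \<alpha>] \<alpha> by auto
  have "eventually (\<lambda>A::real. exp (5 / 2 * A) \<le> exp (A\<^sup>2) - c * exp (A\<^sup>2 / 2)) at_top" by real_asymp
  moreover have "eventually (\<lambda>A::real. M < exp (A / 2) / 6) at_top" by real_asymp
  ultimately have "eventually (\<lambda>A. exp (5 / 2 * A) \<le> exp (A\<^sup>2) - c * exp (A\<^sup>2 / 2) \<and> M < exp (A / 2) / 6 \<and> 0 \<le> A) at_top"
    using eventually_ge_at_top[of 0] by eventually_elim auto
  then obtain A where A: "exp (5 / 2 * A) \<le> exp (A\<^sup>2) - c * exp (A\<^sup>2 / 2)" "M < exp (A / 2) / 6" "0 \<le> A"
    using eventually_happens'[OF trivial_limit_at_top_linorder] by blast
  define E where "E = mittag_leffler \<alpha> (A\<^sup>2)"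
  define f where "f = (\<lambda>s. exp (A / 4) * E / (3 * (exp (- (A / 4)) * mittag_leffler \<alpha> (A\<^sup>2 * s powr \<alpha>) + exp (9 / 4 * A))))"
  have E: "exp (5 / 2 * A) \<le> E" unfolding E_def using A(1) c[of "A\<^sup>2"] by simp
  have E0: "E > 0" using E less_le_trans[OF exp_gt_zero] by blast
  have "(f \<longlongrightarrow> exp (A / 4) * E / (3 * (exp (- (A / 4)) * mittag_leffler \<alpha> (A\<^sup>2 * 1 powr \<alpha>) + exp (9 / 4 * A)))) (at_right 1)"
    unfolding f_def
  proof (intro tendsto_intros isCont_tendsto_compose[OF continuous_mittag_leffler])
    have "exp (- (A / 4)) * mittag_leffler \<alpha> (A\<^sup>2 * 1 powr \<alpha>) + exp (9 / 4 * A) > 0"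
      using E0 by (intro add_pos_pos mult_pos_pos) (auto simp: E_def)
    then show "3 * (exp (- (A / 4)) * mittag_leffler \<alpha> (A\<^sup>2 * 1 powr \<alpha>) + exp (9 / 4 * A)) \<noteq> 0" by simp
  qed (use \<alpha> in auto)
  moreover have "M < exp (A / 4) * E / (3 * (exp (- (A / 4)) * mittag_leffler \<alpha> (A\<^sup>2 * 1 powr \<alpha>) + exp (9 / 4 * A)))"
  proof -
    have "exp (9 / 4 * A) = exp (- (A / 4)) * exp (5 / 2 * A)" by (simp flip: exp_add)
    also have "\<dots> \<le> exp (- (A / 4)) * E" using E by (intro mult_left_mono) auto
    finally have le: "exp (9 / 4 * A) \<le> exp (- (A / 4)) * E" .
    have "3 * (a + b) \<le> 6 * a" if "b \<le> a" for a b :: real using that by simp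
    from this[OF le] have "3 * (exp (- (A / 4)) * E + exp (9 / 4 * A)) \<le> 6 * (exp (- (A / 4)) * E)" .
    then have "exp (A / 4) * E / (6 * (exp (- (A / 4)) * E)) \<le> exp (A / 4) * E / (3 * (exp (- (A / 4)) * E + exp (9 / 4 * A)))"
      using E0 by (intro divide_left_mono mult_pos_pos add_pos_pos) auto
    moreover have "exp (A / 4) * E / (6 * (exp (- (A / 4)) * E)) = exp (A / 2) / 6"
    proof -
      have "exp (A / 2) * exp (- (A / 4)) = exp (A / 4)" by (simp flip: exp_add)
      then show ?thesis using E0 by (simp add: field_simps)
    qed
    ultimately show ?thesis using A(2) by (simp add: E_def)
  qed
  ultimately have "eventually (\<lambda>s. M < f s) (at_right 1)" by (rule order_tendstoD)
  moreover have "eventually (\<lambda>s::real. 1 < s \<and> s \<le> 2) (at_right 1)"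
    unfolding eventually_at_right_field by (intro exI[of _ 2]) auto
  ultimately show "eventually (\<lambda>s. M \<le> C s) (at_right 1)"
  proof eventually_elim
    case (elim s)
    have "f s \<le> C s" unfolding f_def E_def
      using elim A by (intro harnack_constant_lower_bound[OF \<alpha> d C]) auto
    with elim show ?case by simp
  qed
qed

theorem theorem2p4:
  fixes \<alpha> \<beta> :: real and k :: enat
  assumes "0 < \<alpha>" and "\<alpha> < 1" and "0 < \<beta>" and "\<beta> \<le> 2"
  shows "(\<exists>C. harnack_constant TYPE('a::euclidean_space) k \<alpha> \<beta> C) \<and>
         (\<beta> = 2 \<and> \<beta> \<le> real DIM('a) \<longrightarrow>
            (\<forall>C. harnack_constant TYPE('a) k \<alpha> \<beta> C \<longrightarrow> filterlim C at_top (at_right 1)))"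
  using harnack_constant_exists[OF assms] harnack_constant_blowup[OF assms(1,2)] by auto

end
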